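(* Let $m\ge 1$ be a fixed integer and let $B_{n,m}$ be the random bipartite graph described in the context. Define \[ c_m:=1-\frac{1.5}{1+(m+1)\left(1+e^{-1}\sum_{j=0}^{m}\frac{1}{j!}-\log 2\right)} . \] Then, as $n\to\infty$, (1) $\mathbb P\bigl(B_{n,m}\text{ has a perfect matching}\bigr)\ge 1-O\bigl(n^{-c_m+o(1)}\bigr)$; (2) $\mathbb P\bigl(B_{n,m}\text{ is connected}\bigr)=1-O\bigl(n^{-c_m+o(1)}\bigr)$. Here $c_1\approx 0.514$ and $c_m\uparrow 1$ as $m\to\infty$.
   Context: Let $V_1,V_2$ be disjoint vertex sets with $|V_1|=|V_2|=n$. The random bipartite graph $B_{n,m}$ (for a fixed integer $m\ge 0$) with bipartition $(V_1,V_2)$ is generated in two rounds. In the first round, every vertex $v\in V_1\cup V_2$ selects one vertex from the opposite side uniformly at random, independently of all other selections. A vertex is called unpopular if, in the first round, it was selected by at most $m$ vertices. In the second round, each unpopular vertex makes one more selection of a vertex from the opposite side, uniformly at random and independently of everything else. The edge set of $B_{n,m}$ consists of all pairs $\{v,w\}$ such that $v$ selected $w$ in some round. A perfect matching is a set of $n$ pairwise disjoint edges of $B_{n,m}$. The $o(1)$ in the exponent tends to $0$ as $n\to\infty$. *)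

theory Defs
  imports "HOL-Probability.Probability" "HOL-Library.Landau_Symbols"
begin

definition opposite :: "'a set \<Rightarrow> 'a set \<Rightarrow> 'a \<Rightarrow> 'a set" where
  "opposite V1 V2 v = (if v \<in> V1 then V2 else V1)"

text \<open>
  Independent uniform selections from the opposite side, made by the vertices in \<open>S\<close>.
  Outside \<open>S\<close> the selection function takes the dummy value \<open>undefined\<close>.
\<close>
definition selections :: "'a set \<Rightarrow> 'a set \<Rightarrow> 'a set \<Rightarrow> ('a \<Rightarrow> 'a) pmf" where
  "selections V1 V2 S = Pi_pmf S undefined (\<lambda>v. pmf_of_set (opposite V1 V2 v))"

definition unpopular :: "'a set \<Rightarrow> 'a set \<Rightarrow> nat \<Rightarrow> ('a \<Rightarrow> 'a) \<Rightarrow> 'a set" where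
  "unpopular V1 V2 m f = {v \<in> V1 \<union> V2. card {u \<in> V1 \<union> V2. f u = v} \<le> m}"

text \<open>
  The law of the edge set of the random bipartite graph with bipartition \<open>(V1, V2)\<close>; edges are
  unordered pairs. Here \<open>f\<close> and \<open>g\<close> are the first-round and second-round selections.
\<close>
definition random_bipartite :: "'a set \<Rightarrow> 'a set \<Rightarrow> nat \<Rightarrow> 'a set set pmf" where
  "random_bipartite V1 V2 m =
     bind_pmf (selections V1 V2 (V1 \<union> V2)) (\<lambda>f.
       map_pmf (\<lambda>g. (\<lambda>v. {v, f v}) ` (V1 \<union> V2) \<union> (\<lambda>v. {v, g v}) ` unpopular V1 V2 m f)
         (selections V1 V2 (unpopular V1 V2 m f)))"

definition has_perfect_matching :: "nat \<Rightarrow> 'a set set \<Rightarrow> bool" where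
  "has_perfect_matching n E \<longleftrightarrow> (\<exists>M \<subseteq> E. finite M \<and> card M = n \<and> disjoint M)"

definition connected_graph :: "'a set \<Rightarrow> 'a set set \<Rightarrow> bool" where
  "connected_graph V E \<longleftrightarrow> V \<noteq> {} \<and> (\<forall>u\<in>V. \<forall>v\<in>V. (u, v) \<in> {(x, y). {x, y} \<in> E}\<^sup>*)"

definition c_exp :: "nat \<Rightarrow> real" where
  "c_exp m = 1 - 1.5 / (1 + (real m + 1) * (1 + exp (-1) * (\<Sum>j=0..m. 1 / fact j) - ln 2))"

end

theory Submission imports Defs begin

text \<open>
  Both failure probabilities are in fact \<open>O(1/n)\<close>, which suffices since \<open>c_exp m \<le> 1\<close>.

  If there is no perfect matching, a smallest violator \<open>S\<close> of Hall's condition, taken over both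
  sides, has \<open>k \<le> (n + 1) / 2\<close> elements, exactly \<open>k - 1\<close> neighbours, and each of these neighbours
  has at least two neighbours in \<open>S\<close>. The last property is essential, because the expected number
  of all violators is exponentially large. About \<open>2 k\<close> selections leave \<open>S\<close>, and they have to hit
  each of \<open>k - 1\<close> vertices twice, up to the selections made by these vertices themselves. All
  these occupancy conditions are bounded through exponential generating functions evaluated at a
  fixed point, giving a union bound of \<open>1/n\<close> times a polynomial in \<open>k\<close> times \<open>0.995 ^ k\<close>. For
  \<open>k \<le> n / 1000\<close> the second round outside of \<open>S\<close> and its neighbourhood can be ignored; for larger
  \<open>k\<close> it is needed, but then polynomial losses in \<open>n\<close> are harmless.

  If the graph is disconnected, some union of components has \<open>k1 + k2 \<le> n\<close> vertices on the two
  sides. The first round alone makes the expected number of such pairs of sets at most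
  \<open>(min / max) ^ (max - min) \<le> 1\<close>. Since at least half of the vertices of a union of components are
  unpopular, the second round contributes a factor of at most \<open>(max / n) ^ ((k1 + k2) / 2)\<close>.
\<close>

section \<open>Averages over finite product sets\<close>

text \<open>The factor 1/n has a single source. With \<open>x = k / n\<close>, choosing
  \<open>S\<close> and \<open>W\<close> costs at most
  \<open>x / (x ^ (2 * k) * (1 - x) ^ (n - k))\<close> once the first selections of the
  \<open>n - k + 1\<close> vertices opposite \<open>S\<close> and outside \<open>W\<close> are
  charged; the lone \<open>x\<close> appears because \<open>W\<close> has one vertex fewer than
  \<open>S\<close>. Everything else has to decay exponentially in \<open>k\<close>. The leftover
  \<open>1 / (1 - x) ^ (n - k)\<close> is at most a factor e per element of \<open>S\<close>. For
  small \<open>x\<close> the conditions inside \<open>S \<union> W\<close> beat it. For larger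
  \<open>x\<close> the second round lowers it to \<open>exp (1 - q)\<close>, where \<open>q\<close>
  is the probability that a Poisson variable of mean \<open>1 - x\<close> is at most 1. The obstacle
  is that the in-degrees of different vertices are dependent. A coefficient of a power series with
  nonnegative coefficients is bounded through its value at any positive point, so no asymptotic
  analysis is required: a good point is fixed, and an inequality between explicit numbers
  remains.\<close>

definition avg :: "'i set \<Rightarrow> ('i \<Rightarrow> 'b set) \<Rightarrow> (('i \<Rightarrow> 'b) \<Rightarrow> real) \<Rightarrow> real" where
  "avg I X F = (\<Sum>h\<in>PiE I X. F h) / (\<Prod>i\<in>I. real (card (X i)))"

lemma avg_mono:
  assumes "\<And>h. h \<in> PiE I X \<Longrightarrow> F h \<le> G h"
  shows "avg I X F \<le> avg I X G"
  unfolding avg_def by (intro divide_right_mono sum_mono assms prod_nonneg) auto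

lemma avg_cong:
  assumes "\<And>h. h \<in> PiE I X \<Longrightarrow> F h = G h"
  shows "avg I X F = avg I X G"
  unfolding avg_def using assms by simp

lemma avg_nonneg:
  assumes "\<And>h. h \<in> PiE I X \<Longrightarrow> 0 \<le> F h"
  shows "0 \<le> avg I X F"
  unfolding avg_def by (intro divide_nonneg_nonneg sum_nonneg assms prod_nonneg) auto

lemma avg_cmult: "avg I X (\<lambda>h. c * F h) = c * avg I X F"
  unfolding avg_def by (simp add: sum_distrib_left)

lemma avg_sum: "avg I X (\<lambda>h. \<Sum>a\<in>A. F a h) = (\<Sum>a\<in>A. avg I X (F a))"
  unfolding avg_def by (subst sum.swap) (simp add: sum_divide_distrib)

lemma avg_prod:
  assumes "finite I" "\<And>i. i \<in> I \<Longrightarrow> finite (X i)"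
  shows "avg I X (\<lambda>h. \<Prod>i\<in>I. \<phi> i (h i)) = (\<Prod>i\<in>I. (\<Sum>y\<in>X i. \<phi> i y) / real (card (X i)))"
  unfolding avg_def using assms by (simp add: prod_sum_PiE prod_dividef)

lemma avg_const:
  assumes "finite I" "\<And>i. i \<in> I \<Longrightarrow> finite (X i) \<and> X i \<noteq> {}"
  shows "avg I X (\<lambda>_. c) = c"
  unfolding avg_def using assms by (simp add: card_PiE)

text \<open>Fubini for functions glued from two blocks of slots. It allows the selections that
  decide popularity to be frozen while the selections depending on them are averaged.\<close>

lemma avg_Un:
  assumes "finite I" "finite J" "I \<inter> J = {}"
  shows "avg (I \<union> J) X F = avg I X (\<lambda>h1. avg J X (\<lambda>h2. F (\<lambda>i. if i \<in> I then h1 i else h2 i)))"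
proof -
  have "(\<Sum>h\<in>PiE (I \<union> J) X. F h)
      = (\<Sum>(h1,h2)\<in>PiE I X \<times> PiE J X. F (\<lambda>i. if i \<in> I then h1 i else h2 i))"
    by (rule sum.reindex_bij_witness[where j="\<lambda>h. (restrict h I, restrict h J)"
          and i="\<lambda>(h1,h2) i. if i \<in> I then h1 i else h2 i"])
       (use assms in \<open>auto simp: PiE_def extensional_def fun_eq_iff restrict_def intro!: arg_cong[of _ _ F]\<close>)
  also have "\<dots> = (\<Sum>h1\<in>PiE I X. \<Sum>h2\<in>PiE J X. F (\<lambda>i. if i \<in> I then h1 i else h2 i))"
    by (simp add: sum.cartesian_product)
  finally show ?thesis
    unfolding avg_def using assms by (simp add: prod.union_disjoint sum_divide_distrib mult.commute)
qed

text \<open>Discards slots that the event does not read, in particular the fictitious second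
  selections of popular vertices.\<close>

lemma avg_restrict:
  assumes "finite I" "J \<subseteq> I" "\<And>i. i \<in> I \<Longrightarrow> finite (X i) \<and> X i \<noteq> {}"
    and "\<And>h h'. (\<And>i. i \<in> J \<Longrightarrow> h i = h' i) \<Longrightarrow> F h = F h'"
  shows "avg I X F = avg J X F"
proof -
  have "I = J \<union> (I - J)" using assms(2) by auto
  then have "avg I X F = avg (J \<union> (I - J)) X F" by simp
  also have "\<dots> = avg J X (\<lambda>h1. avg (I - J) X (\<lambda>h2. F (\<lambda>i. if i \<in> J then h1 i else h2 i)))"
    using assms(1,2) by (intro avg_Un) (auto intro: finite_subset)
  also have "\<dots> = avg J X (\<lambda>h1. avg (I - J) X (\<lambda>h2. F h1))"
    by (intro avg_cong assms(4)) auto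
  also have "\<dots> = avg J X F"
    using assms(1,3) by (subst avg_const) auto
  finally show ?thesis .
qed

text \<open>
  The left-hand side is \<open>card I\<close> factorial times the coefficient of \<open>z\<close> to the power \<open>card I\<close> in
  the product of the exponential generating functions of the \<open>F b\<close>.
\<close>

lemma sum_PiE_occupancy:
  fixes F :: "'b \<Rightarrow> nat \<Rightarrow> real"
  assumes "finite B" "finite I" "z > 0"
    and "\<And>b d. b \<in> B \<Longrightarrow> 0 \<le> F b d"
    and "\<And>b N. b \<in> B \<Longrightarrow> (\<Sum>d\<le>N. F b d * z ^ d / fact d) \<le> \<Phi> b"
  shows "(\<Sum>h\<in>PiE I (\<lambda>_. B). \<Prod>b\<in>B. F b (card {i\<in>I. h i = b}))
           \<le> fact (card I) / z ^ card I * (\<Prod>b\<in>B. \<Phi> b)"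
  using assms(1,2,4,5)
proof (induction B arbitrary: I rule: finite_induct)
  case empty
  then show ?case using \<open>z > 0\<close>
    by (cases "I = {}") (auto simp: PiE_eq_empty_iff)
next
  case (insert b B)
  define P where "P = (\<Prod>b\<in>B. \<Phi> b)"
  \<comment> \<open>The case \<open>N = 0\<close> of the bound on partial sums reads
    \<open>F c 0 \<le> \<Phi> c\<close>, which gives nonnegativity.\<close>
  have \<Phi>0: "0 \<le> \<Phi> c" if "c \<in> insert b B" for c
    using insert.prems(3)[OF that, of 0] insert.prems(2)[OF that, of 0] by simp
  have P0: "0 \<le> P" unfolding P_def by (intro prod_nonneg \<Phi>0) auto
  \<comment> \<open>Peel off \<open>b\<close>: a function is determined by its fibre
    \<open>D\<close> over \<open>b\<close> and its restriction to \<open>I - D\<close>, which takes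
    values in \<open>B\<close>.\<close>
  have "(\<Sum>h\<in>PiE I (\<lambda>_. insert b B). \<Prod>c\<in>insert b B. F c (card {i\<in>I. h i = c}))
     = (\<Sum>(D,h)\<in>(SIGMA D:Pow I. PiE (I - D) (\<lambda>_. B)).
          F b (card D) * (\<Prod>c\<in>B. F c (card {i\<in>I-D. h i = c})))"
  proof (rule sum.reindex_bij_witness[where
      j="\<lambda>h. ({i\<in>I. h i = b}, restrict h {i\<in>I. h i \<noteq> b})"
      and i="\<lambda>(D,h) i. if i \<in> D then b else h i"], goal_cases)
    case (1 h)
    then show ?case by (auto simp: PiE_def extensional_def fun_eq_iff restrict_def)
  next
    case (2 h)
    have "I - {i\<in>I. h i = b} = {i\<in>I. h i \<noteq> b}" by auto
    with 2 show ?case by (auto simp: PiE_def Pi_def)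
  next
    case (3 a)
    obtain D h where a: "a = (D,h)" by force
    have D: "D \<subseteq> I" "h \<in> PiE (I - D) (\<lambda>_. B)" using 3 a by auto
    have ne: "h i \<noteq> b" if "i \<in> I - D" for i using D that insert.hyps(2) by (metis PiE_mem)
    have und: "h i = undefined" if "i \<notin> I - D" for i using D that by (metis PiE_arb)
    have "{i \<in> I. (if i \<in> D then b else h i) = b} = D" using D ne by auto
    moreover have "restrict (\<lambda>i. if i \<in> D then b else h i) {i \<in> I. (if i \<in> D then b else h i) \<noteq> b} = h"
      using ne und D by (auto simp: restrict_def fun_eq_iff)
    ultimately show ?case by (simp add: a)
  next
    case (4 a)
    then show ?case by (auto simp: PiE_def Pi_def extensional_def)
  next
    case (5 h)
    have "(\<Prod>c\<in>B. F c (card {i\<in>I. h i = c}))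
        = (\<Prod>c\<in>B. F c (card {i\<in>I-{i\<in>I. h i = b}. restrict h {i\<in>I. h i \<noteq> b} i = c}))"
      using insert.hyps(2) by (intro prod.cong refl arg_cong[of _ _ "F _"] arg_cong[of _ _ card]) auto
    then show ?case using insert.hyps by simp
  qed
  also have "\<dots> = (\<Sum>D\<in>Pow I. F b (card D) *
        (\<Sum>h\<in>PiE (I - D) (\<lambda>_. B). \<Prod>c\<in>B. F c (card {i\<in>I-D. h i = c})))"
    using insert.prems(1) insert.hyps(1)
    by (subst sum.Sigma[symmetric]) (auto simp: sum_distrib_left intro!: finite_PiE)
  also have "\<dots> \<le> (\<Sum>D\<in>Pow I. F b (card D) * (fact (card (I - D)) / z ^ card (I - D) * P))"
    unfolding P_def using insert.prems
    by (intro sum_mono mult_left_mono insert.IH) auto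
  also have "\<dots> = (\<Sum>D\<in>Pow I. F b (card D) * (fact (card I - card D) / z ^ (card I - card D) * P))"
    using insert.prems(1) by (intro sum.cong refl) (auto simp: card_Diff_subset finite_subset)
  also have "\<dots> = (\<Sum>d\<le>card I. \<Sum>D\<in>{D\<in>Pow I. card D = d}.
        F b (card D) * (fact (card I - card D) / z ^ (card I - card D) * P))"
    using insert.prems(1) by (intro sum.group[symmetric]) (auto intro: card_mono)
  also have "\<dots> = (\<Sum>d\<le>card I. real (card I choose d) * (F b d * (fact (card I - d) / z ^ (card I - d) * P)))"
  proof (intro sum.cong refl)
    fix d
    have "card {D\<in>Pow I. card D = d} = card I choose d"
      using n_subsets[OF insert.prems(1), of d] by (simp add: Pow_def)
    then show "(\<Sum>D\<in>{D\<in>Pow I. card D = d}.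
        F b (card D) * (fact (card I - card D) / z ^ (card I - card D) * P))
       = real (card I choose d) * (F b d * (fact (card I - d) / z ^ (card I - d) * P))"
      by simp
  qed
  \<comment> \<open>The binomial coefficient splits the factorial of \<open>card I\<close>, which is
    what makes exponential generating functions multiply.\<close>
  also have "\<dots> = (\<Sum>d\<le>card I. fact (card I) / z ^ card I * P * (F b d * z ^ d / fact d))"
  proof (intro sum.cong refl)
    fix d assume "d \<in> {..card I}"
    then have d: "d \<le> card I" by simp
    have "z ^ card I = z ^ d * z ^ (card I - d)" using d by (simp flip: power_add)
    moreover have "real (card I choose d) = fact (card I) / (fact d * fact (card I - d))"
      using d by (rule binomial_fact)
    ultimately show "real (card I choose d) * (F b d * (fact (card I - d) / z ^ (card I - d) * P))
        = fact (card I) / z ^ card I * P * (F b d * z ^ d / fact d)"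
      using \<open>z > 0\<close> by (simp add: field_simps)
  qed
  also have "\<dots> = fact (card I) / z ^ card I * P * (\<Sum>d\<le>card I. F b d * z ^ d / fact d)"
    by (simp add: sum_distrib_left)
  \<comment> \<open>No fibre exceeds \<open>card I\<close>, so only a partial sum of the series for
    \<open>b\<close> occurs and summability never enters.\<close>
  also have "\<dots> \<le> fact (card I) / z ^ card I * P * \<Phi> b"
    using insert.prems(3)[of b] P0 \<open>z > 0\<close> by (intro mult_left_mono) auto
  finally show ?case using insert.hyps by (simp add: P_def mult_ac)
qed

section \<open>The random graph as a uniform choice\<close>

lemma pair_pmf_of_set:
  assumes "finite A" "A \<noteq> {}" "finite B" "B \<noteq> {}"
  shows "pair_pmf (pmf_of_set A) (pmf_of_set B) = pmf_of_set (A \<times> B)"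
proof (rule pmf_eqI)
  fix i :: "'a \<times> 'b"
  obtain a b where i: "i = (a, b)" by force
  show "pmf (pair_pmf (pmf_of_set A) (pmf_of_set B)) i = pmf (pmf_of_set (A \<times> B)) i"
    using assms by (simp add: i pmf_pair indicator_def card_cartesian_product)
qed

lemma opposite_commute:
  "V1 \<inter> V2 = {} \<Longrightarrow> v \<in> V1 \<union> V2 \<Longrightarrow> opposite V1 V2 v = opposite V2 V1 v"
  by (auto simp: opposite_def)

definition sel_edges :: "'a set \<Rightarrow> 'a set \<Rightarrow> nat \<Rightarrow> ('a \<times> bool \<Rightarrow> 'a) \<Rightarrow> 'a set set" where
  "sel_edges V1 V2 m h = (\<lambda>v. {v, h (v, False)}) ` (V1 \<union> V2) \<union>
     (\<lambda>v. {v, h (v, True)}) ` unpopular V1 V2 m (\<lambda>v. h (v, False))"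

abbreviation slot_range :: "'a set \<Rightarrow> 'a set \<Rightarrow> 'a \<times> bool \<Rightarrow> 'a set" where
  "slot_range V1 V2 \<equiv> \<lambda>i. opposite V1 V2 (fst i)"

text \<open>
  Letting every vertex make its second selection, and ignoring that of the popular ones, turns the
  two rounds into a single uniform choice: slot \<open>(v, False)\<close> holds the first and slot
  \<open>(v, True)\<close> the second selection of \<open>v\<close>.
\<close>

lemma prob_random_bipartite:
  assumes fin: "finite V1" "finite V2" and ne: "V1 \<noteq> {}" "V2 \<noteq> {}"
  shows "measure_pmf.prob (random_bipartite V1 V2 m) {E. Q E}
    = avg ((V1 \<union> V2) \<times> UNIV) (slot_range V1 V2) (\<lambda>h. of_bool (Q (sel_edges V1 V2 m h)))"
proof -
  define V where "V = V1 \<union> V2"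
  define \<Omega> where "\<Omega> = PiE V (opposite V1 V2)"
  define \<Omega>2 where "\<Omega>2 = PiE (V \<times> UNIV) (slot_range V1 V2)"
  define edg where "edg f g = (\<lambda>v. {v, f v}) ` V \<union> (\<lambda>v. {v, g v}) ` unpopular V1 V2 m f"
    for f g :: "'a \<Rightarrow> 'a"
  define join where "join = (\<lambda>(f :: 'a \<Rightarrow> 'a, g) i. if snd i then g (fst i) else f (fst i))"
  have finV: "finite V" using fin by (simp add: V_def)
  have opp: "finite (opposite V1 V2 v)" "opposite V1 V2 v \<noteq> {}" for v
    using fin ne by (auto simp: opposite_def)
  have \<Omega>: "finite \<Omega>" "\<Omega> \<noteq> {}"
    using finV opp by (auto simp: \<Omega>_def PiE_eq_empty_iff intro!: finite_PiE)
  have \<Omega>2: "finite \<Omega>2" "\<Omega>2 \<noteq> {}"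
    using finV opp by (auto simp: \<Omega>2_def PiE_eq_empty_iff intro!: finite_PiE)
  have dflt: "PiE_dflt V undefined (opposite V1 V2) = \<Omega>"
    by (auto simp: PiE_dflt_def \<Omega>_def PiE_def Pi_def extensional_def)
  have sel: "selections V1 V2 V = pmf_of_set \<Omega>"
    unfolding selections_def using finV opp by (subst Pi_pmf_of_set) (auto simp: dflt)
  \<comment> \<open>\<open>edg f g\<close> reads \<open>g\<close> only at unpopular vertices, and
    the product law on them is a marginal of the law on all of \<open>V\<close>. Hence a second
    round whose index set depends on \<open>f\<close> can be replaced by one independent of
    \<open>f\<close>.\<close>
  have selU: "map_pmf (edg f) (selections V1 V2 (unpopular V1 V2 m f)) = map_pmf (edg f) (pmf_of_set \<Omega>)" for f
  proof -
    have sub: "unpopular V1 V2 m f \<subseteq> V" by (auto simp: unpopular_def V_def)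
    have "edg f (\<lambda>x. if x \<in> unpopular V1 V2 m f then g x else undefined) = edg f g" for g
      unfolding edg_def by auto
    moreover have "selections V1 V2 (unpopular V1 V2 m f) =
        map_pmf (\<lambda>g x. if x \<in> unpopular V1 V2 m f then g x else undefined) (pmf_of_set \<Omega>)"
      unfolding sel[symmetric] unfolding selections_def using finV sub by (intro Pi_pmf_subset)
    ultimately show ?thesis by (simp add: pmf.map_comp o_def)
  qed
  have join: "bij_betw join (\<Omega> \<times> \<Omega>) \<Omega>2"
    by (rule bij_betwI[where g="\<lambda>h. (\<lambda>v. h (v, False), \<lambda>v. h (v, True))"])
       (auto simp: join_def \<Omega>_def \<Omega>2_def PiE_def Pi_def extensional_def fun_eq_iff split: if_splits)
  have "unpopular V1 V2 m (\<lambda>v. join (f, g) (v, False)) = unpopular V1 V2 m f" for f g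
    by (simp add: join_def)
  then have edg_join: "sel_edges V1 V2 m (join fg) = edg (fst fg) (snd fg)" for fg
    by (cases fg) (simp add: sel_edges_def edg_def V_def join_def)
  have "random_bipartite V1 V2 m = bind_pmf (pmf_of_set \<Omega>) (\<lambda>f. map_pmf (edg f) (pmf_of_set \<Omega>))"
    unfolding random_bipartite_def V_def[symmetric] sel
    using selU by (simp add: edg_def[abs_def])
  also have "\<dots> = map_pmf (\<lambda>fg. edg (fst fg) (snd fg)) (pair_pmf (pmf_of_set \<Omega>) (pmf_of_set \<Omega>))"
    by (simp add: pair_pmf_def map_bind_pmf map_pmf_def bind_assoc_pmf bind_return_pmf)
  also have "\<dots> = map_pmf (sel_edges V1 V2 m) (map_pmf join (pmf_of_set (\<Omega> \<times> \<Omega>)))"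
    using \<Omega> by (simp add: pair_pmf_of_set pmf.map_comp o_def edg_join)
  also have "map_pmf join (pmf_of_set (\<Omega> \<times> \<Omega>)) = pmf_of_set \<Omega>2"
    using \<Omega> join by (intro map_pmf_of_set_bij_betw) auto
  finally have "measure_pmf.prob (random_bipartite V1 V2 m) {E. Q E}
      = card (\<Omega>2 \<inter> {h. Q (sel_edges V1 V2 m h)}) / card \<Omega>2"
    using \<Omega>2 by (simp add: measure_pmf_of_set vimage_def)
  also have "\<dots> = avg (V \<times> UNIV) (slot_range V1 V2) (\<lambda>h. of_bool (Q (sel_edges V1 V2 m h)))"
    unfolding avg_def using \<Omega>2(1) finV
    by (simp add: \<Omega>2_def card_PiE sum.If_cases of_bool_def)
  finally show ?thesis by (simp add: V_def)
qed

section \<open>Obstructions to a perfect matching\<close>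

text \<open>The induction of Halmos and Vaughan. If some proper nonempty \<open>S\<close> is tight,
  match \<open>S\<close> within its neighbourhood and \<open>A - S\<close> outside of it; tightness
  of \<open>S\<close> transfers Hall's condition to the rest. Otherwise every proper nonempty subset
  has a neighbour to spare, so any single edge may be fixed.\<close>

lemma hall_marriage:
  fixes N :: "'a \<Rightarrow> 'b set"
  assumes "finite A" "\<And>v. v \<in> A \<Longrightarrow> finite (N v)"
    and "\<And>S. S \<subseteq> A \<Longrightarrow> card S \<le> card (\<Union>v\<in>S. N v)"
  shows "\<exists>\<phi>. inj_on \<phi> A \<and> (\<forall>v\<in>A. \<phi> v \<in> N v)"
  using assms
proof (induction "card A" arbitrary: A N rule: less_induct)
  case less
  show ?case
  proof (cases "\<exists>S. S \<noteq> {} \<and> S \<subset> A \<and> card (\<Union>v\<in>S. N v) = card S")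
    case True
    then obtain S where S: "S \<noteq> {}" "S \<subset> A" "card (\<Union>v\<in>S. N v) = card S" by blast
    have finS: "finite S" using S less.prems(1) by (auto intro: finite_subset)
    have "\<exists>\<phi>. inj_on \<phi> S \<and> (\<forall>v\<in>S. \<phi> v \<in> N v)"
      using S less.prems finS by (intro less.hyps psubset_card_mono) auto
    then obtain \<phi>1 where \<phi>1: "inj_on \<phi>1 S" "\<forall>v\<in>S. \<phi>1 v \<in> N v" by blast
    have "\<exists>\<phi>. inj_on \<phi> (A - S) \<and> (\<forall>v\<in>A - S. \<phi> v \<in> N v - (\<Union>v\<in>S. N v))"
    proof (rule less.hyps)
      show "card (A - S) < card A" using S less.prems(1) by (intro psubset_card_mono) auto
      fix S' assume S': "S' \<subseteq> A - S"
      have fin': "finite S'" using S' less.prems(1) by (auto intro: finite_subset)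
      have "card S + card S' = card (S \<union> S')"
        using S' finS fin' by (subst card_Un_disjoint) auto
      also have "\<dots> \<le> card (\<Union>v\<in>S \<union> S'. N v)"
        using S S' by (intro less.prems(3)) auto
      also have "(\<Union>v\<in>S \<union> S'. N v) = (\<Union>v\<in>S. N v) \<union> (\<Union>v\<in>S'. N v - (\<Union>v\<in>S. N v))" by auto
      also have "card \<dots> \<le> card S + card (\<Union>v\<in>S'. N v - (\<Union>v\<in>S. N v))"
        using card_Un_le S(3) by metis
      finally show "card S' \<le> card (\<Union>v\<in>S'. N v - (\<Union>v\<in>S. N v))" by simp
    qed (use less.prems in auto)
    then obtain \<phi>2 where \<phi>2: "inj_on \<phi>2 (A - S)" "\<forall>v\<in>A - S. \<phi>2 v \<in> N v - (\<Union>v\<in>S. N v)" by blast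
    define \<phi> where "\<phi> = (\<lambda>v. if v \<in> S then \<phi>1 v else \<phi>2 v)"
    have cross: "\<phi>1 u \<noteq> \<phi>2 v" if "u \<in> S" "v \<in> A - S" for u v
      using that \<phi>1(2) \<phi>2(2) by (metis DiffD2 UN_I)
    have "\<forall>v\<in>A. \<phi> v \<in> N v" using \<phi>1 \<phi>2 by (auto simp: \<phi>_def)
    moreover have "inj_on \<phi> A"
    proof (rule inj_onI)
      fix u v assume uv: "u \<in> A" "v \<in> A" "\<phi> u = \<phi> v"
      show "u = v"
        using uv \<phi>1(1) \<phi>2(1) cross[of u v] cross[of v u]
        by (cases "u \<in> S"; cases "v \<in> S") (auto simp: \<phi>_def dest: inj_onD)
    qed
    ultimately show ?thesis by blast
  next
    case False
    show ?thesis
    proof (cases "A = {}")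
      case False
      then obtain v where v: "v \<in> A" by blast
      have "N v \<noteq> {}" using less.prems(3)[of "{v}"] v by auto
      then obtain w where w: "w \<in> N v" by blast
      have "\<exists>\<phi>. inj_on \<phi> (A - {v}) \<and> (\<forall>u\<in>A - {v}. \<phi> u \<in> N u - {w})"
      proof (rule less.hyps)
        show "card (A - {v}) < card A" using v less.prems(1) by (intro psubset_card_mono) auto
        fix S' assume S': "S' \<subseteq> A - {v}"
        show "card S' \<le> card (\<Union>u\<in>S'. N u - {w})"
        proof (cases "S' = {}")
          case False
          then have "S' \<noteq> {} \<and> S' \<subset> A" using S' v by auto
          then have "card S' \<noteq> card (\<Union>u\<in>S'. N u)"
            using \<open>\<not> (\<exists>S. S \<noteq> {} \<and> S \<subset> A \<and> card (\<Union>v\<in>S. N v) = card S)\<close> by metis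
          moreover have "card S' \<le> card (\<Union>u\<in>S'. N u)" using S' by (intro less.prems(3)) auto
          moreover have "(\<Union>u\<in>S'. N u - {w}) = (\<Union>u\<in>S'. N u) - {w}" by auto
          moreover have "card (\<Union>u\<in>S'. N u) - 1 \<le> card ((\<Union>u\<in>S'. N u) - {w})"
            by (simp add: card_Diff_singleton_if)
          ultimately show ?thesis by simp
        qed simp
      qed (use less.prems in auto)
      then obtain \<phi> where \<phi>: "inj_on \<phi> (A - {v})" "\<forall>u\<in>A - {v}. \<phi> u \<in> N u - {w}" by blast
      have "inj_on (\<phi>(v := w)) A" using \<phi> by (auto simp: inj_on_def)
      moreover have "\<forall>u\<in>A. (\<phi>(v := w)) u \<in> N u" using \<phi> w by auto
      ultimately show ?thesis by blast
    qed simp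
  qed
qed

text \<open>Keeps just those consequences of minimality that the count exploits. Containment of all
  neighbours in \<open>W\<close> together with the degree condition makes \<open>W\<close> exactly
  the neighbourhood of \<open>S\<close>.\<close>

definition hall_obstruction :: "nat \<Rightarrow> 'a set set \<Rightarrow> 'a set \<Rightarrow> 'a set \<Rightarrow> bool" where
  "hall_obstruction n E S W \<longleftrightarrow> 1 \<le> card S \<and> 2 * card S \<le> n + 1 \<and> card W + 1 = card S \<and>
     (\<forall>v\<in>S. \<forall>w. {v, w} \<in> E \<longrightarrow> w \<in> W) \<and> (\<forall>w\<in>W. 2 \<le> card {v\<in>S. {v, w} \<in> E})"

text \<open>All properties come from minimality of \<open>S\<close> among the violators on both
  sides. Deleting a vertex leaves no violator, so the deficiency is exactly 1. The part of the other
  side outside \<open>W\<close> also violates Hall's condition, which bounds \<open>card S\<close>.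
  A vertex of \<open>W\<close> with a unique neighbour in \<open>S\<close> could be removed along
  with that neighbour, leaving a smaller violator.\<close>

lemma no_perfect_matching_imp_obstruction:
  assumes fin: "finite A" "finite B" and n: "card A = n" "card B = n" and disj: "A \<inter> B = {}"
    and E: "\<And>u v. {u, v} \<in> E \<Longrightarrow> u \<in> A \<and> v \<in> B \<or> u \<in> B \<and> v \<in> A"
    and no: "\<not> has_perfect_matching n E"
  shows "\<exists>S W. (S \<subseteq> A \<and> W \<subseteq> B \<or> S \<subseteq> B \<and> W \<subseteq> A) \<and> hall_obstruction n E S W"
proof -
  define N where "N v = {w. {v, w} \<in> E}" for v
  define viol where "viol S \<longleftrightarrow> (S \<subseteq> A \<or> S \<subseteq> B) \<and> card (\<Union>v\<in>S. N v) < card S" for S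
  have NA: "N v \<subseteq> B" if "v \<in> A" for v using E that disj by (auto simp: N_def)
  have NB: "N v \<subseteq> A" if "v \<in> B" for v using E that disj by (auto simp: N_def)
  have "\<exists>S. viol S"
  proof (rule ccontr)
    assume *: "\<nexists>S. viol S"
    have "\<exists>\<phi>. inj_on \<phi> A \<and> (\<forall>v\<in>A. \<phi> v \<in> N v)"
    proof (rule hall_marriage)
      show "finite (N v)" if "v \<in> A" for v using NA[OF that] fin by (auto intro: finite_subset)
      show "card S \<le> card (\<Union>v\<in>S. N v)" if "S \<subseteq> A" for S
        using * that by (auto simp: viol_def not_less)
    qed (use fin in auto)
    then obtain \<phi> where \<phi>: "inj_on \<phi> A" "\<And>v. v \<in> A \<Longrightarrow> \<phi> v \<in> N v" by blast
    have \<phi>B: "\<phi> v \<in> B" if "v \<in> A" for v using \<phi>(2)[OF that] NA[OF that] by auto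
    have inj: "inj_on (\<lambda>v. {v, \<phi> v}) A"
      using \<phi>B disj by (auto simp: inj_on_def doubleton_eq_iff)
    have "has_perfect_matching n E"
      unfolding has_perfect_matching_def
    proof (intro exI[of _ "(\<lambda>v. {v, \<phi> v}) ` A"] conjI)
      show "(\<lambda>v. {v, \<phi> v}) ` A \<subseteq> E" using \<phi>(2) by (auto simp: N_def)
      show "finite ((\<lambda>v. {v, \<phi> v}) ` A)" using fin by simp
      show "card ((\<lambda>v. {v, \<phi> v}) ` A) = n" using inj n by (simp add: card_image)
      show "disjoint ((\<lambda>v. {v, \<phi> v}) ` A)"
      proof (rule disjointI)
        fix a b assume ab: "a \<in> (\<lambda>v. {v, \<phi> v}) ` A" "b \<in> (\<lambda>v. {v, \<phi> v}) ` A" "a \<noteq> b"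
        then obtain u v where uv: "u \<in> A" "v \<in> A" "a = {u, \<phi> u}" "b = {v, \<phi> v}" by auto
        then have "u \<noteq> v" using ab by auto
        then show "a \<inter> b = {}" using uv \<phi>B disj \<phi>(1) by (auto simp: inj_on_def)
      qed
    qed
    with no show False by simp
  qed
  then obtain S where S: "viol S" and min: "\<And>S'. viol S' \<Longrightarrow> card S \<le> card S'"
    using ex_has_least_nat[of viol _ card] by metis
  define W where "W = (\<Union>v\<in>S. N v)"
  obtain A' B' where AB: "S \<subseteq> A'" "A' = A \<and> B' = B \<or> A' = B \<and> B' = A"
    using S unfolding viol_def by blast
  have fin': "finite A'" "finite B'" and card': "card A' = n" "card B' = n" and disj': "A' \<inter> B' = {}"
    using AB fin n disj by auto
  have NA': "N v \<subseteq> B'" if "v \<in> A'" for v using AB(2) NA[of v] NB[of v] that by blast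
  have NB': "N v \<subseteq> A'" if "v \<in> B'" for v using AB(2) NA[of v] NB[of v] that by blast
  have finS: "finite S" using AB fin' by (auto intro: finite_subset)
  have WB: "W \<subseteq> B'" using NA' AB by (auto simp: W_def)
  have finW: "finite W" using WB fin' by (auto intro: finite_subset)
  have ltS: "card W < card S" using S by (simp add: viol_def W_def)
  have violI: "viol S'" if "S' \<subseteq> A' \<or> S' \<subseteq> B'" "card (\<Union>v\<in>S'. N v) < card S'" for S'
    using that AB by (auto simp: viol_def)
  have sub: "card S - 1 \<le> card (\<Union>u\<in>S - {v}. N u)" if "v \<in> S" for v
  proof (rule ccontr)
    assume *: "\<not> ?thesis"
    have c: "card (S - {v}) = card S - 1" using that finS by simp
    have "viol (S - {v})" using * c AB by (intro violI) auto
    from min[OF this] c that finS show False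
      by (metis card_Diff1_less not_less)
  qed
  have S0: "card S \<ge> 1" using ltS by simp
  then obtain v0 where v0: "v0 \<in> S" by (metis card.empty ex_in_conv not_one_le_zero)
  have "card (\<Union>u\<in>S - {v0}. N u) \<le> card W" using finW by (intro card_mono) (auto simp: W_def)
  with sub[OF v0] ltS have cW: "card W + 1 = card S" by simp
  have "2 * card S \<le> n + 1"
  proof -
    have SA: "card S \<le> n" using AB fin' card' card_mono by metis
    have "card (B' - W) = n - card W" using WB finW card' by (simp add: card_Diff_subset)
    then have cT: "card (B' - W) = n + 1 - card S" using cW by simp
    \<comment> \<open>The complementary violator: \<open>B' - W\<close> has
      \<open>n + 1 - card S\<close> elements but at most \<open>n - card S\<close>
      neighbours.\<close>
    have "(\<Union>v\<in>B' - W. N v) \<subseteq> A' - S"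
    proof
      fix u assume "u \<in> (\<Union>v\<in>B' - W. N v)"
      then obtain v where v: "v \<in> B'" "v \<notin> W" "u \<in> N v" by blast
      then have "u \<in> A'" using NB' by blast
      moreover have "u \<notin> S" using v by (auto simp: W_def N_def insert_commute)
      ultimately show "u \<in> A' - S" by simp
    qed
    then have "card (\<Union>v\<in>B' - W. N v) \<le> card (A' - S)" using fin' by (intro card_mono) auto
    also have "card (A' - S) = n - card S" using AB finS card' by (simp add: card_Diff_subset)
    finally have "viol (B' - W)" using cT SA by (intro violI) auto
    from min[OF this] cT show ?thesis by simp
  qed
  moreover have "2 \<le> card {v\<in>S. {v, w} \<in> E}" if w: "w \<in> W" for w
  proof (rule ccontr)
    assume *: "\<not> ?thesis"
    obtain v where v: "v \<in> S" "{v, w} \<in> E" using w by (auto simp: W_def N_def)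
    have one: "u = v" if "u \<in> S" "{u, w} \<in> E" for u
    proof (rule ccontr)
      assume "u \<noteq> v"
      then have "card {u, v} = 2" by simp
      moreover have "card {u, v} \<le> card {v\<in>S. {v, w} \<in> E}" using v that finS by (intro card_mono) auto
      ultimately show False using * by simp
    qed
    \<comment> \<open>\<open>v\<close> is the only neighbour of \<open>w\<close> in
      \<open>S\<close>, so deleting \<open>v\<close> loses \<open>w\<close> as well and keeps the
      deficiency.\<close>
    have "(\<Union>u\<in>S - {v}. N u) \<subseteq> W - {w}" using one by (auto simp: W_def N_def)
    then have "card (\<Union>u\<in>S - {v}. N u) \<le> card (W - {w})" using finW by (intro card_mono) auto
    also have "\<dots> = card W - 1" using w finW by simp
    finally have "card W \<le> card W - 1" using sub[OF v(1)] cW by simp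
    moreover have "card W > 0" using w finW by (auto simp: card_gt_0_iff)
    ultimately show False by simp
  qed
  moreover have "\<forall>v\<in>S. \<forall>w. {v, w} \<in> E \<longrightarrow> w \<in> W" by (auto simp: W_def N_def)
  ultimately have "hall_obstruction n E S W"
    unfolding hall_obstruction_def using S0 cW by auto
  moreover have "S \<subseteq> A \<and> W \<subseteq> B \<or> S \<subseteq> B \<and> W \<subseteq> A" using AB WB by auto
  ultimately show ?thesis by blast
qed

section \<open>Probability of a Hall obstruction\<close>

lemma avg_indep:
  assumes "finite I" "finite J" "I \<inter> J = {}"
    and F: "\<And>h h'. (\<And>i. i \<in> I \<Longrightarrow> h i = h' i) \<Longrightarrow> F h = F h'"
    and G: "\<And>h h'. (\<And>i. i \<in> J \<Longrightarrow> h i = h' i) \<Longrightarrow> G h = G h'"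
  shows "avg (I \<union> J) X (\<lambda>h. F h * G h) = avg I X F * avg J X G"
proof -
  have "avg (I \<union> J) X (\<lambda>h. F h * G h)
      = avg I X (\<lambda>h1. avg J X (\<lambda>h2. F (\<lambda>i. if i \<in> I then h1 i else h2 i)
          * G (\<lambda>i. if i \<in> I then h1 i else h2 i)))"
    using assms(1-3) by (rule avg_Un)
  also have "\<dots> = avg I X (\<lambda>h1. avg J X (\<lambda>h2. F h1 * G h2))"
    using assms(3) by (intro avg_cong arg_cong2[of _ _ _ _ "(*)"] F G) auto
  also have "\<dots> = avg J X G * avg I X F"
    by (simp add: avg_cmult mult.commute[of _ "avg J X G"])
  finally show ?thesis by simp
qed

lemma card_slots: "card {i \<in> Y \<times> {b}. h i = c} = card {y \<in> Y. h (y, b) = c}"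
  by (rule bij_betw_same_card[of fst], rule bij_betwI[where g="\<lambda>y. (y, b)"]) auto

lemma prod_of_bool: "finite A \<Longrightarrow> (\<Prod>a\<in>A. of_bool (P a)) = (of_bool (\<forall>a\<in>A. P a) :: real)"
  by (induction A rule: finite_induct) auto

lemma avg_slots_occupancy:
  fixes F :: "'b \<Rightarrow> nat \<Rightarrow> real"
  assumes "finite I" "finite B" "z > 0"
    and X: "\<And>i. i \<in> I \<Longrightarrow> X i = B"
    and "\<And>b d. b \<in> B \<Longrightarrow> 0 \<le> F b d"
    and "\<And>b N. b \<in> B \<Longrightarrow> (\<Sum>d\<le>N. F b d * z ^ d / fact d) \<le> \<Phi> b"
  shows "avg I X (\<lambda>h. \<Prod>b\<in>B. F b (card {i \<in> I. h i = b}))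
     \<le> fact (card I) / (real (card B) * z) ^ card I * (\<Prod>b\<in>B. \<Phi> b)"
proof -
  have "PiE I X = PiE I (\<lambda>_. B)" using X by (intro PiE_cong)
  then have "avg I X (\<lambda>h. \<Prod>b\<in>B. F b (card {i \<in> I. h i = b}))
     = (\<Sum>h\<in>PiE I (\<lambda>_. B). \<Prod>b\<in>B. F b (card {i \<in> I. h i = b})) / real (card B) ^ card I"
    using X by (simp add: avg_def)
  also have "\<dots> \<le> (fact (card I) / z ^ card I * (\<Prod>b\<in>B. \<Phi> b)) / real (card B) ^ card I"
    using assms by (intro divide_right_mono sum_PiE_occupancy) auto
  finally show ?thesis by (simp add: power_mult_distrib mult_ac)
qed

lemma exp_partial_sum_le: "z \<ge> 0 \<Longrightarrow> (\<Sum>d\<le>N. z ^ d / fact d) \<le> exp (z::real)"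
proof -
  assume "z \<ge> 0"
  then have "(\<Sum>d<Suc N. inverse (fact d) * z ^ d) \<le> (\<Sum>d. inverse (fact d) * z ^ d)"
    by (intro sum_le_suminf summable_exp) auto
  then show ?thesis by (simp add: exp_def divide_inverse scaleR_conv_of_real mult.commute lessThan_Suc_atMost)
qed

text \<open>The weights met below are exceptional only at in-degree 0 and 1 (unpopular, or degree
  still too small) and geometric from 2 on; the geometric tail sums to an exponential without its
  first two terms.\<close>

lemma exp_partial_sum_weighted_le:
  fixes z :: real
  assumes "z \<ge> 0" "\<And>d. d \<ge> 2 \<Longrightarrow> F d \<le> c * r ^ d" "0 \<le> c" "0 \<le> r" "0 \<le> F 0" "0 \<le> F 1"
  shows "(\<Sum>d\<le>N. F d * z ^ d / fact d) \<le> F 0 + F 1 * z + c * (exp (r * z) - 1 - r * z)"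
proof -
  have tail: "(\<Sum>d=2..M. F d * z ^ d / fact d) \<le> c * (exp (r * z) - 1 - r * z)" if "M \<ge> 1" for M
  proof -
    have split: "{..M} = insert 0 (insert 1 {2..M})" using that by auto
    have "(\<Sum>d=2..M. F d * z ^ d / fact d) \<le> (\<Sum>d=2..M. c * ((r * z) ^ d / fact d))"
    proof (intro sum_mono)
      fix d assume "d \<in> {2..M}"
      then have "F d * z ^ d \<le> c * r ^ d * z ^ d"
        using assms(1,2) by (intro mult_right_mono) auto
      then show "F d * z ^ d / fact d \<le> c * ((r * z) ^ d / fact d)"
        by (simp add: power_mult_distrib divide_right_mono mult.assoc)
    qed
    also have "\<dots> = c * ((\<Sum>d\<le>M. (r * z) ^ d / fact d) - 1 - r * z)"
      unfolding split by (simp add: sum_distrib_left)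
    also have "\<dots> \<le> c * (exp (r * z) - 1 - r * z)"
      using assms exp_partial_sum_le[of "r * z" M] by (intro mult_left_mono) auto
    finally show ?thesis .
  qed
  show ?thesis
  proof (cases "N \<ge> 1")
    case True
    then have split: "{..N} = insert 0 (insert 1 {2..N})" by auto
    show ?thesis using tail[OF True] unfolding split by simp
  next
    \<comment> \<open>Here \<open>tail[of 1]\<close> concerns an empty sum and contributes the
      nonnegativity of the last term.\<close>
    case False
    then have "N = 0" by simp
    then show ?thesis using assms tail[of 1] by simp
  qed
qed

section \<open>Events attached to a fixed pair of sets\<close>

locale sides =
  fixes A B :: "'a set" and n m :: nat
  assumes fin: "finite A" "finite B" and card_sides: "card A = n" "card B = n"
    and disj: "A \<inter> B = {}" and m_pos: "m \<ge> 1"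
begin

abbreviation "X \<equiv> slot_range A B"

lemma X_A: "v \<in> A \<Longrightarrow> X (v, b) = B" and X_B: "v \<in> B \<Longrightarrow> X (v, b) = A"
  using disj by (auto simp: opposite_def)

end

text \<open>\<open>A\<close> is whichever side contains \<open>S\<close>; both choices are covered
  by instantiating \<open>sides\<close> twice with the sides exchanged. The bound
  \<open>k < n\<close> keeps \<open>1 - x\<close> positive.\<close>

locale hall_pair = sides +
  fixes S W :: "'a set" and k :: nat
  assumes S: "S \<subseteq> A" and W: "W \<subseteq> B" and card_S: "card S = k" and card_W: "card W = k - 1"
    and k_pos: "1 \<le> k" and k_less: "k < n"
begin

definition "R = A - S"
definition "T = B - W"
definition "x = real k / real n"

lemma finSWRT: "finite S" "finite W" "finite R" "finite T"
  using S W fin by (auto simp: R_def T_def intro: finite_subset)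

lemma card_RT: "card R = n - k" "card T = n - k + 1"
  using S W finSWRT card_sides card_S card_W k_pos k_less by (auto simp: R_def T_def card_Diff_subset)

lemma n_pos: "0 < n" using k_less by simp

lemma X_fin: "i \<in> (A \<union> B) \<times> UNIV \<Longrightarrow> finite (X i) \<and> X i \<noteq> {}"
  using fin card_sides n_pos disj by (auto simp: opposite_def)

lemma x_bounds: "0 < x" "x < 1" "1 - x = real (n - k) / real n"
  using k_pos k_less by (auto simp: x_def field_simps of_nat_diff)

text \<open>
  Two relaxations make the events on \<open>R \<union> T\<close> and \<open>S \<union> W\<close> independent: only vertices of \<open>T\<close>
  selected at most once by \<open>R\<close> are required to select inside \<open>R\<close> again (these are unpopular for
  every \<open>m \<ge> 1\<close>), and the second selections of all vertices of \<open>W\<close> count towards their degree.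
\<close>

definition F_T :: "('a \<times> bool \<Rightarrow> 'a) \<Rightarrow> real" where
  "F_T h = of_bool (\<forall>t\<in>T. h (t, False) \<in> R \<and> (card {r\<in>R. h (r, False) = t} \<le> 1 \<longrightarrow> h (t, True) \<in> R))"

definition F_S :: "('a \<times> bool \<Rightarrow> 'a) \<Rightarrow> real" where
  "F_S h = of_bool (\<forall>v\<in>S. h (v, False) \<in> W \<and> (card {w\<in>W. h (w, False) = v} \<le> m \<longrightarrow> h (v, True) \<in> W))
     * of_bool (\<forall>w\<in>W. 2 \<le> card {v\<in>S. h (v, False) = w}
         + card {v\<in>S. card {w\<in>W. h (w, False) = v} \<le> m \<and> h (v, True) = w}
         + of_bool (h (w, False) \<in> S) + of_bool (h (w, True) \<in> S))"

text \<open>The obstruction decouples popularity. A vertex of \<open>S\<close> can be selected only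
  from \<open>W\<close>, because \<open>T\<close> selects inside \<open>R\<close>; a vertex of
  \<open>T\<close> can be selected only from \<open>R\<close>, because \<open>S\<close> selects
  inside \<open>W\<close>. So popularity in each of the two blocks is decided by first selections
  within that block.\<close>

lemma obstruction_le:
  assumes h: "h \<in> PiE ((A \<union> B) \<times> UNIV) X"
  shows "of_bool (hall_obstruction n (sel_edges A B m h) S W) \<le> F_S h * F_T h"
proof (cases "hall_obstruction n (sel_edges A B m h) S W")
  case True
  define E where "E = sel_edges A B m h"
  have cl: "w \<in> W" if "v \<in> S" "{v, w} \<in> E" for v w
    using True that unfolding hall_obstruction_def E_def by blast
  have deg: "2 \<le> card {v\<in>S. {v, w} \<in> E}" if "w \<in> W" for w
    using True that unfolding hall_obstruction_def E_def by blast
  have hA: "h (v, b) \<in> B" if "v \<in> A" for v b using PiE_mem[OF h, of "(v, b)"] X_A that by auto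
  have hB: "h (v, b) \<in> A" if "v \<in> B" for v b using PiE_mem[OF h, of "(v, b)"] X_B that by auto
  have e1: "{v, h (v, False)} \<in> E" if "v \<in> A \<union> B" for v
    using that by (auto simp: E_def sel_edges_def)
  have e2: "{v, h (v, True)} \<in> E" if "v \<in> A \<union> B" "card {u \<in> A \<union> B. h (u, False) = v} \<le> m" for v
    using that by (auto simp: E_def sel_edges_def unpopular_def)
  have S1: "h (v, False) \<in> W" if "v \<in> S" for v using cl[OF that] e1[of v] that S by auto
  have T1: "h (t, False) \<in> R" if "t \<in> T" for t
    using cl[of "h (t, False)" t] e1[of t] that hB[of t False] by (auto simp: T_def R_def insert_commute)
  have inS: "{u \<in> A \<union> B. h (u, False) = v} \<subseteq> {w\<in>W. h (w, False) = v}" if "v \<in> S" for v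
  proof
    fix u assume u: "u \<in> {u \<in> A \<union> B. h (u, False) = v}"
    have "v \<in> A" using that S by auto
    then have "u \<notin> A" using u hA[of u False] disj by auto
    moreover have "u \<notin> T" using u T1[of u] that by (auto simp: R_def)
    ultimately show "u \<in> {w\<in>W. h (w, False) = v}" using u by (auto simp: T_def)
  qed
  have S2: "h (v, True) \<in> W" if "v \<in> S" "card {w\<in>W. h (w, False) = v} \<le> m" for v
  proof -
    have "card {u \<in> A \<union> B. h (u, False) = v} \<le> m"
      using card_mono[OF _ inS[OF that(1)]] finSWRT that(2) by simp
    then show ?thesis using e2[of v] cl[of v] that S by auto
  qed
  have T2: "h (t, True) \<in> R" if t: "t \<in> T" "card {r\<in>R. h (r, False) = t} \<le> 1" for t
  proof -
    have tB: "t \<in> B" "t \<notin> W" using t by (auto simp: T_def)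
    have "{u \<in> A \<union> B. h (u, False) = t} \<subseteq> {r\<in>R. h (r, False) = t}"
      using S1 tB hB disj by (auto simp: R_def)
    then have "card {u \<in> A \<union> B. h (u, False) = t} \<le> card {r\<in>R. h (r, False) = t}"
      using finSWRT by (intro card_mono) auto
    \<comment> \<open>The threshold 1 in \<open>F_T\<close> is safe for every
      \<open>m \<ge> 1\<close>; this makes the estimates uniform in \<open>m\<close>.\<close>
    then have "card {u \<in> A \<union> B. h (u, False) = t} \<le> m"
      using t(2) m_pos by linarith
    then have "{t, h (t, True)} \<in> E" using e2[of t] tB by auto
    then show ?thesis using cl[of "h (t, True)" t] hB[of t True] tB by (auto simp: R_def insert_commute)
  qed
  \<comment> \<open>An edge between \<open>v\<close> and \<open>w\<close> arises from a selection by
    \<open>v\<close> or by \<open>w\<close>, in either round. Counting repeated edges several times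
    only enlarges the right-hand side.\<close>
  have deg2: "2 \<le> card {v\<in>S. h (v, False) = w}
         + card {v\<in>S. card {w\<in>W. h (w, False) = v} \<le> m \<and> h (v, True) = w}
         + of_bool (h (w, False) \<in> S) + of_bool (h (w, True) \<in> S)" if w: "w \<in> W" for w
  proof -
    let ?S1 = "{v\<in>S. h (v, False) = w}"
    let ?S2 = "{v\<in>S. card {w\<in>W. h (w, False) = v} \<le> m \<and> h (v, True) = w}"
    have pop: "card {w\<in>W. h (w, False) = v} \<le> m" if "v \<in> S" "v \<in> unpopular A B m (\<lambda>v. h (v, False))" for v
    proof -
      have "card {w\<in>W. h (w, False) = v} \<le> card {u \<in> A \<union> B. h (u, False) = v}"
        using W fin by (intro card_mono) auto
      then show ?thesis using that by (simp add: unpopular_def)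
    qed
    have one: "card {v\<in>S. v = h (w, b)} = of_bool (h (w, b) \<in> S)" for b
    proof (cases "h (w, b) \<in> S")
      case True
      then have "{v\<in>S. v = h (w, b)} = {h (w, b)}" by auto
      then show ?thesis using True by simp
    next
      case False
      then have "{v\<in>S. v = h (w, b)} = {}" by auto
      then show ?thesis using False by simp
    qed
    have "{v\<in>S. {v, w} \<in> E} \<subseteq> ?S1 \<union> ?S2 \<union> {v\<in>S. v = h (w, False)} \<union> {v\<in>S. v = h (w, True)}"
    proof
      fix v assume "v \<in> {v\<in>S. {v, w} \<in> E}"
      then have v: "v \<in> S" "{v, w} \<in> E" by auto
      from v(2) consider u where "{v, w} = {u, h (u, False)}"
        | u where "u \<in> unpopular A B m (\<lambda>v. h (v, False))" "{v, w} = {u, h (u, True)}"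
        unfolding E_def sel_edges_def by blast
      then show "v \<in> ?S1 \<union> ?S2 \<union> {v\<in>S. v = h (w, False)} \<union> {v\<in>S. v = h (w, True)}"
      proof cases
        case 1
        then have "v = u \<and> w = h (u, False) \<or> v = h (u, False) \<and> w = u"
          by (simp add: doubleton_eq_iff)
        then show ?thesis using v(1) by blast
      next
        case 2
        then have "v = u \<and> w = h (u, True) \<or> v = h (u, True) \<and> w = u"
          by (simp add: doubleton_eq_iff)
        then show ?thesis using v(1) pop[of v] 2(1) by blast
      qed
    qed
    then have "card {v\<in>S. {v, w} \<in> E} \<le> card (?S1 \<union> ?S2 \<union> {v\<in>S. v = h (w, False)} \<union> {v\<in>S. v = h (w, True)})"
      using finSWRT by (intro card_mono) auto
    also have "\<dots> \<le> card ?S1 + card ?S2 + card {v\<in>S. v = h (w, False)} + card {v\<in>S. v = h (w, True)}"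
      by (intro order_trans[OF card_Un_le] add_mono order_refl)
    finally show ?thesis using deg[OF w] unfolding one by linarith
  qed
  have "F_S h = 1" unfolding F_S_def using S1 S2 deg2 by simp
  moreover have "F_T h = 1" unfolding F_T_def using T1 T2 by simp
  ultimately show ?thesis by simp
next
  case False
  then show ?thesis by (simp add: F_S_def F_T_def)
qed

lemma avg_obstruction_le:
  "avg ((A \<union> B) \<times> UNIV) X (\<lambda>h. of_bool (hall_obstruction n (sel_edges A B m h) S W))
     \<le> avg ((W \<union> S) \<times> UNIV) X F_S * avg ((R \<union> T) \<times> UNIV) X F_T"
proof -
  have AB: "(A \<union> B) \<times> UNIV = (W \<union> S) \<times> UNIV \<union> (R \<union> T) \<times> (UNIV :: bool set)"
    using S W by (auto simp: R_def T_def)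
  have "avg ((A \<union> B) \<times> UNIV) X (\<lambda>h. of_bool (hall_obstruction n (sel_edges A B m h) S W))
     \<le> avg ((A \<union> B) \<times> UNIV) X (\<lambda>h. F_S h * F_T h)"
    by (rule avg_mono) (rule obstruction_le)
  also have "\<dots> = avg ((W \<union> S) \<times> UNIV) X F_S * avg ((R \<union> T) \<times> UNIV) X F_T"
    unfolding AB
  proof (rule avg_indep)
    show "(W \<union> S) \<times> UNIV \<inter> (R \<union> T) \<times> (UNIV :: bool set) = {}"
      using S W disj by (auto simp: R_def T_def)
    fix h h' :: "'a \<times> bool \<Rightarrow> 'a"
    {
      assume eq: "\<And>i. i \<in> (W \<union> S) \<times> UNIV \<Longrightarrow> h i = h' i"
      have c: "{w\<in>W. h (w, False) = v} = {w\<in>W. h' (w, False) = v}" for v using eq by auto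
      have "{v\<in>S. h (v, False) = w} = {v\<in>S. h' (v, False) = w}"
        "{v\<in>S. card {w\<in>W. h' (w, False) = v} \<le> m \<and> h (v, True) = w}
          = {v\<in>S. card {w\<in>W. h' (w, False) = v} \<le> m \<and> h' (v, True) = w}" for w using eq by auto
      then show "F_S h = F_S h'" unfolding F_S_def c using eq by simp
    next
      assume eq: "\<And>i. i \<in> (R \<union> T) \<times> UNIV \<Longrightarrow> h i = h' i"
      have c: "{w\<in>R. h (w, False) = v} = {w\<in>R. h' (w, False) = v}" for v using eq by auto
      show "F_T h = F_T h'" unfolding F_T_def c using eq by simp
    }
  qed (use finSWRT in auto)
  finally show ?thesis .
qed

end

section \<open>Selections made outside the obstruction\<close>

context hall_pair
begin

text \<open>Conditional probability, given the first selections of \<open>R\<close>, that a vertex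
  of \<open>T\<close> selected \<open>d\<close> times from \<open>R\<close> makes all its required
  selections inside \<open>R\<close>.\<close>

definition "\<psi> d = (1 - x) * (if d \<le> 1 then 1 - x else (1::real))" for d :: nat

text \<open>Once the first selections of \<open>R\<close> are fixed, the slots of \<open>T\<close>
  are independent and their requirements are known, so the inner average factorises over
  \<open>T\<close>.\<close>

lemma avg_F_T:
  "avg ((R \<union> T) \<times> UNIV) X F_T
     = avg (R \<times> {False}) X (\<lambda>h. \<Prod>t\<in>T. \<psi> (card {r\<in>R. h (r, False) = t}))"
proof -
  have RA: "R \<subseteq> A" and TB: "T \<subseteq> B" and RT: "R \<inter> T = {}"
    using S W disj by (auto simp: R_def T_def)
  have "avg ((R \<union> T) \<times> UNIV) X F_T = avg (R \<times> {False} \<union> T \<times> UNIV) X F_T"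
  proof (rule avg_restrict)
    fix h h' :: "'a \<times> bool \<Rightarrow> 'a"
    assume eq: "\<And>i. i \<in> R \<times> {False} \<union> T \<times> UNIV \<Longrightarrow> h i = h' i"
    have c: "{w\<in>R. h (w, False) = v} = {w\<in>R. h' (w, False) = v}" for v using eq by auto
    show "F_T h = F_T h'" unfolding F_T_def c using eq by simp
  next
    fix i :: "'a \<times> bool" assume "i \<in> (R \<union> T) \<times> UNIV"
    then show "finite (X i) \<and> X i \<noteq> {}" using RA TB by (intro X_fin) auto
  qed (use finSWRT in auto)
  also have "\<dots> = avg (R \<times> {False}) X (\<lambda>h1. avg (T \<times> UNIV) X
      (\<lambda>h2. F_T (\<lambda>i. if i \<in> R \<times> {False} then h1 i else h2 i)))"
    using finSWRT RT by (intro avg_Un) auto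
  also have "\<dots> = avg (R \<times> {False}) X (\<lambda>h. \<Prod>t\<in>T. \<psi> (card {r\<in>R. h (r, False) = t}))"
  proof (rule avg_cong)
    fix h1 :: "'a \<times> bool \<Rightarrow> 'a"
    define c where "c t = card {r\<in>R. h1 (r, False) = t}" for t
    define \<phi> :: "'a \<times> bool \<Rightarrow> 'a \<Rightarrow> real" where
      "\<phi> i y = of_bool (snd i \<and> 1 < c (fst i) \<or> y \<in> R)" for i y
    have sumA: "(\<Sum>y\<in>A. of_bool (y \<in> R)) = real (n - k)"
      using fin RA card_RT by (simp add: Int_absorb1)
    have "avg (T \<times> UNIV) X (\<lambda>h2. F_T (\<lambda>i. if i \<in> R \<times> {False} then h1 i else h2 i))
        = avg (T \<times> UNIV) X (\<lambda>h2. \<Prod>i\<in>T \<times> UNIV. \<phi> i (h2 i))"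
    proof (rule avg_cong)
      fix h2 :: "'a \<times> bool \<Rightarrow> 'a"
      have "{r\<in>R. (if (r, False) \<in> R \<times> {False} then h1 (r, False) else h2 (r, False)) = t}
          = {r\<in>R. h1 (r, False) = t}" for t by auto
      moreover have "t \<in> T \<Longrightarrow> t \<notin> R" for t using RT by auto
      ultimately show "F_T (\<lambda>i. if i \<in> R \<times> {False} then h1 i else h2 i)
          = (\<Prod>i\<in>T \<times> UNIV. \<phi> i (h2 i))"
        unfolding F_T_def \<phi>_def using finSWRT
        by (subst prod_of_bool) (auto simp: c_def UNIV_bool not_less not_le)
    qed
    also have "\<dots> = (\<Prod>i\<in>T \<times> UNIV. (\<Sum>y\<in>X i. \<phi> i y) / real (card (X i)))"
    proof (rule avg_prod)
      show "finite (X i)" if "i \<in> T \<times> UNIV" for i using X_fin[of i] that TB by auto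
    qed (use finSWRT in auto)
    also have "\<dots> = (\<Prod>i\<in>T \<times> UNIV. (\<Sum>y\<in>A. \<phi> i y) / real n)"
      using TB X_B card_sides by (intro prod.cong) (auto simp: subset_iff)
    also have "\<dots> = (\<Prod>t\<in>T. \<Prod>b\<in>UNIV. (\<Sum>y\<in>A. \<phi> (t, b) y) / real n)"
      by (simp add: prod.cartesian_product case_prod_unfold)
    also have "\<dots> = (\<Prod>t\<in>T. \<psi> (c t))"
      using sumA n_pos card_sides
      by (intro prod.cong) (auto simp: \<psi>_def \<phi>_def UNIV_bool x_bounds(3))
    finally show "avg (T \<times> UNIV) X (\<lambda>h2. F_T (\<lambda>i. if i \<in> R \<times> {False} then h1 i else h2 i))
        = (\<Prod>t\<in>T. \<psi> (card {r\<in>R. h1 (r, False) = t}))" by (simp add: c_def)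
  qed
  finally show ?thesis .
qed

text \<open>The version without the second round. It loses no power of \<open>n\<close>, which is
  essential for small \<open>k\<close>, where such a loss could not be absorbed.\<close>

lemma avg_F_T_le1: "avg ((R \<union> T) \<times> UNIV) X F_T \<le> (1 - x) ^ (n - k + 1)"
proof -
  have "avg ((R \<union> T) \<times> UNIV) X F_T \<le> avg (R \<times> {False}) X (\<lambda>h. (1 - x) ^ (n - k + 1))"
    unfolding avg_F_T
  proof (rule avg_mono)
    fix h :: "'a \<times> bool \<Rightarrow> 'a"
    have "(\<Prod>t\<in>T. \<psi> (card {r\<in>R. h (r, False) = t})) \<le> (\<Prod>t\<in>T. 1 - x)"
      using x_bounds(1,2) by (intro prod_mono) (auto simp: \<psi>_def mult_le_cancel_left1)
    then show "(\<Prod>t\<in>T. \<psi> (card {r\<in>R. h (r, False) = t})) \<le> (1 - x) ^ (n - k + 1)"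
      by (simp add: card_RT)
  qed
  also have "\<dots> = (1 - x) ^ (n - k + 1)"
    using finSWRT X_fin by (intro avg_const) (auto simp: R_def)
  finally show ?thesis .
qed

text \<open>With \<open>y = 1 - x\<close> this is \<open>exp (- y) * (1 + y)\<close>, the
  probability that a Poisson variable of mean \<open>y\<close> is at most 1; it approximates the
  fraction of vertices of \<open>B\<close> selected at most once by \<open>R\<close>.\<close>

definition "q = exp (x - 1) * (2 - x)"

text \<open>The occupancy bound at \<open>y = 1 - x\<close>, the mean number of selections from
  \<open>R\<close> that a vertex of \<open>B\<close> receives. The quotient with the factorial is
  the price of replacing the occupancy numbers by independent Poisson variables.\<close>

lemma avg_F_T_le2:
  "avg ((R \<union> T) \<times> UNIV) X F_T \<le> (1 - x) ^ (n - k + 1) *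
     (fact (n - k) * exp (real (n - k)) / real (n - k) ^ (n - k) * (1 - q * x) ^ (n - k + 1))"
proof -
  define y where "y = 1 - x"
  have y: "y > 0" using x_bounds(1,2) by (simp add: y_def)
  have ny: "real n * y = real (n - k)" using n_pos by (simp add: y_def x_bounds(3))
  \<comment> \<open>\<open>R\<close> selects uniformly from all of \<open>B\<close>, so the vertices
    of \<open>W\<close> take part in the occupancy problem with weight 1 and contribute a plain
    exponential.\<close>
  define F where "F b d = (if b \<in> T then \<psi> d else 1)" for b :: 'a and d :: nat
  define \<Phi> where "\<Phi> b = (if b \<in> T then (1 - x) * (exp y * (1 - q * x)) else exp y)" for b :: 'a
  have TB: "T \<subseteq> B" "B - T = W" using W by (auto simp: T_def)
  have "avg ((R \<union> T) \<times> UNIV) X F_T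
      = avg (R \<times> {False}) X (\<lambda>h. \<Prod>b\<in>B. F b (card {i \<in> R \<times> {False}. h i = b}))"
    unfolding avg_F_T F_def card_slots using fin TB
    by (intro avg_cong) (simp add: prod.If_cases Int_absorb1 Int_absorb2)
  also have "\<dots> \<le> fact (card (R \<times> {False})) / (real (card B) * y) ^ card (R \<times> {False}) * (\<Prod>b\<in>B. \<Phi> b)"
  proof (rule avg_slots_occupancy)
    show "X i = B" if "i \<in> R \<times> {False}" for i using that X_A by (auto simp: R_def)
    show "0 \<le> F b d" for b d using x_bounds(1,2) by (simp add: F_def \<psi>_def)
    show "(\<Sum>d\<le>N. F b d * y ^ d / fact d) \<le> \<Phi> b" for b N
    proof (cases "b \<in> T")
      case True
      have "(\<Sum>d\<le>N. F b d * y ^ d / fact d) = (\<Sum>d\<le>N. \<psi> d * y ^ d / fact d)" using True by (simp add: F_def)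
      also have "\<dots> \<le> \<psi> 0 + \<psi> 1 * y + (1 - x) * (exp (1 * y) - 1 - 1 * y)"
        using y x_bounds(1,2) by (intro exp_partial_sum_weighted_le) (auto simp: \<psi>_def)
      also have "\<dots> = (1 - x) * (exp y - x * (1 + y))" by (simp add: \<psi>_def algebra_simps)
      also have "exp y - x * (1 + y) = exp y * (1 - q * x)"
      proof -
        have "exp y * q = 1 + y" by (simp add: q_def y_def flip: exp_add mult.assoc)
        then have "exp y * (q * x) = (1 + y) * x" by (metis mult.assoc)
        then show ?thesis by (simp add: algebra_simps)
      qed
      finally show ?thesis using True by (simp add: \<Phi>_def)
    next
      case False
      then show ?thesis using y exp_partial_sum_le[of y N] by (simp add: F_def \<Phi>_def)
    qed
  qed (use finSWRT fin y in auto)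
  also have "(\<Prod>b\<in>B. \<Phi> b) = ((1 - x) * (exp y * (1 - q * x))) ^ (n - k + 1) * exp y ^ (k - 1)"
    using fin TB by (simp add: \<Phi>_def prod.If_cases Int_absorb1 Int_absorb2 card_RT card_W Diff_eq[symmetric])
  also have "\<dots> = (1 - x) ^ (n - k + 1) * (1 - q * x) ^ (n - k + 1) * (exp y ^ (n - k + 1) * exp y ^ (k - 1))"
    by (simp only: power_mult_distrib mult_ac)
  also have "exp y ^ (n - k + 1) * exp y ^ (k - 1) = exp (real (n - k))"
  proof -
    have "n - k + 1 + (k - 1) = n" using k_pos k_less by simp
    then have "exp y ^ (n - k + 1) * exp y ^ (k - 1) = exp y ^ n" by (metis power_add)
    also have "\<dots> = exp (real n * y)" by (simp add: exp_of_nat_mult)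
    finally show ?thesis using ny by simp
  qed
  also have "real (card B) * y = real (n - k)" using ny card_sides by simp
  finally show ?thesis by (simp add: card_RT card_cartesian_product mult_ac)
qed

end

section \<open>Selections made inside the obstruction\<close>

lemma fact_shift_le:
  assumes "2 * p \<le> k"
  shows "fact (2 * k - p) * (3 / 2 * real k) ^ p \<le> (fact (2 * k) :: real)"
  using assms
proof (induction p)
  case 0
  then show ?case by simp
next
  case (Suc p)
  have "Suc (2 * k - Suc p) = 2 * k - p" using Suc.prems by simp
  then have "fact (2 * k - p) = real (2 * k - p) * fact (2 * k - Suc p)"
    by (metis fact_Suc of_nat_fact of_nat_mult)
  \<comment> \<open>The assumption \<open>2 * p \<le> k\<close> is the fact that at most half of
    \<open>S\<close> is popular; each of the \<open>p\<close> factors removed from the factorial is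
    then at least \<open>2 * k - k / 2\<close>.\<close>
  moreover have "3 / 2 * real k \<le> real (2 * k - p)" using Suc.prems by (simp add: of_nat_diff)
  ultimately have "fact (2 * k - Suc p) * (3 / 2 * real k) \<le> (fact (2 * k - p) :: real)"
    by (simp add: mult_left_mono mult.commute)
  then have "fact (2 * k - Suc p) * (3 / 2 * real k) * (3 / 2 * real k) ^ p
      \<le> fact (2 * k - p) * (3 / 2 * real k) ^ p"
    by (intro mult_right_mono) auto
  also have "\<dots> \<le> fact (2 * k)" using Suc by simp
  finally show ?case by (simp add: mult_ac)
qed

text \<open>The Poisson weight of the event that a vertex with \<open>c\<close> neighbours gets at least \<open>2 - c\<close> more.\<close>

definition "trunc_exp z c = exp z - (if c = 0 then 1 + z else if c = 1 then 1 else (0::real))"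
  for z :: real and c :: nat

lemma trunc_exp_nonneg: "z \<ge> 0 \<Longrightarrow> 0 \<le> trunc_exp z c"
  using exp_ge_add_one_self[of z] by (auto simp: trunc_exp_def)

lemma trunc_exp_sum: "z \<ge> 0 \<Longrightarrow> (\<Sum>d\<le>N. of_bool (2 \<le> d + c) * z ^ d / fact d) \<le> trunc_exp z c"
  using exp_partial_sum_weighted_le[of z "\<lambda>d. of_bool (2 \<le> d + c)" 1 1 N]
  by (auto simp: trunc_exp_def split: if_splits)

context hall_pair
begin

definition "indeg h v = card {w\<in>W. h (w, False) = v}" for h :: "'a \<times> bool \<Rightarrow> 'a" and v
definition "hits h w = of_bool (h (w, False) \<in> S) + (of_bool (h (w, True) \<in> S) :: nat)"
  for h :: "'a \<times> bool \<Rightarrow> 'a" and w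

lemma sum_indeg_le: "(\<Sum>v\<in>S. indeg h v) \<le> k - 1"
proof -
  have "(\<Sum>v\<in>S. indeg h v) = card (\<Union>v\<in>S. {w\<in>W. h (w, False) = v})"
    unfolding indeg_def using finSWRT by (subst card_UN_disjoint) auto
  also have "\<dots> \<le> card W" using finSWRT by (intro card_mono) auto
  finally show ?thesis by (simp add: card_W)
qed

text \<open>Only \<open>k - 1\<close> first selections can enter \<open>S\<close> from
  \<open>W\<close>, and each vertex counted here absorbs at least two of them.\<close>

lemma card_popular_le: "2 * card {v\<in>S. 2 \<le> indeg h v} \<le> k"
proof -
  have "2 * card {v\<in>S. 2 \<le> indeg h v} = (\<Sum>v\<in>{v\<in>S. 2 \<le> indeg h v}. 2)" by simp
  also have "\<dots> \<le> (\<Sum>v\<in>{v\<in>S. 2 \<le> indeg h v}. indeg h v)" by (intro sum_mono) auto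
  also have "\<dots> \<le> (\<Sum>v\<in>S. indeg h v)" using finSWRT by (intro sum_mono2) auto
  also have "\<dots> \<le> k" using sum_indeg_le[of h] by simp
  finally show ?thesis .
qed

text \<open>Given the selections of \<open>W\<close>, the popular vertices of \<open>S\<close> are
  known. If there are \<open>p\<close> of them, \<open>S\<close> makes exactly
  \<open>2 * k - p\<close> selections, all of which must land in \<open>W\<close> and bring every
  degree up to 2: an occupancy problem. Normalising to \<open>2 * k\<close> selections costs at most
  \<open>\<theta>\<close> per popular vertex. As \<open>\<theta> \<ge> 1\<close>, this charge may be
  extended to every vertex with in-degree at least 2, whatever \<open>m\<close> is.\<close>

lemma avg_F_S_inner:
  fixes h1 :: "'a \<times> bool \<Rightarrow> 'a" and z \<theta> :: real
  assumes z: "z > 0" and \<theta>: "\<theta> = z / (3 / 2 * x)" "1 \<le> \<theta>"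
  shows "avg (S \<times> UNIV) X (\<lambda>h2. F_S (\<lambda>i. if i \<in> W \<times> UNIV then h1 i else h2 i))
    \<le> fact (2 * k) / (real n * z) ^ (2 * k) *
       (\<theta> ^ card {v\<in>S. 2 \<le> indeg h1 v} * (\<Prod>w\<in>W. trunc_exp z (hits h1 w)))"
proof -
  define U where "U = {v\<in>S. indeg h1 v \<le> m}"
  define J where "J = S \<times> {False} \<union> U \<times> {True}"
  define p where "p = card (S - U)"
  have US: "U \<subseteq> S" and finU: "finite U" using finSWRT by (auto simp: U_def)
  have SW: "S \<inter> W = {}" using S W disj by auto
  have finJ: "finite J" using finU finSWRT by (simp add: J_def)
  have p: "2 * p \<le> k" and pp: "p \<le> card {v\<in>S. 2 \<le> indeg h1 v}"
  proof -
    show pp: "p \<le> card {v\<in>S. 2 \<le> indeg h1 v}"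
      unfolding p_def using finSWRT m_pos by (intro card_mono) (auto simp: U_def)
    then show "2 * p \<le> k" using card_popular_le[of h1] by linarith
  qed
  have "card U = k - p" using US finU finSWRT card_S card_mono[of S U]
    by (simp add: p_def card_Diff_subset)
  then have cardJ: "card J = 2 * k - p"
    using p finU finSWRT unfolding J_def
    by (subst card_Un_disjoint) (auto simp: card_cartesian_product card_S)
  define G :: "('a \<times> bool \<Rightarrow> 'a) \<Rightarrow> real" where
    "G h = of_bool (\<forall>i\<in>J. h i \<in> W) * (\<Prod>w\<in>W. of_bool (2 \<le> card {i\<in>J. h i = w} + hits h1 w))" for h
  have XJ: "X i = B" if "i \<in> J" for i using that US S X_A by (auto simp: J_def)
  have FG: "F_S (\<lambda>i. if i \<in> W \<times> UNIV then h1 i else h2 i) = G h2" for h2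
  proof -
    have notW: "v \<in> S \<Longrightarrow> v \<notin> W" for v using SW by auto
    have c: "{w\<in>W. (if (w, False) \<in> W \<times> UNIV then h1 (w, False) else h2 (w, False)) = v}
        = {w\<in>W. h1 (w, False) = v}" for v by auto
    have cc: "card {v\<in>S. (if (v, False) \<in> W \<times> UNIV then h1 (v, False) else h2 (v, False)) = w}
        + card {v\<in>S. card {w\<in>W. h1 (w, False) = v} \<le> m \<and>
              (if (v, True) \<in> W \<times> UNIV then h1 (v, True) else h2 (v, True)) = w}
        = card {i\<in>J. h2 i = w}" for w
    proof -
      have "card {i\<in>J. h2 i = w} = card ({i\<in>S \<times> {False}. h2 i = w} \<union> {i\<in>U \<times> {True}. h2 i = w})"
        by (intro arg_cong[of _ _ card]) (auto simp: J_def)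
      also have "\<dots> = card {i\<in>S \<times> {False}. h2 i = w} + card {i\<in>U \<times> {True}. h2 i = w}"
        using finSWRT finU by (intro card_Un_disjoint) auto
      also have "\<dots> = card {v\<in>S. h2 (v, False) = w} + card {v\<in>U. h2 (v, True) = w}"
        by (simp only: card_slots)
      also have "{v\<in>S. h2 (v, False) = w}
          = {v\<in>S. (if (v, False) \<in> W \<times> UNIV then h1 (v, False) else h2 (v, False)) = w}"
        using notW by auto
      also have "{v\<in>U. h2 (v, True) = w} = {v\<in>S. card {w\<in>W. h1 (w, False) = v} \<le> m \<and>
              (if (v, True) \<in> W \<times> UNIV then h1 (v, True) else h2 (v, True)) = w}"
        using notW by (auto simp: U_def indeg_def)
      finally show ?thesis by simp
    qed
    have b1: "(\<forall>v\<in>S. (if (v, False) \<in> W \<times> UNIV then h1 (v, False) else h2 (v, False)) \<in> W \<and>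
        (card {w\<in>W. h1 (w, False) = v} \<le> m \<longrightarrow>
           (if (v, True) \<in> W \<times> UNIV then h1 (v, True) else h2 (v, True)) \<in> W)) \<longleftrightarrow> (\<forall>i\<in>J. h2 i \<in> W)"
      using notW by (auto simp: J_def U_def indeg_def)
    have b2: "(\<forall>w\<in>W. 2 \<le> card {i\<in>J. h2 i = w}
          + of_bool ((if (w, False) \<in> W \<times> UNIV then h1 (w, False) else h2 (w, False)) \<in> S)
          + of_bool ((if (w, True) \<in> W \<times> UNIV then h1 (w, True) else h2 (w, True)) \<in> S))
        \<longleftrightarrow> (\<forall>w\<in>W. 2 \<le> card {i\<in>J. h2 i = w} + hits h1 w)"
      by (simp add: hits_def)
    show ?thesis unfolding F_S_def c cc b1 b2 G_def using finSWRT by (simp add: prod_of_bool)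
  qed
  have "avg (S \<times> UNIV) X G = avg J X G"
  proof (rule avg_restrict)
    show "J \<subseteq> S \<times> UNIV" using US by (auto simp: J_def)
    fix h h' :: "'a \<times> bool \<Rightarrow> 'a" assume eq: "\<And>i. i \<in> J \<Longrightarrow> h i = h' i"
    have "{i\<in>J. h i = w} = {i\<in>J. h' i = w}" for w using eq by auto
    then show "G h = G h'" unfolding G_def using eq by simp
  next
    fix i :: "'a \<times> bool" assume "i \<in> S \<times> UNIV"
    then show "finite (X i) \<and> X i \<noteq> {}" using S by (intro X_fin) auto
  qed (use finSWRT in auto)
  also have "\<dots> = (\<Sum>h\<in>PiE J (\<lambda>_. B). G h) / real n ^ (2 * k - p)"
    using XJ card_sides cardJ PiE_cong[of J X "\<lambda>_. B"] by (simp add: avg_def)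
  \<comment> \<open>A selection outside \<open>W\<close> makes \<open>G\<close> vanish. Counting
    functions into \<open>W\<close> while still dividing by powers of \<open>n\<close> retains the
    probability of staying in \<open>W\<close>.\<close>
  also have "(\<Sum>h\<in>PiE J (\<lambda>_. B). G h) = (\<Sum>h\<in>PiE J (\<lambda>_. W). G h)"
  proof (rule sum.mono_neutral_right)
    show "finite (PiE J (\<lambda>_. B))" using finJ fin by (intro finite_PiE) auto
    show "PiE J (\<lambda>_. W) \<subseteq> PiE J (\<lambda>_. B)" using W by (intro PiE_mono) auto
    show "\<forall>h\<in>PiE J (\<lambda>_. B) - PiE J (\<lambda>_. W). G h = 0"
      by (auto simp: G_def PiE_def)
  qed
  also have "\<dots> = (\<Sum>h\<in>PiE J (\<lambda>_. W). \<Prod>w\<in>W. of_bool (2 \<le> card {i\<in>J. h i = w} + hits h1 w))"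
    by (intro sum.cong) (auto simp: G_def PiE_mem)
  also have "\<dots> / real n ^ (2 * k - p)
      \<le> (fact (card J) / z ^ card J * (\<Prod>w\<in>W. trunc_exp z (hits h1 w))) / real n ^ (2 * k - p)"
    using z finJ finSWRT trunc_exp_sum[of z]
    by (intro divide_right_mono
        sum_PiE_occupancy[where F="\<lambda>w d. of_bool (2 \<le> d + hits h1 w)"]) auto
  also have "\<dots> = fact (2 * k - p) / (real n * z) ^ (2 * k - p) * (\<Prod>w\<in>W. trunc_exp z (hits h1 w))"
    by (simp add: cardJ power_mult_distrib mult_ac)
  also have "\<dots> \<le> (fact (2 * k) / (real n * z) ^ (2 * k) * \<theta> ^ card {v\<in>S. 2 \<le> indeg h1 v})
      * (\<Prod>w\<in>W. trunc_exp z (hits h1 w))"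
  proof (intro mult_right_mono prod_nonneg ballI trunc_exp_nonneg)
    have "fact (2 * k - p) \<le> fact (2 * k) / (3 / 2 * real k) ^ p"
      using fact_shift_le[OF p] k_pos by (simp add: field_simps)
    then have "fact (2 * k - p) / (real n * z) ^ (2 * k - p)
        \<le> fact (2 * k) / (3 / 2 * real k) ^ p / (real n * z) ^ (2 * k - p)"
      using z by (intro divide_right_mono) auto
    also have "\<dots> = fact (2 * k) / (real n * z) ^ (2 * k) * \<theta> ^ p"
    proof -
      have "(real n * z) ^ (2 * k) = (real n * z) ^ (2 * k - p) * (real n * z) ^ p"
        using p by (simp flip: power_add)
      moreover have "\<theta> = (real n * z) / (3 / 2 * real k)" by (simp add: \<theta> x_def)
      ultimately show ?thesis using n_pos z by (simp add: power_divide)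
    qed
    also have "\<dots> \<le> fact (2 * k) / (real n * z) ^ (2 * k) * \<theta> ^ card {v\<in>S. 2 \<le> indeg h1 v}"
      using pp \<theta>(2) z by (intro mult_left_mono power_increasing) auto
    finally show "fact (2 * k - p) / (real n * z) ^ (2 * k - p)
        \<le> fact (2 * k) / (real n * z) ^ (2 * k) * \<theta> ^ card {v\<in>S. 2 \<le> indeg h1 v}" .
  qed (use z in auto)
  finally show ?thesis by (simp add: FG mult_ac)
qed

lemma avg_F_S_le:
  fixes z \<theta> :: real
  assumes "z > 0" "\<theta> = z / (3 / 2 * x)" "1 \<le> \<theta>"
  shows "avg ((W \<union> S) \<times> UNIV) X F_S \<le> fact (2 * k) / (real n * z) ^ (2 * k) *
     avg (W \<times> UNIV) X (\<lambda>h. \<theta> ^ card {v\<in>S. 2 \<le> indeg h v} * (\<Prod>w\<in>W. trunc_exp z (hits h w)))"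
proof -
  have "(W \<union> S) \<times> UNIV = W \<times> UNIV \<union> S \<times> (UNIV :: bool set)" by auto
  then have "avg ((W \<union> S) \<times> UNIV) X F_S
    = avg (W \<times> UNIV) X (\<lambda>h1. avg (S \<times> UNIV) X (\<lambda>h2. F_S (\<lambda>i. if i \<in> W \<times> UNIV then h1 i else h2 i)))"
    using finSWRT S W disj by (simp only:) (intro avg_Un; auto)
  also have "\<dots> \<le> avg (W \<times> UNIV) X (\<lambda>h. fact (2 * k) / (real n * z) ^ (2 * k) *
     (\<theta> ^ card {v\<in>S. 2 \<le> indeg h v} * (\<Prod>w\<in>W. trunc_exp z (hits h w))))"
    by (rule avg_mono) (rule avg_F_S_inner[OF assms])
  finally show ?thesis by (simp only: avg_cmult)
qed

text \<open>\<open>A0\<close> and \<open>A1\<close> are the mean weights of a vertex of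
  \<open>W\<close> over its second selection, according to whether its first selection misses or
  hits \<open>S\<close>. Relative to \<open>A0\<close>, each first selection into \<open>S\<close>
  carries the factor \<open>\<rho>\<close>. Since the in-degrees in \<open>S\<close> add up to the
  number of such selections, the weight becomes a product over \<open>A\<close>, and the occupancy
  bound applies to the \<open>k - 1\<close> first selections of \<open>W\<close>.\<close>

lemma avg_W_le:
  fixes y z \<theta> A0 A1 \<rho> :: real
  assumes z: "z > 0" and y: "y > 0" and \<theta>: "0 \<le> \<theta>"
    and A0: "A0 = (1 - x) * trunc_exp z 0 + x * trunc_exp z 1"
    and A1: "A1 = (1 - x) * trunc_exp z 1 + x * trunc_exp z 2"
    and \<rho>: "\<rho> = A1 / A0"
  shows "avg (W \<times> UNIV) X (\<lambda>h. \<theta> ^ card {v\<in>S. 2 \<le> indeg h v} * (\<Prod>w\<in>W. trunc_exp z (hits h w)))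
    \<le> A0 ^ (k - 1) * (fact (k - 1) / (real n * y) ^ (k - 1) *
        ((1 + \<rho> * y + \<theta> * (exp (\<rho> * y) - 1 - \<rho> * y)) ^ k * exp y ^ (n - k)))"
proof -
  have E0: "0 < trunc_exp z 0" "0 < trunc_exp z 1" "0 < trunc_exp z 2"
  proof -
    have "1 + z + z\<^sup>2 / 2 \<le> exp z" using z by (intro exp_lower_Taylor_quadratic) auto
    moreover have "z\<^sup>2 / 2 > 0" using z by simp
    ultimately have "exp z > 1 + z" by linarith
    then show "0 < trunc_exp z 0" "0 < trunc_exp z 1" "0 < trunc_exp z 2"
      using z by (auto simp: trunc_exp_def)
  qed
  have A0': "0 < A0" and A1': "0 < A1"
    using E0 x_bounds(1,2) by (auto simp: A0 A1 intro!: add_pos_pos mult_pos_pos)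
  have \<rho>': "0 < \<rho>" using A0' A1' by (simp add: \<rho>)
  define f where "f h = \<theta> ^ card {v\<in>S. 2 \<le> indeg h v} * (\<Prod>w\<in>W. trunc_exp z (hits h w))" for h
  define F where "F v d = (if v \<in> S then \<rho> ^ d * \<theta> ^ of_bool (2 \<le> d) else 1)" for v :: 'a and d :: nat
  have W2: "W \<times> UNIV = W \<times> {False} \<union> W \<times> {True}" by (auto simp: UNIV_bool)
  have "avg (W \<times> UNIV) X f = avg (W \<times> {False}) X (\<lambda>h1. avg (W \<times> {True}) X
      (\<lambda>h2. f (\<lambda>i. if i \<in> W \<times> {False} then h1 i else h2 i)))"
    unfolding W2 using finSWRT by (intro avg_Un) auto
  also have "\<dots> = avg (W \<times> {False}) X (\<lambda>h. A0 ^ (k - 1) * (\<Prod>v\<in>A. F v (card {i\<in>W \<times> {False}. h i = v})))"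
  proof (rule avg_cong)
    fix h1 :: "'a \<times> bool \<Rightarrow> 'a" assume h1: "h1 \<in> PiE (W \<times> {False}) X"
    define P where "P = \<theta> ^ card {v\<in>S. 2 \<le> indeg h1 v}"
    define \<phi> where "\<phi> i u = trunc_exp z (of_bool (h1 (fst i, False) \<in> S) + of_bool (u \<in> S))"
      for i :: "'a \<times> bool" and u
    have "avg (W \<times> {True}) X (\<lambda>h2. f (\<lambda>i. if i \<in> W \<times> {False} then h1 i else h2 i))
        = avg (W \<times> {True}) X (\<lambda>h2. P * (\<Prod>i\<in>W \<times> {True}. \<phi> i (h2 i)))"
    proof (rule avg_cong)
      fix h2 :: "'a \<times> bool \<Rightarrow> 'a"
      let ?h = "\<lambda>i. if i \<in> W \<times> {False} then h1 i else h2 i"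
      have "indeg ?h v = indeg h1 v" for v
        unfolding indeg_def by (intro arg_cong[of _ _ card]) auto
      moreover have "(\<Prod>i\<in>W \<times> {True}. \<phi> i (h2 i)) = (\<Prod>w\<in>W. trunc_exp z (hits ?h w))"
        by (rule prod.reindex_bij_witness[where i="\<lambda>w. (w, True)" and j=fst])
           (auto simp: \<phi>_def hits_def)
      ultimately show "f ?h = P * (\<Prod>i\<in>W \<times> {True}. \<phi> i (h2 i))" by (simp add: f_def P_def)
    qed
    also have "\<dots> = P * (\<Prod>i\<in>W \<times> {True}. (\<Sum>u\<in>X i. \<phi> i u) / real (card (X i)))"
      unfolding avg_cmult
    proof (subst avg_prod)
      show "finite (X i)" if "i \<in> W \<times> {True}" for i using X_fin[of i] that W by auto
    qed (use finSWRT in auto)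
    also have "(\<Prod>i\<in>W \<times> {True}. (\<Sum>u\<in>X i. \<phi> i u) / real (card (X i)))
        = (\<Prod>w\<in>W. if h1 (w, False) \<in> S then A1 else A0)"
    proof (rule prod.reindex_bij_witness[where i="\<lambda>w. (w, True)" and j=fst])
      fix i assume i: "i \<in> W \<times> {True}"
      have "(\<Sum>u\<in>A. trunc_exp z (c + of_bool (u \<in> S)))
          = real (n - k) * trunc_exp z c + real k * trunc_exp z (c + 1)" for c
      proof -
        have RS: "A = R \<union> S" "R \<inter> S = {}" using S by (auto simp: R_def)
        have "(\<Sum>u\<in>A. trunc_exp z (c + of_bool (u \<in> S)))
            = (\<Sum>u\<in>R. trunc_exp z (c + of_bool (u \<in> S))) + (\<Sum>u\<in>S. trunc_exp z (c + of_bool (u \<in> S)))"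
          using finSWRT RS(2) by (subst RS(1), intro sum.union_disjoint) auto
        also have "(\<Sum>u\<in>R. trunc_exp z (c + of_bool (u \<in> S))) = (\<Sum>u\<in>R. trunc_exp z c)"
          by (intro sum.cong) (auto simp: R_def)
        finally show ?thesis by (simp add: card_RT card_S)
      qed
      moreover have "X i = A" using i W X_B by auto
      ultimately have "(\<Sum>u\<in>X i. \<phi> i u) / real (card (X i))
          = (1 - x) * trunc_exp z (of_bool (h1 (fst i, False) \<in> S))
             + x * trunc_exp z (of_bool (h1 (fst i, False) \<in> S) + 1)"
        by (simp add: \<phi>_def card_sides add_divide_distrib x_bounds(3)) (simp add: x_def)
      then show "(if h1 (fst i, False) \<in> S then A1 else A0) = (\<Sum>u\<in>X i. \<phi> i u) / real (card (X i))"
        by (simp add: A0 A1 numeral_2_eq_2)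
    qed auto
    also have "P * (\<Prod>w\<in>W. if h1 (w, False) \<in> S then A1 else A0)
        = A0 ^ (k - 1) * (\<Prod>v\<in>A. F v (card {i\<in>W \<times> {False}. h1 i = v}))"
    proof -
      have "(\<Prod>w\<in>W. if h1 (w, False) \<in> S then A1 else A0)
          = (\<Prod>w\<in>W. A0 * (if h1 (w, False) \<in> S then \<rho> else 1))"
        using A0' by (intro prod.cong) (auto simp: \<rho>)
      also have "\<dots> = A0 ^ (k - 1) * \<rho> ^ card {w\<in>W. h1 (w, False) \<in> S}"
        using finSWRT by (simp add: prod.distrib card_W prod.If_cases Int_def)
      \<comment> \<open>This turns a product over the selecting vertices into one over the selected
        vertices.\<close>
      also have "card {w\<in>W. h1 (w, False) \<in> S} = (\<Sum>v\<in>S. indeg h1 v)"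
      proof -
        have eq: "{w\<in>W. h1 (w, False) \<in> S} = (\<Union>v\<in>S. {w\<in>W. h1 (w, False) = v})" by auto
        show ?thesis unfolding indeg_def eq using finSWRT by (intro card_UN_disjoint) auto
      qed
      also have "\<rho> ^ (\<Sum>v\<in>S. indeg h1 v) = (\<Prod>v\<in>S. \<rho> ^ indeg h1 v)" by (simp add: power_sum)
      finally have 1: "(\<Prod>w\<in>W. if h1 (w, False) \<in> S then A1 else A0)
          = A0 ^ (k - 1) * (\<Prod>v\<in>S. \<rho> ^ indeg h1 v)" .
      have 2: "P = (\<Prod>v\<in>S. \<theta> ^ of_bool (2 \<le> indeg h1 v))"
      proof -
        have "(\<Prod>v\<in>S. \<theta> ^ of_bool (2 \<le> indeg h1 v)) = (\<Prod>v\<in>S. if 2 \<le> indeg h1 v then \<theta> else 1)"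
          by (intro prod.cong) auto
        then show ?thesis using finSWRT by (simp add: P_def prod.If_cases Int_def)
      qed
      have "(\<Prod>v\<in>A. F v (card {i\<in>W \<times> {False}. h1 i = v}))
          = (\<Prod>v\<in>S. \<rho> ^ indeg h1 v * \<theta> ^ of_bool (2 \<le> indeg h1 v))"
        unfolding F_def card_slots indeg_def using fin S by (simp add: prod.If_cases Int_absorb1 Int_absorb2)
      then show ?thesis by (simp add: 1 2 prod.distrib mult_ac)
    qed
    finally show "avg (W \<times> {True}) X (\<lambda>h2. f (\<lambda>i. if i \<in> W \<times> {False} then h1 i else h2 i))
        = A0 ^ (k - 1) * (\<Prod>v\<in>A. F v (card {i\<in>W \<times> {False}. h1 i = v}))" .
  qed
  also have "\<dots> = A0 ^ (k - 1) * avg (W \<times> {False}) X (\<lambda>h. \<Prod>v\<in>A. F v (card {i\<in>W \<times> {False}. h i = v}))"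
    by (rule avg_cmult)
  also have "\<dots> \<le> A0 ^ (k - 1) * (fact (card (W \<times> {False})) / (real (card A) * y) ^ card (W \<times> {False})
      * (\<Prod>v\<in>A. if v \<in> S then 1 + \<rho> * y + \<theta> * (exp (\<rho> * y) - 1 - \<rho> * y) else exp y))"
  proof (intro mult_left_mono avg_slots_occupancy)
    show "X i = A" if "i \<in> W \<times> {False}" for i using that W X_B by auto
    show "0 \<le> F v d" for v d using \<rho>' \<theta> by (simp add: F_def)
    show "(\<Sum>d\<le>N. F v d * y ^ d / fact d)
        \<le> (if v \<in> S then 1 + \<rho> * y + \<theta> * (exp (\<rho> * y) - 1 - \<rho> * y) else exp y)" for v N
      using exp_partial_sum_weighted_le[of y "F v" \<theta> \<rho> N] exp_partial_sum_le[of y N] y \<rho>' \<theta>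
      by (auto simp: F_def)
  qed (use finSWRT fin y A0' in auto)
  also have "(\<Prod>v\<in>A. if v \<in> S then 1 + \<rho> * y + \<theta> * (exp (\<rho> * y) - 1 - \<rho> * y) else exp y)
      = (1 + \<rho> * y + \<theta> * (exp (\<rho> * y) - 1 - \<rho> * y)) ^ k * exp y ^ (n - k)"
  proof -
    have "A \<inter> S = S" "A \<inter> - S = R" using S by (auto simp: R_def)
    then show ?thesis using fin by (simp add: prod.If_cases card_S card_RT)
  qed
  finally show ?thesis by (simp add: f_def[abs_def] card_cartesian_product card_W card_sides)
qed

end

section \<open>Numerical estimates\<close>

text \<open>From the term of index \<open>N\<close> on, the exponential series is dominated by a
  geometric series of ratio \<open>t / (N + 1)\<close>.\<close>

lemma exp_upper_taylor:
  fixes t :: real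
  assumes t: "0 \<le> t" "t < real N + 1"
  shows "exp t \<le> (\<Sum>d<N. t ^ d / fact d) + t ^ N / fact N / (1 - t / (real N + 1))"
proof -
  define r where "r = t / (real N + 1)"
  have r: "0 \<le> r" "r < 1" using t by (auto simp: r_def)
  have sm: "summable (\<lambda>d. t ^ d / fact d)"
    using summable_exp[of t] by (simp add: divide_inverse mult.commute)
  have "exp t = (\<Sum>d. t ^ d / fact d)"
    by (simp add: exp_def divide_inverse scaleR_conv_of_real mult.commute)
  also have "\<dots> = (\<Sum>d. t ^ (d + N) / fact (d + N)) + (\<Sum>d<N. t ^ d / fact d)"
    by (rule suminf_split_initial_segment[OF sm])
  also have "(\<Sum>d. t ^ (d + N) / fact (d + N)) \<le> (\<Sum>d. t ^ N / fact N * r ^ d)"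
  proof (intro suminf_le)
    show "summable (\<lambda>d. t ^ (d + N) / fact (d + N))" using sm by (subst summable_iff_shift)
    show "summable (\<lambda>d. t ^ N / fact N * r ^ d)" using r by (intro summable_mult summable_geometric) auto
    fix d
    have "fact N * (real N + 1) ^ d \<le> (fact (d + N) :: real)"
    proof (induction d)
      case (Suc d)
      have "fact N * (real N + 1) ^ Suc d = (fact N * (real N + 1) ^ d) * (real N + 1)" by simp
      also have "\<dots> \<le> fact (d + N) * real (Suc (d + N))"
        using Suc by (intro mult_mono) auto
      finally show ?case by (simp add: mult.commute)
    qed simp
    then have "t ^ (d + N) / fact (d + N) \<le> t ^ (d + N) / (fact N * (real N + 1) ^ d)"
      using t by (intro divide_left_mono) auto
    then show "t ^ (d + N) / fact (d + N) \<le> t ^ N / fact N * r ^ d"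
      by (simp add: r_def power_divide power_add mult_ac)
  qed
  also have "(\<Sum>d. t ^ N / fact N * r ^ d) = t ^ N / fact N / (1 - r)"
    using r by (subst suminf_mult) (auto simp: suminf_geometric summable_geometric)
  finally show ?thesis by (simp add: r_def)
qed

lemma exp_minus_affine_le:
  assumes "0 \<le> t" "t < (3::real)"
  shows "exp t - 1 - t \<le> t\<^sup>2 / (2 * (1 - t / 3))"
  using exp_upper_taylor[of t 2] assms by (simp add: numeral_2_eq_2)

lemma exp_cubic_le: "0 \<le> t \<Longrightarrow> 1 + t + t\<^sup>2 / 2 + t ^ 3 / 6 \<le> exp (t::real)"
  using exp_partial_sum_le[of t 3] by (simp add: atMost_nat_numeral fact_numeral eval_nat_numeral)

text \<open>3/2 and 12/100 are the two values of \<open>z\<close>. The number 20357/10000 is 13/10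
  plus the constant term 7357/10000 of the linear lower bound for \<open>q\<close>.\<close>

lemma exp_numeric_bounds:
  "exp (3/2) \<le> (44818 / 10000 :: real)" "44816 / 10000 \<le> exp (3/2 :: real)"
  "exp 1 \<le> (27183 / 10000 :: real)" "7657 / 1000 \<le> exp (20357 / 10000 :: real)"
  "exp (12/100) \<le> (11275 / 10000 :: real)" "2718 / 1000 \<le> exp (1 :: real)"
proof -
  show "exp (3/2) \<le> (44818 / 10000 :: real)"
    using exp_upper_taylor[of "3/2" 10] by (simp add: lessThan_nat_numeral fact_numeral power_divide)
  show "44816 / 10000 \<le> exp (3/2 :: real)"
    using exp_partial_sum_le[of "3/2" 10] by (simp add: atMost_nat_numeral fact_numeral power_divide)
  show "exp 1 \<le> (27183 / 10000 :: real)"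
    using exp_upper_taylor[of 1 9] by (simp add: lessThan_nat_numeral fact_numeral)
  show "2718 / 1000 \<le> exp (1 :: real)"
    using exp_partial_sum_le[of 1 9] by (simp add: atMost_nat_numeral fact_numeral)
  show "7657 / 1000 \<le> exp (20357 / 10000 :: real)"
    using exp_partial_sum_le[of "20357 / 10000" 12]
    by (simp add: atMost_nat_numeral fact_numeral power_divide)
  show "exp (12/100) \<le> (11275 / 10000 :: real)"
    using exp_upper_taylor[of "12/100" 3] by (simp add: lessThan_nat_numeral fact_numeral power_divide)
qed

text \<open>Multiplying by \<open>A0\<close> turns \<open>t\<close> into \<open>r * x * A1\<close>,
  and \<open>\<theta> = s / x\<close> cancels one power of \<open>x\<close> in the quadratic term.
  The estimate thus stays bounded as \<open>x\<close> tends to 0 although \<open>\<theta>\<close>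
  does not.\<close>

lemma rate_expand:
  fixes A0 A1 x r s \<theta> t :: real
  assumes "0 < x" "0 < A0" "0 \<le> A1" "0 \<le> r" "0 \<le> s" "\<theta> = s / x" "t = A1 / A0 * (r * x)" "r * x * A1 < 3 * A0"
  shows "A0 * (1 + t + \<theta> * (exp t - 1 - t)) \<le> A0 + r * x * A1 + s * r\<^sup>2 * x * A1\<^sup>2 / (2 * (A0 - r * x * A1 / 3))"
proof -
  have tA: "t * A0 = r * x * A1" using assms by simp
  have t0: "0 \<le> t" using assms by simp
  have t3: "t < 3" using assms(2,8) tA by (metis mult_less_cancel_right_pos)
  have \<theta>0: "0 \<le> \<theta>" using assms by simp
  have pos: "0 < A0 - r * x * A1 / 3" using assms(8) by simp
  have "A0 * (1 + t + \<theta> * (exp t - 1 - t)) \<le> A0 * (1 + t + \<theta> * (t\<^sup>2 / (2 * (1 - t / 3))))"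
    using exp_minus_affine_le[OF t0 t3] assms(2) \<theta>0 by (intro mult_left_mono add_left_mono) auto
  also have "\<dots> = A0 + t * A0 + \<theta> * (t * A0)\<^sup>2 / (2 * (A0 - t * A0 / 3))"
  proof -
    have 1: "A0 * (1 - t / 3) = A0 - t * A0 / 3" by (simp add: algebra_simps)
    have 2: "A0 * (t\<^sup>2 / (2 * (1 - t / 3))) = (t * A0)\<^sup>2 / (2 * (A0 * (1 - t / 3)))"
      using assms(2) t3 by (simp add: power2_eq_square divide_simps)
    have 3: "A0 * (1 + t + \<theta> * v) = A0 + t * A0 + \<theta> * (A0 * v)" for v
      by (simp add: algebra_simps)
    show ?thesis unfolding 3 2 1 by (simp only: times_divide_eq_right)
  qed
  also have "\<theta> * (t * A0)\<^sup>2 = s * r\<^sup>2 * x * A1\<^sup>2"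
    unfolding tA using assms(1,6) by (simp add: power2_eq_square)
  finally show ?thesis by (simp only: tA)
qed

text \<open>\<open>D\<close> bounds the denominator from \<open>rate_expand\<close> from below. The
  cubic on the right is the Taylor polynomial of the exponential in \<open>rate_large\<close> with
  its coefficients rounded down. After clearing \<open>D\<close> the difference has degree 5 and is
  compared with a linear function.\<close>

lemma rate_polynomial:
  fixes x :: real
  assumes x: "0 \<le> x" "x \<le> 51 / 100"
  defines "D \<equiv> 19816 / 10000 + 3 / 2 * x - 7 / 30 * x * (34818 / 10000 + x)"
  shows "D > 0" and "(19818 / 10000 + 3 / 2 * x + 7 / 10 * x * (34818 / 10000 + x)) * D
      + 245 / 1000 * x * (34818 / 10000 + x)\<^sup>2
    \<le> (29998 / 10000 + 31309 / 10000 * x + 16338 / 10000 * x\<^sup>2 + 5684 / 10000 * x ^ 3) * D"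
proof -
  have "0 \<le> x * (51 / 100 - x)" using x by simp
  then have x2: "x\<^sup>2 \<le> 51 / 100 * x" by (simp add: algebra_simps power2_eq_square)
  show "D > 0" unfolding D_def using x x2 by (simp add: algebra_simps power2_eq_square)
  \<comment> \<open>The resulting bound is the tangent to the cube at 51/100, the right end of the
    interval.\<close>
  have "0 \<le> (x + 102 / 100) * (51 / 100 - x)\<^sup>2" using x by simp
  then have x3: "x ^ 3 \<ge> - 265302 / 1000000 + 7803 / 10000 * x"
    by (simp add: field_simps power2_eq_square power3_eq_cube)
  have "0 \<le> x ^ 4 * (1 - x)" using x by simp
  then have x5: "x ^ 5 \<le> x ^ 4" by (simp add: algebra_simps eval_nat_numeral)
  have x4: "0 \<le> x ^ 4" by simp
  have "(29998 / 10000 + 31309 / 10000 * x + 16338 / 10000 * x\<^sup>2 + 5684 / 10000 * x ^ 3) * D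
      - ((19818 / 10000 + 3 / 2 * x + 7 / 10 * x * (34818 / 10000 + x)) * D
        + 245 / 1000 * x * (34818 / 10000 + x)\<^sup>2)
      = 1260793 / 625000 - 19340223449 / 5000000000 * x - 2428628483 / 3750000000 * x\<^sup>2
        + 1283665733 / 750000000 * x ^ 3 + 64850177 / 375000000 * x ^ 4 - 9947 / 75000 * x ^ 5"
    unfolding D_def by (simp add: field_simps eval_nat_numeral)
  also have "\<dots> \<ge> 0" using x x2 x3 x4 x5 by linarith
  finally show "(19818 / 10000 + 3 / 2 * x + 7 / 10 * x * (34818 / 10000 + x)) * D
      + 245 / 1000 * x * (34818 / 10000 + x)\<^sup>2
    \<le> (29998 / 10000 + 31309 / 10000 * x + 16338 / 10000 * x\<^sup>2 + 5684 / 10000 * x ^ 3) * D"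
    by linarith
qed

lemma unpopular_fraction_ge:
  fixes x :: real
  assumes x: "0 \<le> x" "x \<le> 51 / 100"
  shows "7357 / 10000 + 3437 / 10000 * x \<le> exp (x - 1) * (2 - x)"
proof -
  have e: "36787 / 100000 \<le> exp (- 1 :: real)"
    using exp_numeric_bounds(3) by (simp add: exp_minus field_simps)
  have "0 \<le> x * (51 / 100 - x)" using x by simp
  then have x2: "x\<^sup>2 \<le> 51 / 100 * x" by (simp add: algebra_simps power2_eq_square)
  have x3: "x ^ 3 \<le> 2601 / 10000 * x"
    using mult_left_mono[OF x2, of x] x2 x by (simp add: power2_eq_square power3_eq_cube)
  have x4: "x ^ 4 \<le> 132651 / 1000000 * x"
    using mult_left_mono[OF x3, of x] x2 x by (simp add: power2_eq_square eval_nat_numeral)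
  have "2 + 9345 / 10000 * x \<le> 2 + x - x ^ 3 / 6 - x ^ 4 / 6" using x x3 x4 by linarith
  \<comment> \<open>The quadratic terms of this product cancel, so a linear lower bound loses
    little.\<close>
  also have "\<dots> = (1 + x + x\<^sup>2 / 2 + x ^ 3 / 6) * (2 - x)"
    by (simp add: field_simps eval_nat_numeral)
  also have "\<dots> \<le> exp x * (2 - x)" using x exp_cubic_le[of x] by (intro mult_right_mono) auto
  finally have 1: "2 + 9345 / 10000 * x \<le> exp x * (2 - x)" .
  have "7357 / 10000 + 3437 / 10000 * x \<le> 36787 / 100000 * (2 + 9345 / 10000 * x)"
    using x by simp
  also have "\<dots> \<le> exp (- 1) * (exp x * (2 - x))"
    using e 1 x by (intro mult_mono) auto
  also have "\<dots> = exp (x - 1) * (2 - x)" by (simp add: exp_diff exp_minus divide_simps)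
  finally show ?thesis .
qed

text \<open>
  The parameters \<open>z = 3/2\<close>, \<open>r = 7/10\<close> here and \<open>z = 3/25\<close>, \<open>r = 1\<close> in \<open>rate_small\<close> are
  numerical near-optima of the exponential rate; the supremum over \<open>x \<le> 51/100\<close> is about
  \<open>0.982\<close>, so there is little room.
\<close>

lemma rate_large:
  fixes x A0 A1 t \<theta> :: real
  assumes x: "0 < x" "x \<le> 51 / 100"
    and A0: "A0 = (1 - x) * trunc_exp (3/2) 0 + x * trunc_exp (3/2) 1"
    and A1: "A1 = (1 - x) * trunc_exp (3/2) 1 + x * trunc_exp (3/2) 2"
    and t: "t = A1 / A0 * (7/10 * x)" and \<theta>: "\<theta> = (3/2) / (3/2 * x)"
  shows "4 * (A0 * (1 + t + \<theta> * (exp t - 1 - t))) * exp (7/10 * (1 - x)) / (exp 3 * (7/10) * (3/2)\<^sup>2)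
     * exp (1 - exp (x - 1) * (2 - x)) \<le> 995 / 1000"
proof -
  define q where "q = exp (x - 1) * (2 - x)"
  define D where "D = 19816 / 10000 + 3 / 2 * x - 7 / 30 * x * (34818 / 10000 + x)"
  define M where "M = A0 * (1 + t + \<theta> * (exp t - 1 - t))"
  define P where "P = 29998 / 10000 + 31309 / 10000 * x + 16338 / 10000 * x\<^sup>2 + 5684 / 10000 * x ^ 3"
  define a1 where "a1 = 34818 / 10000 + x"
  note poly = rate_polynomial[of x, folded D_def a1_def]
  have D: "D > 0" using poly(1) x by simp
  have A0': "A0 = exp (3/2) - 5/2 + 3/2 * x" by (simp add: A0 trunc_exp_def field_simps)
  have A1': "A1 = exp (3/2) - 1 + x" by (simp add: A1 trunc_exp_def field_simps)
  have A0l: "19816 / 10000 + 3 / 2 * x \<le> A0" and A0u: "A0 \<le> 19818 / 10000 + 3 / 2 * x"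
    and A1u: "A1 \<le> a1" and A1l: "0 \<le> A1"
    using exp_numeric_bounds(1,2) x unfolding A0' A1' a1_def by linarith+
  have A0pos: "A0 > 0" using A0l x by linarith
  have xA: "x * A1 \<le> x * a1" using A1u x by (intro mult_left_mono) auto
  have Dle: "D \<le> A0 - 7/10 * x * A1 / 3"
    using A0l xA unfolding D_def a1_def[symmetric] by (simp add: mult.assoc)
  have "M \<le> A0 + 7/10 * x * A1 + 1 * (7/10)\<^sup>2 * x * A1\<^sup>2 / (2 * (A0 - 7/10 * x * A1 / 3))"
    unfolding M_def using x A0pos A1l D Dle
    by (intro rate_expand) (auto simp: t \<theta>)
  also have "\<dots> \<le> (19818 / 10000 + 3 / 2 * x) + 7/10 * x * a1 + 1 * (7/10)\<^sup>2 * x * a1\<^sup>2 / (2 * D)"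
    using A0u A1u A1l x xA D Dle
    by (intro add_mono frac_le mult_left_mono power_mono) auto
  also have "\<dots> = ((19818 / 10000 + 3 / 2 * x + 7 / 10 * x * a1) * D + 245 / 1000 * x * a1\<^sup>2) / D"
    using D by (simp add: field_simps power2_eq_square)
  also have "\<dots> \<le> P * D / D"
    using poly(2) D x unfolding P_def by (intro divide_right_mono) auto
  also have "\<dots> = P" using D by simp
  \<comment> \<open>The constant 39375/100000 is \<open>(7/10) * (3/2)\<^sup>2 / 4\<close>, the
    numerical part of the normalisation. The exponent collects what the remaining exponentials
    divide by, with 13/10 = 3 - 7/10 - 1.\<close>
  also have "P \<le> 995 / 1000 * (39375 / 100000) * exp (13/10 + q + 7/10 * x)"
  proof -
    define u where "u = 10437 / 10000 * x"
    have "20357 / 10000 + u \<le> 13/10 + q + 7/10 * x"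
      using unpopular_fraction_ge[of x] x unfolding u_def q_def by linarith
    then have 1: "exp (20357 / 10000) * exp u \<le> exp (13/10 + q + 7/10 * x)" by (simp flip: exp_add)
    have "1 + u + u\<^sup>2 / 2 + u ^ 3 / 6 \<le> exp u" using x by (intro exp_cubic_le) (simp add: u_def)
    then have 2: "7657 / 1000 * (1 + u + u\<^sup>2 / 2 + u ^ 3 / 6) \<le> exp (20357 / 10000) * exp u"
      using exp_numeric_bounds(4) x by (intro mult_mono) (auto simp: u_def)
    have "P \<le> 995 / 1000 * (39375 / 100000) * (7657 / 1000 * (1 + u + u\<^sup>2 / 2 + u ^ 3 / 6))"
    proof -
      have e: "995 / 1000 * (39375 / 100000) * (7657 / 1000 * (1 + u + u\<^sup>2 / 2 + u ^ 3 / 6))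
          = 299986903125 / 100000000000 + 299986903125 / 100000000000 * (10437 / 10000) * x
            + 299986903125 / 100000000000 * (10437 / 10000)\<^sup>2 / 2 * x\<^sup>2
            + 299986903125 / 100000000000 * (10437 / 10000) ^ 3 / 6 * x ^ 3"
        by (simp add: u_def power_mult_distrib power_divide distrib_left)
      have "0 \<le> x\<^sup>2" "0 \<le> x ^ 3" using x by auto
      then show ?thesis unfolding e P_def using x
        by (intro add_mono mult_right_mono) (auto simp: power2_eq_square power3_eq_cube)
    qed
    also have "\<dots> \<le> 995 / 1000 * (39375 / 100000) * exp (13/10 + q + 7/10 * x)"
      using 1 2 by (intro mult_left_mono) linarith+
    finally show ?thesis .
  qed
  finally have M: "M \<le> 995 / 1000 * (39375 / 100000) * exp (13/10 + q + 7/10 * x)" .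
  have "exp (7/10 * (1 - x)) / exp 3 * exp (1 - q) = exp (- (13/10 + q + 7/10 * x))"
    by (simp add: field_simps flip: exp_add exp_diff)
  then have "4 * M * exp (7/10 * (1 - x)) / (exp 3 * (7/10) * (3/2)\<^sup>2) * exp (1 - q)
      = M / (39375 / 100000) * exp (- (13/10 + q + 7/10 * x))"
    by (simp add: power2_eq_square field_simps)
  also have "\<dots> \<le> (995 / 1000 * (39375 / 100000) * exp (13/10 + q + 7/10 * x)) / (39375 / 100000)
      * exp (- (13/10 + q + 7/10 * x))"
    using M by (intro mult_right_mono divide_right_mono) auto
  also have "\<dots> = 995 / 1000" by (simp flip: exp_add)
  finally show ?thesis by (simp only: M_def q_def)
qed

text \<open>The last factor is \<open>exp 1\<close> since the second round outside
  \<open>S \<union> W\<close> is ignored here. As \<open>x\<close> tends to 0 with \<open>z\<close>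
  fixed the leading term is \<open>4 * (exp z - 1 - z) / (e * z\<^sup>2)\<close>, which approaches
  2/e for small \<open>z\<close>. So \<open>z\<close> should be small, yet large enough compared
  with \<open>x\<close> that the correction terms remain negligible against
  \<open>A0\<close>.\<close>

lemma rate_small:
  fixes x A0 A1 t \<theta> :: real
  assumes x: "0 < x" "x \<le> 1 / 1000"
    and A0: "A0 = (1 - x) * trunc_exp (12/100) 0 + x * trunc_exp (12/100) 1"
    and A1: "A1 = (1 - x) * trunc_exp (12/100) 1 + x * trunc_exp (12/100) 2"
    and t: "t = A1 / A0 * (1 * x)" and \<theta>: "\<theta> = (12/100) / (3/2 * x)"
  shows "4 * (A0 * (1 + t + \<theta> * (exp t - 1 - t))) * exp (1 * (1 - x)) / (exp 3 * 1 * (12/100)\<^sup>2)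
     * exp 1 \<le> 995 / 1000"
proof -
  define M where "M = A0 * (1 + t + \<theta> * (exp t - 1 - t))"
  have A0': "A0 = exp (12/100) - 112/100 + 12/100 * x" by (simp add: A0 trunc_exp_def field_simps)
  have A1': "A1 = exp (12/100) - 1 + x" by (simp add: A1 trunc_exp_def field_simps)
  have el: "112/100 + 72/10000 \<le> exp (12/100 :: real)"
    using exp_lower_Taylor_quadratic[of "12/100"] by (simp add: power2_eq_square)
  have A0l: "72/10000 \<le> A0" and A0u: "A0 \<le> 762/100000" and A1u: "A1 \<le> 1285/10000" and A1l: "0 \<le> A1"
    using exp_numeric_bounds(5) el x unfolding A0' A1' by linarith+
  have xA: "x * A1 \<le> 1/1000 * (1285/10000)" using A1u A1l x by (intro mult_mono) auto
  have Dle: "7/1000 \<le> A0 - 1 * x * A1 / 3" using A0l xA by simp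
  have "M \<le> A0 + 1 * x * A1 + 8/100 * 1\<^sup>2 * x * A1\<^sup>2 / (2 * (A0 - 1 * x * A1 / 3))"
    unfolding M_def using x A0l A1l Dle by (intro rate_expand) (auto simp: t \<theta>)
  also have "\<dots> \<le> 762/100000 + 1/1000 * (1285/10000)
      + 8/100 * 1\<^sup>2 * (1/1000) * (1285/10000)\<^sup>2 / (2 * (7/1000))"
    using A0u A1u A1l x xA Dle
    by (intro add_mono frac_le mult_mono power_mono) auto
  also have "\<dots> \<le> 785/100000" by (simp add: power2_eq_square)
  finally have M: "M \<le> 785/100000" .
  have "exp (1 * (1 - x)) / exp 3 * exp 1 = exp (- 1 - x)"
    by (simp flip: exp_add exp_diff)
  also have "\<dots> \<le> exp (- 1)" using x by simp
  also have "\<dots> \<le> 1000/2718" using exp_numeric_bounds(6) by (simp add: exp_minus field_simps)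
  finally have e: "exp (1 * (1 - x)) / exp 3 * exp 1 \<le> 1000/2718" .
  have "4 * M * exp (1 * (1 - x)) / (exp 3 * 1 * (12/100)\<^sup>2) * exp 1
      = M * (4 / (12/100)\<^sup>2) * (exp (1 * (1 - x)) / exp 3 * exp 1)"
    by (simp add: field_simps)
  also have "\<dots> \<le> 785/100000 * (4 / (12/100)\<^sup>2) * (1000/2718)"
    using M e by (intro mult_mono) auto
  also have "\<dots> \<le> 995/1000" by (simp add: power2_eq_square)
  finally show ?thesis by (simp only: M_def)
qed

section \<open>Summation over all obstructions\<close>

text \<open>Stirling's bound up to a polynomial factor; the induction step amounts to
  \<open>(j / (j + 1)) ^ (j + 1) \<le> exp (- 1)\<close>.\<close>

lemma fact_le_exp_power:
  assumes "j \<ge> 1"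
  shows "fact j \<le> exp 1 * real j * (real j / exp 1) ^ j"
  using assms
proof (induction j rule: nat_induct_at_least)
  case base
  then show ?case by simp
next
  case (Suc j)
  have "exp (- (1 / real (Suc j))) \<ge> 1 - 1 / real (Suc j)"
    using exp_ge_add_one_self[of "- (1 / real (Suc j))"] by simp
  then have "(1 - 1 / real (Suc j)) ^ Suc j \<le> exp (- (1 / real (Suc j))) ^ Suc j"
    by (intro power_mono) (auto simp: field_simps)
  also have "\<dots> = exp (real (Suc j) * - (1 / real (Suc j)))" by (rule exp_of_nat_mult[symmetric])
  also have "real (Suc j) * - (1 / real (Suc j)) = - 1" by simp
  finally have "(real j / real (Suc j)) ^ Suc j \<le> exp (- 1)" by (simp add: field_simps)
  then have le: "real j ^ Suc j \<le> exp (- 1) * real (Suc j) ^ Suc j"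
    by (simp add: power_divide divide_simps)
  have "fact (Suc j) = real (Suc j) * fact j" by simp
  also have "\<dots> \<le> real (Suc j) * (exp 1 * real j * (real j / exp 1) ^ j)"
    using Suc.IH by (intro mult_left_mono) auto
  also have "\<dots> = real (Suc j) * exp 1 * (real j ^ Suc j / exp 1 ^ j)"
    by (simp add: power_divide)
  also have "\<dots> \<le> real (Suc j) * exp 1 * (exp (- 1) * real (Suc j) ^ Suc j / exp 1 ^ j)"
    using le by (intro mult_left_mono divide_right_mono) auto
  also have "\<dots> = exp 1 * real (Suc j) * (real (Suc j) / exp 1) ^ Suc j"
    by (simp add: power_divide exp_minus divide_simps)
  finally show ?case .
qed

text \<open>The left-hand side is one term of the binomial expansion of 1.\<close>

lemma choose_mult_power_le:
  assumes "k \<le> n" "0 \<le> x" "x \<le> (1::real)"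
  shows "real (n choose k) * x ^ k * (1 - x) ^ (n - k) \<le> 1"
proof -
  have "real (n choose k) * x ^ k * (1 - x) ^ (n - k)
      \<le> (\<Sum>j\<le>n. real (n choose j) * x ^ j * (1 - x) ^ (n - j))"
    using assms by (intro member_le_sum) auto
  also have "\<dots> = (x + (1 - x)) ^ n" by (rule binomial_ring[symmetric])
  finally show ?thesis by simp
qed

context hall_pair
begin

text \<open>The ratio of the two binomial coefficients yields the factor \<open>x / (1 - x)\<close>;
  each remaining copy of \<open>n choose k\<close> is bounded by
  \<open>choose_mult_power_le\<close>. One of the two powers \<open>(1 - x) ^ (n - k)\<close> in the
  denominator is paid for by the first selections of \<open>T\<close>.\<close>

lemma choose_choose_le:
  "real (n choose k) * real (n choose (k - 1)) * (1 - x) ^ (n - k + 1)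
     \<le> x / (x ^ (2 * k) * (1 - x) ^ (n - k))"
proof -
  define D where "D = (1 - x) ^ (n - k)"
  define C where "C = real (n choose k)"
  have D: "D > 0" using x_bounds(2) by (simp add: D_def)
  have xk: "x ^ k > 0" using x_bounds(1) by simp
  have "C * x ^ k * D \<le> 1" unfolding C_def D_def using x_bounds(1,2) k_less
    by (intro choose_mult_power_le) auto
  then have C: "C \<le> 1 / (x ^ k * D)" using D xk by (simp add: field_simps)
  have "(n - (k - 1)) * (n choose (k - 1)) = k * (n choose k)"
    using binomial_absorb_comp[of n "k - 1"] binomial_absorption[of "k - 1" n] k_pos by simp
  then have "real (n - (k - 1)) * real (n choose (k - 1)) = real k * C"
    unfolding C_def of_nat_mult[symmetric] by simp
  moreover have "real (n - k) \<le> real (n - (k - 1))" by simp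
  ultimately have "real (n - k) * real (n choose (k - 1)) \<le> real k * C"
    by (metis mult_right_mono of_nat_0_le_iff)
  then have C1: "real (n choose (k - 1)) * (1 - x) \<le> x * C"
    unfolding x_bounds(3) using n_pos by (simp add: x_def field_simps)
  have "C * real (n choose (k - 1)) * (1 - x) ^ (n - k + 1) = C * D * (real (n choose (k - 1)) * (1 - x))"
    by (simp add: D_def)
  also have "\<dots> \<le> C * D * (x * C)"
    using C1 D by (intro mult_left_mono) (auto simp: C_def)
  also have "\<dots> = x * D * (C * C)" by simp
  also have "\<dots> \<le> x * D * ((1 / (x ^ k * D)) * (1 / (x ^ k * D)))"
    using C D xk x_bounds(1) by (intro mult_left_mono mult_mono) (auto simp: C_def)
  also have "\<dots> = x / (x ^ (2 * k) * D)"
  proof -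
    have "x ^ (2 * k) = x ^ k * x ^ k" by (simp add: mult_2 power_add)
    then show ?thesis using D xk by simp
  qed
  finally show ?thesis by (simp add: C_def D_def)
qed

text \<open>Gathers everything exponential in \<open>k\<close> into the rate \<open>L\<close> per
  element of \<open>S\<close>. Taking the second evaluation point as \<open>r * x\<close> makes
  \<open>exp (r * x) ^ (n - k)\<close> exactly a \<open>k\<close>-th power. Of the factor
  \<open>exp 3\<close> in \<open>L\<close>, two powers of e come from the factorial of
  \<open>2 * k\<close> and one from that of \<open>k\<close>.\<close>

lemma obstruction_weight_le:
  fixes z r \<theta> A0 A1 t Q :: real
  assumes z: "z > 0" and r: "r > 0" and \<theta>: "\<theta> = z / (3 / 2 * x)" "1 \<le> \<theta>"
    and A0: "A0 = (1 - x) * trunc_exp z 0 + x * trunc_exp z 1" "A0 > 0"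
    and A1: "A1 = (1 - x) * trunc_exp z 1 + x * trunc_exp z 2" "A1 > 0"
    and t: "t = A1 / A0 * (r * x)"
    and Q: "avg ((R \<union> T) \<times> UNIV) X F_T \<le> (1 - x) ^ (n - k + 1) * Q" "0 \<le> Q"
    and L: "L = 4 * (A0 * (1 + t + \<theta> * (exp t - 1 - t))) * exp (r * (1 - x)) / (exp 3 * r * z\<^sup>2)"
  shows "real (n choose k) * real (n choose (k - 1)) *
      avg ((A \<union> B) \<times> UNIV) X (\<lambda>h. of_bool (hall_obstruction n (sel_edges A B m h) S W))
    \<le> 2 * (exp 1)\<^sup>2 * r / A0 * (real k ^ 3 / real n) * L ^ k * (Q / (1 - x) ^ (n - k))"
proof -
  define e :: real where "e = exp 1"
  have e: "e > 0" by (simp add: e_def)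
  define y where "y = r * x"
  define \<Phi> where "\<Phi> = 1 + t + \<theta> * (exp t - 1 - t)"
  define a where "a = 4 / (e\<^sup>2 * z\<^sup>2)"
  define b where "b = 1 / (r * e)"
  define g where "g = exp (r * (1 - x))"
  define Y where "Y = A0 ^ (k - 1) * (fact (k - 1) / (real n * y) ^ (k - 1) * (\<Phi> ^ k * exp y ^ (n - k)))"
  define CC where "CC = real (n choose k) * real (n choose (k - 1))"
  have x: "x > 0" "1 - x > 0" using x_bounds(1,2) by auto
  have y: "y > 0" using r x by (simp add: y_def)
  have t0: "t \<ge> 0" using A0(2) A1(2) r x by (simp add: t)
  have "0 \<le> \<theta> * (exp t - 1 - t)"
    using \<theta>(2) exp_ge_add_one_self[of t] by (intro mult_nonneg_nonneg) linarith+
  then have \<Phi>: "\<Phi> > 0" using t0 by (simp add: \<Phi>_def)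
  have "avg ((W \<union> S) \<times> UNIV) X F_S \<le> fact (2 * k) / (real n * z) ^ (2 * k) * Y"
  proof -
    have "avg (W \<times> UNIV) X (\<lambda>h. \<theta> ^ card {v\<in>S. 2 \<le> indeg h v} * (\<Prod>w\<in>W. trunc_exp z (hits h w))) \<le> Y"
      using avg_W_le[OF z y _ A0(1) A1(1) refl, of \<theta>] \<theta>(2) t by (simp add: Y_def \<Phi>_def y_def)
    then show ?thesis
      using z by (intro order_trans[OF avg_F_S_le[OF z \<theta>]] mult_left_mono) auto
  qed
  moreover have Y0: "Y \<ge> 0" using A0(2) y \<Phi> by (auto simp: Y_def)
  ultimately have "avg ((A \<union> B) \<times> UNIV) X (\<lambda>h. of_bool (hall_obstruction n (sel_edges A B m h) S W))
      \<le> (fact (2 * k) / (real n * z) ^ (2 * k) * Y) * ((1 - x) ^ (n - k + 1) * Q)"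
    using Q z by (intro order_trans[OF avg_obstruction_le] mult_mono avg_nonneg)
       (auto simp: F_T_def)
  then have "CC * avg ((A \<union> B) \<times> UNIV) X (\<lambda>h. of_bool (hall_obstruction n (sel_edges A B m h) S W))
      \<le> CC * ((fact (2 * k) / (real n * z) ^ (2 * k) * Y) * ((1 - x) ^ (n - k + 1) * Q))"
    by (intro mult_left_mono) (auto simp: CC_def)
  also have "\<dots> = (CC * (1 - x) ^ (n - k + 1)) * (fact (2 * k) / (real n * z) ^ (2 * k)) * Y * Q"
    by (simp only: mult_ac)
  also have "\<dots> \<le> (x / (x ^ (2 * k) * (1 - x) ^ (n - k))) * (2 * e * real k * (x ^ (2 * k) * a ^ k))
      * (A0 ^ k / A0 * (r * e * real k * b ^ k * (\<Phi> ^ k * g ^ k))) * Q"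
  proof (intro mult_mono mult_nonneg_nonneg)
    show "CC * (1 - x) ^ (n - k + 1) \<le> x / (x ^ (2 * k) * (1 - x) ^ (n - k))"
      unfolding CC_def by (rule choose_choose_le)
    have "fact (2 * k) \<le> exp 1 * real (2 * k) * (real (2 * k) / exp 1) ^ (2 * k)"
      using k_pos by (intro fact_le_exp_power) auto
    then have "fact (2 * k) / (real n * z) ^ (2 * k)
        \<le> exp 1 * real (2 * k) * (real (2 * k) / exp 1) ^ (2 * k) / (real n * z) ^ (2 * k)"
      using z by (intro divide_right_mono) auto
    also have "\<dots> = 2 * e * real k * ((real (2 * k) / e) / (real n * z)) ^ (2 * k)"
      by (simp add: e_def power_divide power_mult_distrib)
    also have "(real (2 * k) / e) / (real n * z) = x * (2 / (e * z))" by (simp add: x_def mult_ac)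
    also have "(x * (2 / (e * z))) ^ (2 * k) = x ^ (2 * k) * a ^ k"
      by (simp add: a_def power_mult_distrib power_mult power_divide)
    finally show "fact (2 * k) / (real n * z) ^ (2 * k) \<le> 2 * e * real k * (x ^ (2 * k) * a ^ k)" .
    show "Y \<le> A0 ^ k / A0 * (r * e * real k * b ^ k * (\<Phi> ^ k * g ^ k))"
      unfolding Y_def
    proof (intro mult_mono mult_nonneg_nonneg)
      show "A0 ^ (k - 1) \<le> A0 ^ k / A0" using A0(2) k_pos by (cases k) auto
      have ny: "real n * y = r * real k" using n_pos by (simp add: y_def x_def)
      \<comment> \<open>\<open>n * y = r * k\<close>, so passing from \<open>k - 1\<close> to
        \<open>k\<close> costs just the factor \<open>r\<close>.\<close>
      have "fact (k - 1) / (real n * y) ^ (k - 1) = r * (fact k / (r * real k) ^ k)"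
      proof -
        obtain j where "k = Suc j" using k_pos by (cases k) auto
        then show ?thesis unfolding ny using r by (simp del: of_nat_Suc)
      qed
      also have "\<dots> \<le> r * ((exp 1 * real k * (real k / exp 1) ^ k) / (r * real k) ^ k)"
        using r k_pos by (intro mult_left_mono divide_right_mono fact_le_exp_power) auto
      also have "\<dots> = r * e * real k * ((real k / e) / (r * real k)) ^ k"
        by (simp add: e_def power_divide power_mult_distrib)
      also have "(real k / e) / (r * real k) = b" using k_pos by (simp add: b_def)
      finally show "fact (k - 1) / (real n * y) ^ (k - 1) \<le> r * e * real k * b ^ k" .
      have "real (n - k) * y = real k * (r * (1 - x))"
        using n_pos by (simp add: y_def x_bounds(3)) (simp add: x_def)
      then show "exp y ^ (n - k) \<le> g ^ k" by (simp add: g_def flip: exp_of_nat_mult)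
    qed (use A0(2) y \<Phi> r e in \<open>auto simp: b_def\<close>)
  qed (use Y0 Q(2) x e z r A0(2) \<Phi> in \<open>auto simp: a_def b_def g_def CC_def\<close>)
  also have "\<dots> = 2 * e\<^sup>2 * r / A0 * (x * real k ^ 2) * (a * A0 * b * \<Phi> * g) ^ k * (Q / (1 - x) ^ (n - k))"
    using x by (simp add: power_mult_distrib power2_eq_square mult_ac)
  also have "a * A0 * b * \<Phi> * g = L"
  proof -
    have "exp 3 = e * e * e" by (simp add: e_def flip: exp_add)
    then show ?thesis unfolding L a_def b_def g_def \<Phi>_def by (simp add: power2_eq_square mult_ac)
  qed
  also have "x * real k ^ 2 = real k ^ 3 / real n" by (simp add: x_def power2_eq_square power3_eq_cube)
  finally show ?thesis by (simp only: CC_def e_def)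
qed

text \<open>\<open>1 / (1 - x) \<le> exp (x / (1 - x))\<close>, and the exponent summed over
  \<open>n - k\<close> factors is exactly \<open>k\<close>.\<close>

lemma inverse_power_le: "1 / (1 - x) ^ (n - k) \<le> exp 1 ^ k"
proof -
  have x: "1 - x > 0" using x_bounds(2) by simp
  have "1 / (1 - x) = 1 + x / (1 - x)" using x by (simp add: field_simps)
  also have "\<dots> \<le> exp (x / (1 - x))" by (rule exp_ge_add_one_self)
  finally have "(1 / (1 - x)) ^ (n - k) \<le> exp (x / (1 - x)) ^ (n - k)"
    using x by (intro power_mono) auto
  also have "\<dots> = exp (real (n - k) * (x / (1 - x)))" by (simp flip: exp_of_nat_mult)
  also have "real (n - k) * (x / (1 - x)) = real k"
    using k_less n_pos unfolding x_bounds(3) by (simp add: x_def)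
  finally show ?thesis by (simp add: power_divide flip: exp_of_nat_mult)
qed

lemma q_bounds: "0 \<le> q" "q \<le> 1"
proof -
  show "0 \<le> q" using x_bounds(2) by (simp add: q_def)
  have "2 - x \<le> exp (1 - x)" using exp_ge_add_one_self[of "1 - x"] by simp
  then have "exp (x - 1) * (2 - x) \<le> exp (x - 1) * exp (1 - x)" by (intro mult_left_mono) auto
  then show "q \<le> 1" by (simp add: q_def flip: exp_add)
qed

text \<open>The argument of \<open>inverse_power_le\<close> applied to
  \<open>(1 - q * x) / (1 - x)\<close>; Stirling's bound accounts for the factor
  \<open>exp 1 * n\<close>.\<close>

lemma second_round_factor_le:
  "fact (n - k) * exp (real (n - k)) / real (n - k) ^ (n - k) * (1 - q * x) ^ (n - k + 1) / (1 - x) ^ (n - k)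
     \<le> exp 1 * real n * exp (1 - q) ^ k"
proof -
  define N where "N = n - k"
  have N: "N \<ge> 1" "N \<le> n" using k_less by (auto simp: N_def)
  have x: "1 - x > 0" using x_bounds(2) by simp
  have qx: "0 \<le> 1 - q * x" "1 - q * x \<le> 1"
    using q_bounds x_bounds(1,2) mult_mono[of q 1 x 1] by auto
  have "fact N * exp (real N) / real N ^ N \<le> (exp 1 * real N * (real N / exp 1) ^ N) * exp (real N) / real N ^ N"
    using N by (intro divide_right_mono mult_right_mono fact_le_exp_power) auto
  also have "\<dots> = exp 1 * real N"
  proof -
    have "exp 1 ^ N = exp (real N)" by (simp flip: exp_of_nat_mult)
    then show ?thesis using N by (simp add: power_divide)
  qed
  also have "\<dots> \<le> exp 1 * real n" using N by simp
  finally have f: "fact N * exp (real N) / real N ^ N \<le> exp 1 * real n" .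
  have "(1 - q * x) / (1 - x) = 1 + (1 - q) * x / (1 - x)" using x by (simp add: field_simps)
  also have "\<dots> \<le> exp ((1 - q) * x / (1 - x))" by (rule exp_ge_add_one_self)
  finally have "((1 - q * x) / (1 - x)) ^ N \<le> exp ((1 - q) * x / (1 - x)) ^ N"
    using x qx by (intro power_mono) auto
  also have "\<dots> = exp (real N * ((1 - q) * x / (1 - x)))" by (simp flip: exp_of_nat_mult)
  also have "real N * ((1 - q) * x / (1 - x)) = real k * (1 - q)"
    using k_less n_pos unfolding x_bounds(3) by (simp add: x_def N_def)
  finally have p: "((1 - q * x) / (1 - x)) ^ N \<le> exp (1 - q) ^ k" by (simp flip: exp_of_nat_mult)
  have "fact N * exp (real N) / real N ^ N * (1 - q * x) ^ (N + 1) / (1 - x) ^ N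
      = fact N * exp (real N) / real N ^ N * (((1 - q * x) / (1 - x)) ^ N * (1 - q * x))"
    by (simp add: power_divide)
  also have "\<dots> \<le> (exp 1 * real n) * (exp (1 - q) ^ k * 1)"
    using f p qx x by (intro mult_mono) auto
  finally show ?thesis by (simp add: N_def)
qed

end

lemma (in hall_pair) obstruction_term_le:
  assumes n: "50 \<le> n" "2 * k \<le> n + 1"
  shows "real (n choose k) * real (n choose (k - 1)) *
      avg ((A \<union> B) \<times> UNIV) X (\<lambda>h. of_bool (hall_obstruction n (sel_edges A B m h) S W))
    \<le> 20000 / real n * (real k ^ 4 * (995 / 1000) ^ k)"
proof -
  have x0: "0 < x" "x < 1" using x_bounds(1,2) .
  \<comment> \<open>\<open>x \<le> 1/2 + 1 / (2 * n)\<close>, and \<open>n \<ge> 50\<close> makes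
    this 51/100.\<close>
  have xu: "x \<le> 51 / 100" using n n_pos by (simp add: x_def field_simps)
  have e2: "(exp 1)\<^sup>2 \<le> (74 / 10 :: real)" and e3: "(exp 1)\<^sup>2 * exp 1 \<le> (202 / 10 :: real)"
  proof -
    have "(exp 1)\<^sup>2 \<le> (27183 / 10000 :: real)\<^sup>2"
      using exp_numeric_bounds(3) by (intro power_mono) auto
    then show e2: "(exp 1)\<^sup>2 \<le> (74 / 10 :: real)" by (simp add: power2_eq_square)
    have "(exp 1)\<^sup>2 * exp 1 \<le> (74 / 10) * (27183 / 10000 :: real)"
      using e2 exp_numeric_bounds(3) by (intro mult_mono) auto
    then show "(exp 1)\<^sup>2 * exp 1 \<le> (202 / 10 :: real)" by simp
  qed
  have k3: "real k ^ 3 \<le> real k ^ 4" using k_pos by (intro power_increasing) auto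
  show ?thesis
  proof (cases "x \<le> 1 / 1000")
    case True
    define \<theta> where "\<theta> = (12/100) / (3/2 * x)"
    define A0 where "A0 = (1 - x) * trunc_exp (12/100) 0 + x * trunc_exp (12/100) 1"
    define A1 where "A1 = (1 - x) * trunc_exp (12/100) 1 + x * trunc_exp (12/100) 2"
    define t where "t = A1 / A0 * (1 * x)"
    define L where "L = 4 * (A0 * (1 + t + \<theta> * (exp t - 1 - t))) * exp (1 * (1 - x)) / (exp 3 * 1 * (12/100)\<^sup>2)"
    have A0': "A0 = exp (12/100) - 112/100 + 12/100 * x" by (simp add: A0_def trunc_exp_def field_simps)
    have A1': "A1 = exp (12/100) - 1 + x" by (simp add: A1_def trunc_exp_def field_simps)
    have el: "112/100 + 72/10000 \<le> exp (12/100 :: real)"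
      using exp_lower_Taylor_quadratic[of "12/100"] by (simp add: power2_eq_square)
    have A0l: "72/10000 \<le> A0" and A1l: "0 < A1" using el x0 unfolding A0' A1' by linarith+
    have \<theta>1: "1 \<le> \<theta>" using True x0 by (simp add: \<theta>_def field_simps)
    have L0: "0 \<le> L"
    proof -
      have "0 \<le> t" using A0l A1l x0 by (simp add: t_def)
      moreover have "0 \<le> \<theta> * (exp t - 1 - t)"
        using \<theta>1 exp_ge_add_one_self[of t] by (intro mult_nonneg_nonneg) linarith+
      ultimately show ?thesis using A0l by (simp add: L_def)
    qed
    have "real (n choose k) * real (n choose (k - 1)) *
        avg ((A \<union> B) \<times> UNIV) X (\<lambda>h. of_bool (hall_obstruction n (sel_edges A B m h) S W))
      \<le> 2 * (exp 1)\<^sup>2 * 1 / A0 * (real k ^ 3 / real n) * L ^ k * (1 / (1 - x) ^ (n - k))"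
      using avg_F_T_le1 A0l A1l \<theta>1
      by (intro obstruction_weight_le[OF _ _ \<theta>_def _ A0_def _ A1_def _ t_def _ _ L_def]) auto
    also have "\<dots> \<le> 20000 * (real k ^ 4 / real n) * L ^ k * exp 1 ^ k"
    proof (intro mult_mono mult_nonneg_nonneg)
      have "2 * (exp 1)\<^sup>2 * 1 / A0 \<le> (2 * (74 / 10) * 1) / (72/10000 :: real)"
        using e2 A0l by (intro frac_le) auto
      then show "2 * (exp 1)\<^sup>2 * 1 / A0 \<le> 20000" by simp
      show "real k ^ 3 / real n \<le> real k ^ 4 / real n" using k3 by (intro divide_right_mono) auto
    qed (use L0 A0l x0 inverse_power_le in auto)
    also have "\<dots> = 20000 / real n * (real k ^ 4 * (L * exp 1) ^ k)" by (simp add: power_mult_distrib)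
    also have "\<dots> \<le> 20000 / real n * (real k ^ 4 * (995 / 1000) ^ k)"
      using rate_small[OF x0(1) True A0_def A1_def t_def \<theta>_def] L0 unfolding L_def[symmetric]
      by (intro mult_left_mono power_mono) auto
    finally show ?thesis .
  next
    case False
    define \<theta> where "\<theta> = (3/2) / (3/2 * x)"
    define A0 where "A0 = (1 - x) * trunc_exp (3/2) 0 + x * trunc_exp (3/2) 1"
    define A1 where "A1 = (1 - x) * trunc_exp (3/2) 1 + x * trunc_exp (3/2) 2"
    define t where "t = A1 / A0 * (7/10 * x)"
    define L where "L = 4 * (A0 * (1 + t + \<theta> * (exp t - 1 - t))) * exp (7/10 * (1 - x)) / (exp 3 * (7/10) * (3/2)\<^sup>2)"
    define Q where "Q = fact (n - k) * exp (real (n - k)) / real (n - k) ^ (n - k) * (1 - q * x) ^ (n - k + 1)"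
    have A0': "A0 = exp (3/2) - 5/2 + 3/2 * x" by (simp add: A0_def trunc_exp_def field_simps)
    have A1': "A1 = exp (3/2) - 1 + x" by (simp add: A1_def trunc_exp_def field_simps)
    have A0l: "19/10 \<le> A0" and A1l: "0 < A1"
      using exp_numeric_bounds(2) x0 unfolding A0' A1' by linarith+
    have \<theta>1: "1 \<le> \<theta>" using x0 by (simp add: \<theta>_def field_simps)
    have Q0: "0 \<le> Q"
    proof -
      have "q * x \<le> 1" using q_bounds x0 mult_mono[of q 1 x 1] by simp
      then show ?thesis by (simp add: Q_def)
    qed
    have L0: "0 \<le> L"
    proof -
      have "0 \<le> t" using A0l A1l x0 by (simp add: t_def)
      moreover have "0 \<le> \<theta> * (exp t - 1 - t)"
        using \<theta>1 exp_ge_add_one_self[of t] by (intro mult_nonneg_nonneg) linarith+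
      ultimately show ?thesis using A0l by (simp add: L_def)
    qed
    \<comment> \<open>Converts the factor \<open>n\<close> lost by the second-round bound into
      \<open>1000 * k\<close>; this restores 1/n and explains the fourth power of
      \<open>k\<close>.\<close>
    have kn: "real n \<le> 1000 * real k" using False n_pos by (simp add: x_def field_simps)
    have "real (n choose k) * real (n choose (k - 1)) *
        avg ((A \<union> B) \<times> UNIV) X (\<lambda>h. of_bool (hall_obstruction n (sel_edges A B m h) S W))
      \<le> 2 * (exp 1)\<^sup>2 * (7/10) / A0 * (real k ^ 3 / real n) * L ^ k * (Q / (1 - x) ^ (n - k))"
      using avg_F_T_le2[folded Q_def] Q0 A0l A1l \<theta>1
      by (intro obstruction_weight_le[OF _ _ \<theta>_def _ A0_def _ A1_def _ t_def _ _ L_def]) auto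
    also have "\<dots> \<le> 2 * (exp 1)\<^sup>2 * (7/10) / A0 * (real k ^ 3 / real n) * L ^ k * (exp 1 * real n * exp (1 - q) ^ k)"
      using second_round_factor_le[folded Q_def] L0 A0l by (intro mult_left_mono) auto
    also have "\<dots> = (2 * ((exp 1)\<^sup>2 * exp 1) * (7/10) / A0) * real k ^ 3 * (L * exp (1 - q)) ^ k"
      using n_pos by (simp add: power_mult_distrib mult_ac)
    also have "\<dots> \<le> 20 * (1000 * real k ^ 4 / real n) * (995 / 1000) ^ k"
    proof (intro mult_mono power_mono mult_nonneg_nonneg)
      have "2 * ((exp 1)\<^sup>2 * exp 1) * (7/10) / A0 \<le> (2 * (202 / 10) * (7/10)) / (19/10 :: real)"
        using e3 A0l by (intro frac_le mult_right_mono mult_left_mono) auto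
      then show "2 * ((exp 1)\<^sup>2 * exp 1) * (7/10) / A0 \<le> 20" by simp
      have "real k ^ 3 * real n \<le> real k ^ 3 * (1000 * real k)" using kn by (intro mult_left_mono) auto
      then show "real k ^ 3 \<le> 1000 * real k ^ 4 / real n"
        using n_pos by (simp add: field_simps eval_nat_numeral)
      show "L * exp (1 - q) \<le> 995 / 1000"
        using rate_large[OF x0(1) xu A0_def A1_def t_def \<theta>_def] unfolding L_def[symmetric] q_def .
    qed (use L0 in auto)
    finally show ?thesis by simp
  qed
qed

lemma summable_power_geometric: "summable (\<lambda>k. real k ^ 4 * (995 / 1000) ^ k)"
proof (rule summable_ratio_test[where c="999/1000" and N=1000])
  fix k :: nat assume k: "1000 \<le> k"
  have "real (Suc k) ^ 4 \<le> (1001 / 1000 * real k) ^ 4" using k by (intro power_mono) auto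
  also have "\<dots> = (1001 / 1000) ^ 4 * real k ^ 4" by (rule power_mult_distrib)
  finally have "995 / 1000 * real (Suc k) ^ 4 \<le> 995 / 1000 * ((1001 / 1000) ^ 4 * real k ^ 4)" by simp
  also have "\<dots> \<le> 999 / 1000 * real k ^ 4" by (simp add: power_divide field_simps)
  finally have "(995 / 1000 * real (Suc k) ^ 4) * (995 / 1000) ^ k \<le> (999 / 1000 * real k ^ 4) * (995 / 1000) ^ k"
    by (intro mult_right_mono) auto
  then show "norm (real (Suc k) ^ 4 * (995 / 1000) ^ Suc k) \<le> 999 / 1000 * norm (real k ^ 4 * (995 / 1000 :: real) ^ k)"
    by (simp add: mult_ac abs_mult del: of_nat_Suc)
qed simp

definition "obstruction_const = 20000 * (\<Sum>k. real k ^ 4 * (995 / 1000 :: real) ^ k)"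

lemma (in sides) avg_exists_obstruction_le:
  assumes n: "50 \<le> n"
  shows "avg ((A \<union> B) \<times> UNIV) X
      (\<lambda>h. of_bool (\<exists>S W. S \<subseteq> A \<and> W \<subseteq> B \<and> hall_obstruction n (sel_edges A B m h) S W))
    \<le> obstruction_const / real n"
proof -
  define SS where "SS k = {S. S \<subseteq> A \<and> card S = k}" for k
  define WW where "WW k = {W. W \<subseteq> B \<and> card W = k - 1}" for k
  define K where "K = {k. 1 \<le> k \<and> 2 * k \<le> n + 1}"
  define ob where "ob S W h = (of_bool (hall_obstruction n (sel_edges A B m h) S W) :: real)" for S W h
  define c where "c k = real k ^ 4 * (995 / 1000 :: real) ^ k" for k
  have finK: "finite K" by (rule finite_subset[of _ "{..n+1}"]) (auto simp: K_def)
  have finSS: "finite (SS k)" "finite (WW k)" for k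
    using fin by (auto simp: SS_def WW_def)
  have "avg ((A \<union> B) \<times> UNIV) X
      (\<lambda>h. of_bool (\<exists>S W. S \<subseteq> A \<and> W \<subseteq> B \<and> hall_obstruction n (sel_edges A B m h) S W))
    \<le> avg ((A \<union> B) \<times> UNIV) X (\<lambda>h. \<Sum>k\<in>K. \<Sum>S\<in>SS k. \<Sum>W\<in>WW k. ob S W h)"
  proof (rule avg_mono)
    fix h :: "'a \<times> bool \<Rightarrow> 'a"
    show "of_bool (\<exists>S W. S \<subseteq> A \<and> W \<subseteq> B \<and> hall_obstruction n (sel_edges A B m h) S W)
        \<le> (\<Sum>k\<in>K. \<Sum>S\<in>SS k. \<Sum>W\<in>WW k. ob S W h)"
    proof (cases "\<exists>S W. S \<subseteq> A \<and> W \<subseteq> B \<and> hall_obstruction n (sel_edges A B m h) S W")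
      case True
      then obtain S W where SW: "S \<subseteq> A" "W \<subseteq> B" "hall_obstruction n (sel_edges A B m h) S W" by blast
      have mem: "card S \<in> K" "S \<in> SS (card S)" "W \<in> WW (card S)"
        using SW by (auto simp: K_def SS_def WW_def hall_obstruction_def)
      have "1 = ob S W h" using SW by (simp add: ob_def)
      also have "\<dots> \<le> (\<Sum>W\<in>WW (card S). ob S W h)"
        using mem finSS by (intro member_le_sum) (auto simp: ob_def)
      also have "\<dots> \<le> (\<Sum>S'\<in>SS (card S). \<Sum>W\<in>WW (card S). ob S' W h)"
        using mem finSS by (intro member_le_sum[of S "SS (card S)" "\<lambda>S'. \<Sum>W\<in>WW (card S). ob S' W h"])
          (auto simp: ob_def intro!: sum_nonneg)
      also have "\<dots> \<le> (\<Sum>k\<in>K. \<Sum>S\<in>SS k. \<Sum>W\<in>WW k. ob S W h)"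
        using mem finK by (intro member_le_sum[of "card S" K "\<lambda>k. \<Sum>S\<in>SS k. \<Sum>W\<in>WW k. ob S W h"])
          (auto simp: ob_def intro!: sum_nonneg)
      finally show ?thesis using True by simp
    next
      case False
      then show ?thesis by (auto simp: ob_def intro!: sum_nonneg)
    qed
  qed
  also have "\<dots> = (\<Sum>k\<in>K. \<Sum>S\<in>SS k. \<Sum>W\<in>WW k. avg ((A \<union> B) \<times> UNIV) X (ob S W))"
    by (simp add: avg_sum)
  also have "\<dots> \<le> (\<Sum>k\<in>K. 20000 / real n * c k)"
  proof (rule sum_mono)
    fix k assume k: "k \<in> K"
    then have k1: "1 \<le> k" "2 * k \<le> n + 1" "k < n" using n by (auto simp: K_def)
    define N where "N = real (n choose k) * real (n choose (k - 1))"
    have N: "N > 0" using k1 by (simp add: N_def)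
    \<comment> \<open>\<open>obstruction_term_le\<close> already includes the number
      \<open>N\<close> of pairs, so each single pair receives its bound divided by
      \<open>N\<close>.\<close>
    have "(\<Sum>S\<in>SS k. \<Sum>W\<in>WW k. avg ((A \<union> B) \<times> UNIV) X (ob S W))
        \<le> (\<Sum>S\<in>SS k. \<Sum>W\<in>WW k. (20000 / real n * c k) / N)"
    proof (intro sum_mono)
      fix S W assume "S \<in> SS k" "W \<in> WW k"
      then interpret hall_pair A B n m S W k
        using k1 by unfold_locales (auto simp: SS_def WW_def)
      have "N * avg ((A \<union> B) \<times> UNIV) X (ob S W) \<le> 20000 / real n * c k"
        using obstruction_term_le[OF n k1(2)] unfolding N_def ob_def[abs_def] c_def .
      then show "avg ((A \<union> B) \<times> UNIV) X (ob S W) \<le> (20000 / real n * c k) / N"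
        unfolding pos_le_divide_eq[OF N] by (simp only: mult.commute)
    qed
    also have "\<dots> = real (card (SS k)) * real (card (WW k)) * ((20000 / real n * c k) / N)" by simp
    also have "real (card (SS k)) * real (card (WW k)) = N"
      using n_subsets[OF fin(1), of k] n_subsets[OF fin(2), of "k - 1"] card_sides
      by (simp add: SS_def WW_def N_def)
    also have "N * ((20000 / real n * c k) / N) = 20000 / real n * c k" using N by simp
    finally show "(\<Sum>S\<in>SS k. \<Sum>W\<in>WW k. avg ((A \<union> B) \<times> UNIV) X (ob S W)) \<le> 20000 / real n * c k" .
  qed
  also have "\<dots> = 20000 / real n * (\<Sum>k\<in>K. c k)" by (simp add: sum_distrib_left)
  also have "\<dots> \<le> 20000 / real n * (\<Sum>k. c k)"
    using summable_power_geometric finK unfolding c_def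
    by (intro mult_left_mono sum_le_suminf) auto
  also have "\<dots> = obstruction_const / real n" by (simp add: obstruction_const_def c_def)
  finally show ?thesis .
qed

section \<open>Combining the two sides\<close>

lemma sel_edges_bipartite:
  assumes "A \<inter> B = {}" "h \<in> PiE ((A \<union> B) \<times> UNIV) (slot_range A B)" "{u, v} \<in> sel_edges A B m h"
  shows "u \<in> A \<and> v \<in> B \<or> u \<in> B \<and> v \<in> A"
proof -
  have opp: "h (w, b) \<in> opposite A B w" if "w \<in> A \<union> B" for w b
    using PiE_mem[OF assms(2), of "(w, b)"] that by simp
  obtain w b where w: "w \<in> A \<union> B" "{u, v} = {w, h (w, b)}"
    using assms(3) unfolding sel_edges_def unpopular_def by blast
  then have "u = w \<and> v = h (w, b) \<or> u = h (w, b) \<and> v = w" by (simp add: doubleton_eq_iff)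
  then show ?thesis using opp[OF w(1), of b] w(1) assms(1) by (auto simp: opposite_def split: if_splits)
qed

lemma sel_edges_commute: "sel_edges A B m h = sel_edges B A m h"
  by (simp add: sel_edges_def unpopular_def Un_commute)

lemma prob_no_perfect_matching_le:
  assumes fin: "finite V1" "finite V2" and card: "card V1 = n" "card V2 = n"
    and disj: "V1 \<inter> V2 = {}" and m: "m \<ge> 1" and n: "50 \<le> n"
  shows "1 - measure_pmf.prob (random_bipartite V1 V2 m) {E. has_perfect_matching n E}
    \<le> 2 * obstruction_const / real n"
proof -
  interpret s1: sides V1 V2 n m using assms by unfold_locales auto
  interpret s2: sides V2 V1 n m using assms by unfold_locales auto
  define I where "I = (V1 \<union> V2) \<times> (UNIV :: bool set)"
  define b1 where "b1 h = (of_bool (\<exists>S W. S \<subseteq> V1 \<and> W \<subseteq> V2 \<and> hall_obstruction n (sel_edges V1 V2 m h) S W) :: real)" for h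
  define b2 where "b2 h = (of_bool (\<exists>S W. S \<subseteq> V2 \<and> W \<subseteq> V1 \<and> hall_obstruction n (sel_edges V2 V1 m h) S W) :: real)" for h
  have ne: "V1 \<noteq> {}" "V2 \<noteq> {}" using card n by auto
  have "1 - measure_pmf.prob (random_bipartite V1 V2 m) {E. has_perfect_matching n E}
      = measure_pmf.prob (random_bipartite V1 V2 m) {E. \<not> has_perfect_matching n E}"
    using measure_pmf.prob_compl[of "{E. has_perfect_matching n E}" "random_bipartite V1 V2 m"]
    by (simp add: Collect_neg_eq Compl_eq_Diff_UNIV)
  also have "\<dots> = avg I (slot_range V1 V2) (\<lambda>h. of_bool (\<not> has_perfect_matching n (sel_edges V1 V2 m h)))"
    unfolding I_def using fin ne by (rule prob_random_bipartite)
  also have "\<dots> \<le> avg I (slot_range V1 V2) (\<lambda>h. \<Sum>b\<in>{True, False}. if b then b1 h else b2 h)"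
  proof (rule avg_mono)
    fix h assume h: "h \<in> PiE I (slot_range V1 V2)"
    show "of_bool (\<not> has_perfect_matching n (sel_edges V1 V2 m h)) \<le> (\<Sum>b\<in>{True, False}. if b then b1 h else b2 h)"
    proof (cases "has_perfect_matching n (sel_edges V1 V2 m h)")
      case False
      have "\<exists>S W. (S \<subseteq> V1 \<and> W \<subseteq> V2 \<or> S \<subseteq> V2 \<and> W \<subseteq> V1) \<and> hall_obstruction n (sel_edges V1 V2 m h) S W"
        using no_perfect_matching_imp_obstruction[OF fin card disj _ False]
          sel_edges_bipartite[OF disj h[unfolded I_def]] by blast
      then have "b1 h = 1 \<or> b2 h = 1" using sel_edges_commute[of V1 V2 m h] by (auto simp: b1_def b2_def)
      then show ?thesis by (auto simp: b1_def b2_def)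
    qed (simp add: b1_def b2_def)
  qed
  also have "\<dots> = avg I (slot_range V1 V2) b1 + avg I (slot_range V1 V2) b2"
    by (subst avg_sum) simp
  \<comment> \<open>The slot ranges for the exchanged sides agree on the slots in \<open>I\<close>,
    so the bound from \<open>s2\<close> applies.\<close>
  also have "avg I (slot_range V1 V2) b2 = avg ((V2 \<union> V1) \<times> UNIV) (slot_range V2 V1) b2"
  proof -
    have I: "I = (V2 \<union> V1) \<times> UNIV" by (simp add: I_def Un_commute)
    have X: "slot_range V1 V2 i = slot_range V2 V1 i" if "i \<in> I" for i
      using that disj by (intro opposite_commute) (auto simp: I_def)
    then have "PiE I (slot_range V1 V2) = PiE I (slot_range V2 V1)" by (intro PiE_cong)
    moreover have "(\<Prod>i\<in>I. real (card (slot_range V1 V2 i))) = (\<Prod>i\<in>I. real (card (slot_range V2 V1 i)))"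
      using X by simp
    ultimately show ?thesis unfolding avg_def I[symmetric] by simp
  qed
  also have "avg I (slot_range V1 V2) b1 + \<dots> \<le> obstruction_const / real n + obstruction_const / real n"
    unfolding I_def b1_def b2_def
    by (intro add_mono s1.avg_exists_obstruction_le s2.avg_exists_obstruction_le n)
  finally show ?thesis by simp
qed

section \<open>Connectivity\<close>

definition edge_closed :: "'a set set \<Rightarrow> 'a set \<Rightarrow> bool" where
  "edge_closed E S \<longleftrightarrow> (\<forall>u v. {u, v} \<in> E \<longrightarrow> (u \<in> S \<longleftrightarrow> v \<in> S))"

text \<open>Take the component of a vertex or its complement, whichever has at most \<open>n\<close>
  vertices. Both sides are met because every vertex selects a neighbour on the opposite
  side.\<close>

lemma disconnected_imp_edge_closed:
  assumes fin: "finite A" "finite B" and card: "card A = n" "card B = n" and n: "1 \<le> n"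
    and disj: "A \<inter> B = {}" and h: "h \<in> PiE ((A \<union> B) \<times> UNIV) (slot_range A B)"
    and no: "\<not> connected_graph (A \<union> B) (sel_edges A B m h)"
  shows "\<exists>S1 S2. S1 \<subseteq> A \<and> S2 \<subseteq> B \<and> S1 \<noteq> {} \<and> S2 \<noteq> {} \<and> card S1 + card S2 \<le> n \<and>
    edge_closed (sel_edges A B m h) (S1 \<union> S2)"
proof -
  define E where "E = sel_edges A B m h"
  define r where "r = {(x, y). {x, y} \<in> E}"
  note bip = sel_edges_bipartite[OF disj h, of _ _ m, folded E_def]
  have "A \<union> B \<noteq> {}" using card n by auto
  then obtain u v where uv: "u \<in> A \<union> B" "v \<in> A \<union> B" "(u, v) \<notin> r\<^sup>*"
    using no unfolding connected_graph_def r_def E_def by auto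
  define C where "C = {w \<in> A \<union> B. (u, w) \<in> r\<^sup>*}"
  have step: "y \<in> C" if "x \<in> C" "{x, y} \<in> E" for x y
  proof -
    have "(u, y) \<in> r\<^sup>*" using that by (auto simp: C_def r_def intro: rtrancl_into_rtrancl)
    moreover have "y \<in> A \<union> B" using bip[OF that(2)] by auto
    ultimately show ?thesis by (simp add: C_def)
  qed
  have clC: "edge_closed E C"
    unfolding edge_closed_def
  proof (intro allI impI iffI)
    fix x y assume xy: "{x, y} \<in> E"
    then have yx: "{y, x} \<in> E" by (simp add: insert_commute)
    show "y \<in> C" if "x \<in> C" using step[OF that xy] .
    show "x \<in> C" if "y \<in> C" using step[OF that yx] .
  qed
  have clD: "edge_closed E (A \<union> B - C)"
    unfolding edge_closed_def
  proof (intro allI impI)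
    fix x y assume xy: "{x, y} \<in> E"
    have "x \<in> C \<longleftrightarrow> y \<in> C" using clC xy unfolding edge_closed_def by simp
    then show "x \<in> A \<union> B - C \<longleftrightarrow> y \<in> A \<union> B - C" using bip[OF xy] by auto
  qed
  have CV: "C \<subseteq> A \<union> B" by (auto simp: C_def)
  have finC: "finite C" using CV fin by (auto intro: finite_subset)
  have "card (A \<union> B) = 2 * n" using fin card disj by (simp add: card_Un_disjoint)
  then have "card C + card (A \<union> B - C) = 2 * n"
    using CV finC fin card_mono[OF _ CV] by (simp add: card_Diff_subset)
  then have half: "card C \<le> n \<or> card (A \<union> B - C) \<le> n" by linarith
  have uC: "C \<noteq> {}" "A \<union> B - C \<noteq> {}" using uv by (auto simp: C_def)
  define S where "S = (if card C \<le> n then C else A \<union> B - C)"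
  have S: "S \<subseteq> A \<union> B" "S \<noteq> {}" "card S \<le> n" "edge_closed E S"
    using half uC clC clD CV by (auto simp: S_def)
  have finS: "finite S" using S(1) fin by (auto intro: finite_subset)
  obtain w where w: "w \<in> S" using S by auto
  have "{w, h (w, False)} \<in> E" using w S(1) by (auto simp: E_def sel_edges_def)
  then have "h (w, False) \<in> S" and "w \<in> A \<and> h (w, False) \<in> B \<or> w \<in> B \<and> h (w, False) \<in> A"
    using w S(4) bip[of w "h (w, False)"] by (simp_all add: edge_closed_def)
  then have "S \<inter> A \<noteq> {}" "S \<inter> B \<noteq> {}" using w by blast+
  moreover have "card (S \<inter> A) + card (S \<inter> B) = card S"
    using S(1) finS disj by (subst card_Un_disjoint[symmetric]) (auto intro!: arg_cong[of _ _ card])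
  moreover have "S \<inter> A \<union> S \<inter> B = S" using S(1) by auto
  ultimately show ?thesis using S(3,4) unfolding E_def
    by (intro exI[of _ "S \<inter> A"] exI[of _ "S \<inter> B"]) auto
qed

section \<open>Events attached to a fixed union of components\<close>

locale component = sides +
  fixes S1 S2 :: "'a set" and k1 k2 :: nat
  assumes S1: "S1 \<subseteq> A" and S2: "S2 \<subseteq> B" and card_S1: "card S1 = k1" and card_S2: "card S2 = k2"
    and k_pos: "1 \<le> k1" "1 \<le> k2" and k_sum: "k1 + k2 \<le> n"
begin

definition "S = S1 \<union> S2"
definition "target v = (if v \<in> A then if v \<in> S1 then S2 else B - S2 else if v \<in> S2 then S1 else A - S1)"
text \<open>Counts selectors inside \<open>S\<close> alone, so that it depends only on first
  selections of \<open>S\<close>; if no edge leaves \<open>S\<close> these are all the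
  selectors.\<close>

definition "few h = {v\<in>S. card {u\<in>S. h (u, False) = v} \<le> m}" for h :: "'a \<times> bool \<Rightarrow> 'a"

lemma finS: "finite S1" "finite S2" "finite S"
  using S1 S2 fin by (auto simp: S_def intro: finite_subset)

lemma card_S: "card S = k1 + k2"
  using S1 S2 disj finS card_S1 card_S2 by (auto simp: S_def intro!: card_Un_disjoint[THEN trans])

lemma n_pos: "0 < n" using k_pos k_sum by simp

text \<open>\<open>S\<close> makes one first selection per vertex, and each vertex outside
  \<open>few h\<close> absorbs at least two of them.\<close>

lemma card_few_ge: "k1 + k2 \<le> 2 * card (few h)"
proof -
  have fewS: "few h \<subseteq> S" by (auto simp: few_def)
  have "2 * card (S - few h) = (\<Sum>v\<in>S - few h. 2)" by simp
  also have "\<dots> \<le> (\<Sum>v\<in>S - few h. card {u\<in>S. h (u, False) = v})"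
    using m_pos by (intro sum_mono) (auto simp: few_def)
  also have "\<dots> = card (\<Union>v\<in>S - few h. {u\<in>S. h (u, False) = v})"
    using finS by (intro card_UN_disjoint[symmetric]) auto
  also have "\<dots> \<le> card S" using finS by (intro card_mono) auto
  finally have "2 * card (S - few h) \<le> card S" .
  moreover have "card (S - few h) = card S - card (few h)" "card (few h) \<le> card S"
    using fewS finS by (auto simp: card_Diff_subset finite_subset intro: card_mono)
  ultimately show ?thesis using card_S by simp
qed

lemma edge_closed_imp_target:
  assumes h: "h \<in> PiE ((A \<union> B) \<times> UNIV) X" and cl: "edge_closed (sel_edges A B m h) S"
  shows "\<forall>v\<in>A \<union> B. h (v, False) \<in> target v" "\<forall>v\<in>few h. h (v, True) \<in> target v"
proof -
  have hA: "h (v, b) \<in> B" if "v \<in> A" for v b using PiE_mem[OF h, of "(v, b)"] X_A that by auto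
  have hB: "h (v, b) \<in> A" if "v \<in> B" for v b using PiE_mem[OF h, of "(v, b)"] X_B that by auto
  have iff: "v \<in> S \<longleftrightarrow> h (v, b) \<in> S" if "{v, h (v, b)} \<in> sel_edges A B m h" for v b
    using cl that unfolding edge_closed_def by blast
  have tgt: "h (v, b) \<in> target v" if "v \<in> A \<union> B" "v \<in> S \<longleftrightarrow> h (v, b) \<in> S" for v b
    using that hA[of v b] hB[of v b] S1 S2 disj unfolding target_def S_def by auto
  have iff1: "v \<in> S \<longleftrightarrow> h (v, False) \<in> S" if "v \<in> A \<union> B" for v
    using that by (intro iff) (auto simp: sel_edges_def)
  show "\<forall>v\<in>A \<union> B. h (v, False) \<in> target v" using tgt iff1 by blast
  show "\<forall>v\<in>few h. h (v, True) \<in> target v"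
  proof
    fix v assume v: "v \<in> few h"
    then have vS: "v \<in> S" "v \<in> A \<union> B" using S1 S2 by (auto simp: few_def S_def)
    have "{u \<in> A \<union> B. h (u, False) = v} \<subseteq> {u\<in>S. h (u, False) = v}"
      using iff1 vS by auto
    then have "card {u \<in> A \<union> B. h (u, False) = v} \<le> card {u\<in>S. h (u, False) = v}"
      using finS by (intro card_mono) auto
    also have "\<dots> \<le> m" using v by (simp add: few_def)
    finally have "{v, h (v, True)} \<in> sel_edges A B m h"
      using vS by (auto simp: sel_edges_def unpopular_def)
    then show "h (v, True) \<in> target v" using tgt iff vS by blast
  qed
qed

lemma target_subset: "v \<in> A \<union> B \<Longrightarrow> target v \<subseteq> X (v, b)"
  using S1 S2 disj by (auto simp: target_def opposite_def)

lemma sum_target: "v \<in> A \<union> B \<Longrightarrow> (\<Sum>y\<in>X (v, b). of_bool (y \<in> target v)) / real (card (X (v, b)))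
    = real (card (target v)) / real n"
proof -
  assume v: "v \<in> A \<union> B"
  have "finite (X (v, b))" "card (X (v, b)) = n" using fin card_sides by (auto simp: opposite_def)
  then show ?thesis using target_subset[OF v, of b] by (simp add: Int_absorb1)
qed

text \<open>With the first round fixed, each vertex of \<open>few h\<close> makes its second
  selection inside \<open>S\<close> with probability at most \<open>s\<^sup>2\<close>. Introducing
  the square root \<open>s\<close> turns at least \<open>(k1 + k2) / 2\<close> such vertices into an
  integer power.\<close>

lemma avg_edge_closed_le:
  fixes s :: real
  assumes s: "0 \<le> s" "s\<^sup>2 = real (max k1 k2) / real n"
  shows "avg ((A \<union> B) \<times> UNIV) X (\<lambda>h. of_bool (edge_closed (sel_edges A B m h) S))
    \<le> ((real k2 / real n) ^ k1 * (real k1 / real n) ^ k2 *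
        (1 - real k2 / real n) ^ (n - k1) * (1 - real k1 / real n) ^ (n - k2)) * s ^ (k1 + k2)"
proof -
  define V where "V = A \<union> B"
  define F :: "('a \<times> bool \<Rightarrow> 'a) \<Rightarrow> real" where
    "F h = of_bool (\<forall>v\<in>V. h (v, False) \<in> target v) * of_bool (\<forall>v\<in>few h. h (v, True) \<in> target v)" for h
  have finV: "finite V" and SV: "S \<subseteq> V" using fin S1 S2 by (auto simp: V_def S_def)
  have Xf: "finite (X i) \<and> X i \<noteq> {}" for i using fin card_sides n_pos by (auto simp: opposite_def)
  have s1: "s \<le> 1"
  proof -
    have "s\<^sup>2 \<le> 1\<^sup>2" using s(2) k_pos k_sum n_pos by simp
    then show ?thesis by (rule power2_le_imp_le) simp
  qed
  have few_cong: "few h = few h'" if "\<And>v. v \<in> V \<Longrightarrow> h (v, False) = h' (v, False)" for h h'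
  proof -
    have "{u\<in>S. h (u, False) = v} = {u\<in>S. h' (u, False) = v}" for v using that SV by auto
    then show ?thesis by (simp add: few_def)
  qed
  have few_S: "few h \<subseteq> S" for h by (auto simp: few_def)
  have "avg (V \<times> UNIV) X (\<lambda>h. of_bool (edge_closed (sel_edges A B m h) S)) \<le> avg (V \<times> UNIV) X F"
    using edge_closed_imp_target by (intro avg_mono) (auto simp: F_def V_def)
  also have "avg (V \<times> UNIV) X F = avg (V \<times> {False}) X (\<lambda>h1. avg (V \<times> {True}) X
      (\<lambda>h2. F (\<lambda>i. if i \<in> V \<times> {False} then h1 i else h2 i)))"
  proof -
    have V2: "V \<times> UNIV = V \<times> {False} \<union> V \<times> {True}" by (auto simp: UNIV_bool)
    show ?thesis unfolding V2 using finV by (intro avg_Un) auto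
  qed
  also have "\<dots> \<le> avg (V \<times> {False}) X (\<lambda>h. s ^ (k1 + k2) * (\<Prod>i\<in>V \<times> {False}. of_bool (h i \<in> target (fst i))))"
  proof (rule avg_mono)
    fix h1 :: "'a \<times> bool \<Rightarrow> 'a"
    define p where "p = (\<Prod>i\<in>V \<times> {False}. of_bool (h1 i \<in> target (fst i)) :: real)"
    define \<phi> where "\<phi> i y = (of_bool (fst i \<in> few h1 \<longrightarrow> y \<in> target (fst i)) :: real)" for i :: "'a \<times> bool" and y
    have p: "p = of_bool (\<forall>v\<in>V. h1 (v, False) \<in> target v)"
      unfolding p_def using finV by (subst prod_of_bool) auto
    have "avg (V \<times> {True}) X (\<lambda>h2. F (\<lambda>i. if i \<in> V \<times> {False} then h1 i else h2 i))
        = avg (V \<times> {True}) X (\<lambda>h2. p * (\<Prod>i\<in>V \<times> {True}. \<phi> i (h2 i)))"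
    proof (rule avg_cong)
      fix h2 :: "'a \<times> bool \<Rightarrow> 'a"
      let ?h = "\<lambda>i. if i \<in> V \<times> {False} then h1 i else h2 i"
      have few: "few ?h = few h1" by (rule few_cong) auto
      have "(\<Prod>i\<in>V \<times> {True}. \<phi> i (h2 i)) = of_bool (\<forall>v\<in>few h1. h2 (v, True) \<in> target v)"
        unfolding \<phi>_def using finV few_S[of h1] SV by (subst prod_of_bool) auto
      then show "F ?h = p * (\<Prod>i\<in>V \<times> {True}. \<phi> i (h2 i))"
        unfolding F_def p few by simp
    qed
    also have "\<dots> = p * (\<Prod>i\<in>V \<times> {True}. (\<Sum>y\<in>X i. \<phi> i y) / real (card (X i)))"
      unfolding avg_cmult using finV Xf by (subst avg_prod) auto
    also have "(\<Prod>i\<in>V \<times> {True}. (\<Sum>y\<in>X i. \<phi> i y) / real (card (X i)))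
        \<le> (\<Prod>i\<in>V \<times> {True}. if fst i \<in> few h1 then s\<^sup>2 else 1)"
    proof (intro prod_mono conjI)
      fix i assume "i \<in> V \<times> {True}"
      then obtain v where v: "i = (v, True)" "v \<in> V" by auto
      show "0 \<le> (\<Sum>y\<in>X i. \<phi> i y) / real (card (X i))"
        by (intro divide_nonneg_nonneg sum_nonneg) (auto simp: \<phi>_def)
      show "(\<Sum>y\<in>X i. \<phi> i y) / real (card (X i)) \<le> (if fst i \<in> few h1 then s\<^sup>2 else 1)"
      proof (cases "v \<in> few h1")
        case True
        then have "v \<in> S" using few_S by auto
        then have "card (target v) \<le> max k1 k2"
          using S1 S2 disj card_S1 card_S2 by (auto simp: target_def S_def)
        then show ?thesis
          using sum_target[of v True] True v n_pos unfolding V_def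
          by (simp add: \<phi>_def s(2) divide_right_mono)
      next
        case False
        then show ?thesis using v Xf[of i] by (simp add: \<phi>_def)
      qed
    qed
    also have "(\<Prod>i\<in>V \<times> {True}. if fst i \<in> few h1 then s\<^sup>2 else 1) = (s\<^sup>2) ^ card (few h1)"
    proof -
      have "(\<Prod>i\<in>V \<times> {True}. if fst i \<in> few h1 then s\<^sup>2 else 1) = (\<Prod>v\<in>V. if v \<in> few h1 then s\<^sup>2 else 1)"
        by (rule prod.reindex_bij_witness[where i="\<lambda>v. (v, True)" and j=fst]) auto
      also have "V \<inter> few h1 = few h1" using few_S[of h1] SV by auto
      then have "(\<Prod>v\<in>V. if v \<in> few h1 then s\<^sup>2 else 1) = (s\<^sup>2) ^ card (few h1)"
        using finV by (simp add: prod.If_cases)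
      finally show ?thesis .
    qed
    also have "(s\<^sup>2) ^ card (few h1) \<le> s ^ (k1 + k2)"
      unfolding power_mult[symmetric] using card_few_ge[of h1] s s1 by (intro power_decreasing) auto
    finally show "avg (V \<times> {True}) X (\<lambda>h2. F (\<lambda>i. if i \<in> V \<times> {False} then h1 i else h2 i))
        \<le> s ^ (k1 + k2) * (\<Prod>i\<in>V \<times> {False}. of_bool (h1 i \<in> target (fst i)))"
      by (simp add: p_def[symmetric] p mult.commute)
  qed
  also have "\<dots> = s ^ (k1 + k2) * (\<Prod>i\<in>V \<times> {False}. real (card (target (fst i))) / real n)"
  proof -
    have "avg (V \<times> {False}) X (\<lambda>h. \<Prod>i\<in>V \<times> {False}. of_bool (h i \<in> target (fst i)))
        = (\<Prod>i\<in>V \<times> {False}. (\<Sum>y\<in>X i. of_bool (y \<in> target (fst i))) / real (card (X i)))"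
      using finV Xf by (intro avg_prod[where \<phi>="\<lambda>i y. of_bool (y \<in> target (fst i))"]) auto
    also have "\<dots> = (\<Prod>i\<in>V \<times> {False}. real (card (target (fst i))) / real n)"
      using sum_target by (intro prod.cong) (auto simp: V_def)
    finally show ?thesis by (simp add: avg_cmult)
  qed
  also have "(\<Prod>i\<in>V \<times> {False}. real (card (target (fst i))) / real n)
      = (\<Prod>v\<in>V. real (card (target v)) / real n)"
    by (rule prod.reindex_bij_witness[where i="\<lambda>v. (v, False)" and j=fst]) auto
  also have "\<dots> = (\<Prod>v\<in>A. real (card (target v)) / real n) * (\<Prod>v\<in>B. real (card (target v)) / real n)"
    unfolding V_def using fin disj by (intro prod.union_disjoint)
  also have "(\<Prod>v\<in>A. real (card (target v)) / real n)
      = (\<Prod>v\<in>A. if v \<in> S1 then real k2 / real n else 1 - real k2 / real n)"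
    using S2 finS card_S2 card_sides n_pos k_sum fin
    by (intro prod.cong) (auto simp: target_def card_Diff_subset of_nat_diff field_simps)
  also have "\<dots> = (real k2 / real n) ^ k1 * (1 - real k2 / real n) ^ (n - k1)"
  proof -
    have "A \<inter> S1 = S1" "A \<inter> - S1 = A - S1" using S1 by auto
    then show ?thesis using fin finS card_S1 card_sides S1 by (simp add: prod.If_cases card_Diff_subset)
  qed
  also have "(\<Prod>v\<in>B. real (card (target v)) / real n)
      = (\<Prod>v\<in>B. if v \<in> S2 then real k1 / real n else 1 - real k1 / real n)"
    using S1 finS card_S1 card_sides n_pos k_sum fin disj
    by (intro prod.cong) (auto simp: target_def card_Diff_subset of_nat_diff field_simps)
  also have "\<dots> = (real k1 / real n) ^ k2 * (1 - real k1 / real n) ^ (n - k2)"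
  proof -
    have "B \<inter> S2 = S2" "B \<inter> - S2 = B - S2" using S2 by auto
    then show ?thesis using fin finS card_S2 card_sides S2 by (simp add: prod.If_cases card_Diff_subset)
  qed
  finally show ?thesis by (simp add: V_def mult_ac)
qed

end

text \<open>Pair each binomial coefficient with its own Bernoulli weight, which makes it at most 1.
  The actual weights have \<open>x\<close> and \<open>y\<close> exchanged; the mismatch is
  \<open>((y / x) * ((1 - x) / (1 - y))) ^ (a - b)\<close>, whose second factor is at most
  1.\<close>

lemma first_round_le:
  assumes ab: "1 \<le> b" "b \<le> a" "a + b \<le> n"
  shows "real (n choose a) * real (n choose b) * ((real b / real n) ^ a * (real a / real n) ^ b *
      (1 - real b / real n) ^ (n - a) * (1 - real a / real n) ^ (n - b)) \<le> (real b / real a) ^ (a - b)"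
proof -
  define x where "x = real a / real n"
  define y where "y = real b / real n"
  define d where "d = a - b"
  have d: "a = b + d" "n - b = n - a + d" using ab by (auto simp: d_def)
  have x: "0 < x" "x < 1" and y: "0 < y" "y < 1" and xy: "y \<le> x"
    using ab by (auto simp: x_def y_def divide_right_mono)
  have 1: "real (n choose a) * x ^ a * (1 - x) ^ (n - a) \<le> 1"
    using ab x by (intro choose_mult_power_le) auto
  have 2: "real (n choose b) * y ^ b * (1 - y) ^ (n - b) \<le> 1"
    using ab y by (intro choose_mult_power_le) auto
  have "real (n choose a) * real (n choose b) * (y ^ a * x ^ b * (1 - y) ^ (n - a) * (1 - x) ^ (n - b))
      = (real (n choose a) * x ^ a * (1 - x) ^ (n - a)) * (real (n choose b) * y ^ b * (1 - y) ^ (n - b))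
         * ((y / x) ^ d * ((1 - x) / (1 - y)) ^ d)"
  proof -
    have "y ^ a = y ^ b * y ^ d" "x ^ a = x ^ b * x ^ d"
      "(1 - x) ^ (n - b) = (1 - x) ^ (n - a) * (1 - x) ^ d"
      "(1 - y) ^ (n - b) = (1 - y) ^ (n - a) * (1 - y) ^ d"
      unfolding d(2) by (subst d(1), simp add: power_add | simp add: power_add)+
    then show ?thesis using x y by (simp add: power_divide)
  qed
  also have "\<dots> \<le> (1 * 1) * ((y / x) ^ d * 1)"
    using 1 2 x y xy by (intro mult_mono power_le_one) auto
  also have "y / x = real b / real a" using ab by (simp add: x_def y_def)
  finally show ?thesis by (simp add: x_def y_def d_def)
qed

text \<open>If \<open>a\<close> is at most two thirds of \<open>n\<close>, the second-round factor
  decays, and one \<open>s\<^sup>2\<close> is set aside as \<open>a / n\<close> to supply 1/n. If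
  \<open>a\<close> is larger, \<open>a + b \<le> n\<close> forces \<open>b \<le> a / 2\<close>, the
  first-round factor decays, and 1/n is free because \<open>n \<le> 2 * a\<close>.\<close>

lemma component_rate_le:
  fixes s :: real
  assumes ab: "1 \<le> b" "b \<le> a" "a + b \<le> n" and s: "0 \<le> s" "s\<^sup>2 = real a / real n"
  shows "(real b / real a) ^ (a - b) * s ^ (a + b)
    \<le> 2 / real n * ((real a ^ 4 * (995 / 1000) ^ a) * (real b ^ 4 * (995 / 1000) ^ b))"
proof -
  \<comment> \<open>Chosen so that \<open>c = d\<^sup>2\<close> satisfies
    \<open>c\<^sup>2 \<ge> 2/3\<close> for the first case and \<open>c ^ 3 \<ge> 1/2\<close> for the
    second; \<open>b \<le> a\<close> later shares the decay between \<open>a\<close> and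
    \<open>b\<close>.\<close>
  define d :: real where "d = 91 / 100"
  define c where "c = d\<^sup>2"
  have c: "0 < c" "c \<le> 1" "1 \<le> 2 * c" "2 / 3 \<le> c\<^sup>2" "1 / 2 \<le> c ^ 3"
    by (simp_all add: c_def d_def power2_eq_square power3_eq_cube)
  have an: "real a / real n \<le> 1" "0 \<le> real a / real n" using ab by auto
  have s1: "s \<le> 1"
  proof -
    have "s\<^sup>2 \<le> 1\<^sup>2" using s(2) an by simp
    then show ?thesis by (rule power2_le_imp_le) simp
  qed
  have ba: "0 \<le> real b / real a" "real b / real a \<le> 1" using ab by auto
  have n0: "0 < real n" and a0: "0 < real a" using ab by auto
  have ca: "0 \<le> c ^ a" using c(1) by simp
  have "(real b / real a) ^ (a - b) * s ^ (a + b) \<le> 2 * (real a / real n) * c ^ a"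
  proof (cases "3 * a \<le> 2 * n")
    case True
    have "3 * real a \<le> 2 * real n" using True by linarith
    then have "real a / real n \<le> 2 / 3" using n0 by (simp add: pos_divide_le_eq)
    then have "s\<^sup>2 \<le> c\<^sup>2" using s(2) c(4) by linarith
    then have sc: "s \<le> c" by (rule power2_le_imp_le) (use c(1) in simp)
    have "(real b / real a) ^ (a - b) \<le> 1" using ba by (rule power_le_one)
    moreover have "s ^ (a + b) \<le> s ^ (2 + (a - 1))"
      using ab s(1) s1 by (intro power_decreasing) linarith+
    ultimately have "(real b / real a) ^ (a - b) * s ^ (a + b) \<le> 1 * s ^ (2 + (a - 1))"
      using s(1) by (intro mult_mono zero_le_power) auto
    also have "\<dots> = s\<^sup>2 * s ^ (a - 1)" unfolding power_add by (rule mult_1)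
    also have "\<dots> \<le> s\<^sup>2 * c ^ (a - 1)"
      using s(1) sc by (intro mult_left_mono power_mono) auto
    also have "\<dots> \<le> s\<^sup>2 * (2 * c ^ a)"
    proof (intro mult_left_mono)
      have eq: "c ^ a = c * c ^ (a - 1)" by (rule power_eq_if[THEN trans]) (use ab in simp)
      have "1 * c ^ (a - 1) \<le> (2 * c) * c ^ (a - 1)"
        using c(1,3) by (intro mult_right_mono) auto
      then show "c ^ (a - 1) \<le> 2 * c ^ a" unfolding eq by linarith
    qed auto
    also have "\<dots> = 2 * (real a / real n) * c ^ a" by (simp add: s(2))
    finally show ?thesis .
  next
    case False
    have ba2: "2 * b \<le> a" and ba3: "a \<le> 3 * (a - b)" using False ab by linarith+
    have "2 * real b \<le> real a" using ba2 by linarith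
    then have half: "real b / real a \<le> 1 / 2" using a0 by (simp add: pos_divide_le_eq)
    have "(real b / real a) ^ (a - b) * s ^ (a + b) \<le> (c ^ 3) ^ (a - b) * 1"
    proof (intro mult_mono power_le_one power_mono)
      show "real b / real a \<le> c ^ 3" using half c(5) by linarith
    qed (use ba s(1) s1 c(1) in auto)
    also have "\<dots> = c ^ (3 * (a - b))" by (simp add: power_mult)
    also have "\<dots> \<le> c ^ a" using c(1,2) ba3 by (intro power_decreasing) auto
    also have "\<dots> \<le> 2 * (real a / real n) * c ^ a"
    proof -
      have "real n \<le> 2 * real a" using False ab by linarith
      then have "1 \<le> 2 * (real a / real n)" using n0 by (simp add: pos_le_divide_eq)
      then have "1 * c ^ a \<le> 2 * (real a / real n) * c ^ a" using ca by (rule mult_right_mono)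
      then show ?thesis by simp
    qed
    finally show ?thesis .
  qed
  also have "\<dots> \<le> 2 * (real a / real n) * (d ^ a * d ^ b)"
  proof (intro mult_left_mono)
    show "c ^ a \<le> d ^ a * d ^ b"
      unfolding c_def power_mult[symmetric] power_add[symmetric] using ab
      by (intro power_decreasing) (auto simp: d_def)
  qed (use an in auto)
  also have "2 * (real a / real n) * (d ^ a * d ^ b) = 2 / real n * ((real a * d ^ a) * d ^ b)" by simp
  \<comment> \<open>A crude weakening that reuses the series already shown summable for the
    matching.\<close>
  also have "\<dots> \<le> 2 / real n * ((real a ^ 4 * (995 / 1000) ^ a) * (real b ^ 4 * (995 / 1000) ^ b))"
  proof (rule mult_left_mono, rule mult_mono)
    show "real a * d ^ a \<le> real a ^ 4 * (995 / 1000) ^ a"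
      using ab power_increasing[of 1 4 "real a"] by (intro mult_mono power_mono) (auto simp: d_def)
    have "1 * d ^ b \<le> real b ^ 4 * (995 / 1000) ^ b"
      using ab by (intro mult_mono power_mono) (auto simp: d_def)
    then show "d ^ b \<le> real b ^ 4 * (995 / 1000) ^ b" by simp
  qed (auto simp: d_def)
  finally show ?thesis .
qed

lemma (in component) component_term_le:
  "real (n choose k1) * real (n choose k2) *
      avg ((A \<union> B) \<times> UNIV) X (\<lambda>h. of_bool (edge_closed (sel_edges A B m h) (S1 \<union> S2)))
    \<le> 2 / real n * ((real k1 ^ 4 * (995 / 1000) ^ k1) * (real k2 ^ 4 * (995 / 1000) ^ k2))"
proof -
  define s where "s = sqrt (real (max k1 k2) / real n)"
  have s: "0 \<le> s" "s\<^sup>2 = real (max k1 k2) / real n" by (simp_all add: s_def)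
  define f where "f = (real k2 / real n) ^ k1 * (real k1 / real n) ^ k2 *
        (1 - real k2 / real n) ^ (n - k1) * (1 - real k1 / real n) ^ (n - k2)"
  have "real (n choose k1) * real (n choose k2) *
      avg ((A \<union> B) \<times> UNIV) X (\<lambda>h. of_bool (edge_closed (sel_edges A B m h) (S1 \<union> S2)))
    \<le> real (n choose k1) * real (n choose k2) * (f * s ^ (k1 + k2))"
    using avg_edge_closed_le[OF s] unfolding f_def S_def by (intro mult_left_mono) auto
  also have "\<dots> = (real (n choose k1) * real (n choose k2) * f) * s ^ (k1 + k2)" by simp
  also have "\<dots> \<le> 2 / real n * ((real k1 ^ 4 * (995 / 1000) ^ k1) * (real k2 ^ 4 * (995 / 1000) ^ k2))"
  proof (cases "k2 \<le> k1")
    case True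
    have "(real (n choose k1) * real (n choose k2) * f) * s ^ (k1 + k2)
        \<le> (real k2 / real k1) ^ (k1 - k2) * s ^ (k1 + k2)"
      unfolding f_def using k_pos k_sum True s by (intro mult_right_mono first_round_le) auto
    also have "\<dots> \<le> 2 / real n * ((real k1 ^ 4 * (995 / 1000) ^ k1) * (real k2 ^ 4 * (995 / 1000) ^ k2))"
      using k_pos k_sum True s by (intro component_rate_le) auto
    finally show ?thesis .
  next
    case False
    have "(real (n choose k1) * real (n choose k2) * f) * s ^ (k1 + k2)
      = (real (n choose k2) * real (n choose k1) * ((real k1 / real n) ^ k2 * (real k2 / real n) ^ k1 *
        (1 - real k1 / real n) ^ (n - k2) * (1 - real k2 / real n) ^ (n - k1))) * s ^ (k2 + k1)"
      by (simp only: f_def mult_ac add.commute)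
    also have "\<dots> \<le> (real k1 / real k2) ^ (k2 - k1) * s ^ (k2 + k1)"
      using k_pos k_sum False s by (intro mult_right_mono first_round_le) auto
    also have "\<dots> \<le> 2 / real n * ((real k2 ^ 4 * (995 / 1000) ^ k2) * (real k1 ^ 4 * (995 / 1000) ^ k1))"
      using k_pos k_sum False s by (intro component_rate_le) auto
    finally show ?thesis by (simp only: mult.commute)
  qed
  finally show ?thesis .
qed

definition "component_const = 2 * (\<Sum>k. real k ^ 4 * (995 / 1000 :: real) ^ k)\<^sup>2"

lemma prob_disconnected_le:
  assumes fin: "finite V1" "finite V2" and card: "card V1 = n" "card V2 = n"
    and disj: "V1 \<inter> V2 = {}" and m: "m \<ge> 1" and n: "1 \<le> n"
  shows "1 - measure_pmf.prob (random_bipartite V1 V2 m) {E. connected_graph (V1 \<union> V2) E}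
    \<le> component_const / real n"
proof -
  interpret sides V1 V2 n m using assms by unfold_locales auto
  define SS where "SS k = {S. S \<subseteq> V1 \<and> card S = fst k}" for k :: "nat \<times> nat"
  define WW where "WW k = {S. S \<subseteq> V2 \<and> card S = snd k}" for k :: "nat \<times> nat"
  define K where "K = {k. 1 \<le> fst k \<and> 1 \<le> snd k \<and> fst k + snd k \<le> n}"
  define ob where "ob S W h = (of_bool (edge_closed (sel_edges V1 V2 m h) (S \<union> W)) :: real)" for S W h
  define c where "c k = real k ^ 4 * (995 / 1000 :: real) ^ k" for k
  define I where "I = (V1 \<union> V2) \<times> (UNIV :: bool set)"
  have ne: "V1 \<noteq> {}" "V2 \<noteq> {}" using card n by auto
  have Ksub: "K \<subseteq> {..n} \<times> {..n}" by (auto simp: K_def)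
  have finK: "finite K" by (rule finite_subset[OF Ksub]) auto
  have finSS: "finite (SS k)" "finite (WW k)" for k
    using fin by (auto simp: SS_def WW_def)
  have c0: "0 \<le> c k" for k by (simp add: c_def)
  have "1 - measure_pmf.prob (random_bipartite V1 V2 m) {E. connected_graph (V1 \<union> V2) E}
      = measure_pmf.prob (random_bipartite V1 V2 m) {E. \<not> connected_graph (V1 \<union> V2) E}"
    using measure_pmf.prob_compl[of "{E. connected_graph (V1 \<union> V2) E}" "random_bipartite V1 V2 m"]
    by (simp add: Collect_neg_eq Compl_eq_Diff_UNIV)
  also have "\<dots> = avg I X (\<lambda>h. of_bool (\<not> connected_graph (V1 \<union> V2) (sel_edges V1 V2 m h)))"
    unfolding I_def using fin ne by (rule prob_random_bipartite)
  also have "\<dots> \<le> avg I X (\<lambda>h. \<Sum>k\<in>K. \<Sum>S\<in>SS k. \<Sum>W\<in>WW k. ob S W h)"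
  proof (rule avg_mono)
    fix h assume h: "h \<in> PiE I X"
    show "of_bool (\<not> connected_graph (V1 \<union> V2) (sel_edges V1 V2 m h))
        \<le> (\<Sum>k\<in>K. \<Sum>S\<in>SS k. \<Sum>W\<in>WW k. ob S W h)"
    proof (cases "connected_graph (V1 \<union> V2) (sel_edges V1 V2 m h)")
      case False
      obtain S W where SW: "S \<subseteq> V1" "W \<subseteq> V2" "S \<noteq> {}" "W \<noteq> {}" "card S + card W \<le> n"
          "edge_closed (sel_edges V1 V2 m h) (S \<union> W)"
        using disconnected_imp_edge_closed[OF fin card n disj h[unfolded I_def] False] by blast
      have "finite S" "finite W" using SW(1,2) fin by (auto intro: finite_subset)
      then have "1 \<le> card S" "1 \<le> card W" using SW(3,4) by (simp_all add: Suc_le_eq card_gt_0_iff)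
      then have mem: "(card S, card W) \<in> K" "S \<in> SS (card S, card W)" "W \<in> WW (card S, card W)"
        using SW by (auto simp: K_def SS_def WW_def)
      let ?k = "(card S, card W)"
      have "1 = ob S W h" using SW by (simp add: ob_def)
      also have "\<dots> \<le> (\<Sum>W'\<in>WW ?k. ob S W' h)"
        using mem finSS by (intro member_le_sum) (auto simp: ob_def)
      also have "\<dots> \<le> (\<Sum>S'\<in>SS ?k. \<Sum>W'\<in>WW ?k. ob S' W' h)"
        using mem finSS by (intro member_le_sum[of S "SS ?k" "\<lambda>S'. \<Sum>W'\<in>WW ?k. ob S' W' h"])
          (auto simp: ob_def intro!: sum_nonneg)
      also have "\<dots> \<le> (\<Sum>k\<in>K. \<Sum>S\<in>SS k. \<Sum>W\<in>WW k. ob S W h)"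
        using mem finK by (intro member_le_sum[of ?k K "\<lambda>k. \<Sum>S\<in>SS k. \<Sum>W\<in>WW k. ob S W h"])
          (auto simp: ob_def intro!: sum_nonneg)
      finally show ?thesis using False by simp
    next
      case True
      then show ?thesis by (auto simp: ob_def intro!: sum_nonneg)
    qed
  qed
  also have "\<dots> = (\<Sum>k\<in>K. \<Sum>S\<in>SS k. \<Sum>W\<in>WW k. avg I X (ob S W))"
    by (simp add: avg_sum)
  also have "\<dots> \<le> (\<Sum>k\<in>K. 2 / real n * (c (fst k) * c (snd k)))"
  proof (rule sum_mono)
    fix k assume k: "k \<in> K"
    define N where "N = real (n choose fst k) * real (n choose snd k)"
    have N: "N > 0" using k by (simp add: N_def K_def)
    have "(\<Sum>S\<in>SS k. \<Sum>W\<in>WW k. avg I X (ob S W))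
        \<le> (\<Sum>S\<in>SS k. \<Sum>W\<in>WW k. (2 / real n * (c (fst k) * c (snd k))) / N)"
    proof (intro sum_mono)
      fix S W assume "S \<in> SS k" "W \<in> WW k"
      then interpret component V1 V2 n m S W "fst k" "snd k"
        using k by unfold_locales (auto simp: SS_def WW_def K_def)
      have "N * avg I X (ob S W) \<le> 2 / real n * (c (fst k) * c (snd k))"
        using component_term_le unfolding N_def ob_def[abs_def] c_def I_def .
      then show "avg I X (ob S W) \<le> (2 / real n * (c (fst k) * c (snd k))) / N"
        unfolding pos_le_divide_eq[OF N] by (simp only: mult.commute)
    qed
    also have "\<dots> = real (card (SS k)) * real (card (WW k)) * ((2 / real n * (c (fst k) * c (snd k))) / N)" by simp
    also have "real (card (SS k)) * real (card (WW k)) = N"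
      using n_subsets[OF fin(1), of "fst k"] n_subsets[OF fin(2), of "snd k"] card
      by (simp add: SS_def WW_def N_def)
    also have "N * ((2 / real n * (c (fst k) * c (snd k))) / N) = 2 / real n * (c (fst k) * c (snd k))"
      using N by simp
    finally show "(\<Sum>S\<in>SS k. \<Sum>W\<in>WW k. avg I X (ob S W)) \<le> 2 / real n * (c (fst k) * c (snd k))" .
  qed
  \<comment> \<open>Enlarging the index set to a square makes the double sum factorise.\<close>
  also have "\<dots> \<le> (\<Sum>k\<in>{..n} \<times> {..n}. 2 / real n * (c (fst k) * c (snd k)))"
    using Ksub c0 by (intro sum_mono2) auto
  also have "\<dots> = 2 / real n * (\<Sum>k\<le>n. c k)\<^sup>2"
    unfolding power2_eq_square sum_product
    by (simp only: sum.cartesian_product sum_distrib_left case_prod_unfold)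
  also have "\<dots> \<le> 2 / real n * (\<Sum>k. c k)\<^sup>2"
    using summable_power_geometric c0 unfolding c_def
    by (intro mult_left_mono power_mono sum_le_suminf sum_nonneg) auto
  also have "\<dots> = component_const / real n" by (simp add: component_const_def c_def)
  finally show ?thesis .
qed

section \<open>The exponent\<close>

definition c_slope :: "nat \<Rightarrow> real" where
  "c_slope m = 1 + exp (-1) * (\<Sum>j=0..m. 1 / fact j) - ln 2"

lemma c_exp_eq: "c_exp m = 1 - 1.5 / (1 + (real m + 1) * c_slope m)"
  by (simp add: c_exp_def c_slope_def)

lemma c_slope_ge: "1 - ln 2 \<le> c_slope m"
proof -
  have "0 \<le> exp (-1) * (\<Sum>j=0..m. 1 / fact j :: real)" by (intro mult_nonneg_nonneg sum_nonneg) auto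
  then show ?thesis unfolding c_slope_def by linarith
qed

lemma c_slope_pos: "0 < c_slope m"
  using c_slope_ge[of m] ln_2_less_1 by linarith

lemma mono_c_slope: "mono c_slope"
proof (rule monoI)
  fix m n :: nat assume "m \<le> n"
  then have "(\<Sum>j=0..m. 1 / fact j :: real) \<le> (\<Sum>j=0..n. 1 / fact j)" by (intro sum_mono2) auto
  then have "exp (-1) * (\<Sum>j=0..m. 1 / fact j :: real) \<le> exp (-1) * (\<Sum>j=0..n. 1 / fact j)"
    by (intro mult_left_mono) auto
  then show "c_slope m \<le> c_slope n" unfolding c_slope_def by linarith
qed

lemma c_exp_le_1: "c_exp m \<le> 1"
  using c_slope_pos[of m] by (simp add: c_exp_eq)

lemma strict_mono_c_exp: "strict_mono c_exp"
proof (rule strict_monoI)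
  fix m n :: nat assume mn: "m < n"
  have "(real m + 1) * c_slope m < (real n + 1) * c_slope n"
    using mn c_slope_pos[of m] monoD[OF mono_c_slope, of m n]
    by (intro mult_less_le_imp_less) auto
  moreover have "0 \<le> (real m + 1) * c_slope m" using c_slope_pos[of m] by simp
  ultimately have "1.5 / (1 + (real n + 1) * c_slope n) < 1.5 / (1 + (real m + 1) * c_slope m)"
    by (intro divide_strict_left_mono mult_pos_pos) linarith+
  then show "c_exp m < c_exp n" unfolding c_exp_eq by linarith
qed

text \<open>\<open>c_slope\<close> stays above the positive constant \<open>1 - ln 2\<close>, so the
  denominator grows at least linearly in \<open>m\<close>.\<close>

lemma c_exp_tendsto: "c_exp \<longlonglongrightarrow> 1"
proof -
  have l: "0 < 1 - ln (2::real)" using ln_2_less_1 by simp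
  have "(\<lambda>m. 1.5 / (1 - ln 2) * inverse (real (Suc m))) \<longlonglongrightarrow> 1.5 / (1 - ln 2) * 0"
    by (rule tendsto_mult_left[OF LIMSEQ_inverse_real_of_nat])
  then have lim: "(\<lambda>m. 1.5 / (1 - ln 2) * inverse (real (Suc m))) \<longlonglongrightarrow> 0" by simp
  have "(\<lambda>m. 1.5 / (1 + (real m + 1) * c_slope m)) \<longlonglongrightarrow> 0"
  proof (rule tendsto_sandwich[OF _ _ tendsto_const lim]; intro always_eventually allI)
    fix m
    have "(1 - ln 2) * real (Suc m) \<le> c_slope m * real (Suc m)"
      by (rule mult_right_mono[OF c_slope_ge]) simp
    also have "\<dots> = (real m + 1) * c_slope m" by (simp add: mult.commute add.commute)
    finally have le: "(1 - ln 2) * real (Suc m) \<le> 1 + (real m + 1) * c_slope m" by linarith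
    have pos: "0 < (1 - ln 2) * real (Suc m)" using l by (intro mult_pos_pos) auto
    show "0 \<le> 1.5 / (1 + (real m + 1) * c_slope m)" using le pos by (intro divide_nonneg_nonneg) linarith+
    have "1.5 / (1 + (real m + 1) * c_slope m) \<le> 1.5 / ((1 - ln 2) * real (Suc m))"
      by (rule frac_le[OF _ order_refl pos le]) simp
    then show "1.5 / (1 + (real m + 1) * c_slope m) \<le> 1.5 / (1 - ln 2) * inverse (real (Suc m))"
      by (simp only: divide_inverse inverse_mult_distrib mult.assoc)
  qed
  then have "(\<lambda>m. 1 - 1.5 / (1 + (real m + 1) * c_slope m)) \<longlonglongrightarrow> 1 - 0"
    by (rule tendsto_diff[OF tendsto_const])
  then have "(\<lambda>m. c_exp m) \<longlonglongrightarrow> 1 - 0" unfolding c_exp_eq .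
  then show ?thesis by simp
qed

lemma c_exp_1_approx: "\<bar>c_exp 1 - 0.514\<bar> < 0.0005"
proof -
  define D where "D = 3 + 4 * exp (-1) - 2 * ln (2::real)"
  have c: "c_exp 1 = 1 - 1.5 / D"
    by (simp add: c_exp_def D_def algebra_simps)
  have e: "3678 / 10000 \<le> exp (-1 :: real)" "exp (-1 :: real) \<le> 368 / 1000"
    using exp_numeric_bounds(3,6) by (simp_all add: exp_minus field_simps)
  have "2 \<le> exp (6935 / 10000 :: real)"
    using exp_partial_sum_le[of "6935 / 10000" 6] by (simp add: atMost_nat_numeral fact_numeral power_divide)
  then have l1: "ln 2 \<le> (6935 / 10000 :: real)" using ln_le_cancel_iff[of 2 "exp (6935 / 10000 :: real)"] by simp
  have "exp (692 / 1000 :: real) \<le> 2"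
    using exp_upper_taylor[of "692 / 1000" 6] by (simp add: lessThan_nat_numeral fact_numeral power_divide)
  then have l2: "692 / 1000 \<le> ln (2 :: real)" using ln_ge_iff[of 2 "692 / 1000"] by linarith
  have D: "30833 / 10000 < D" "D < 30895 / 10000" using e l1 l2 unfolding D_def by linarith+
  have dec: "(1.5 :: real) = 3 / 2" "(0.514 :: real) = 514 / 1000" "(0.0005 :: real) = 5 / 10000"
    by simp_all
  have "3 / 2 / D < 4865 / 10000" using D by (simp add: field_simps)
  moreover have "4855 / 10000 < 3 / 2 / D" using D by (simp add: field_simps)
  ultimately show ?thesis unfolding c dec by linarith
qed

text \<open>The step from the rate 1/n to the claimed one, with the o(1) term identically 0; the
  explicit \<open>+ 0\<close> preserves the shape of the exponent for that witness.\<close>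

lemma inverse_in_bigo_c_exp: "(\<lambda>n. C / real n) \<in> O(\<lambda>n. real n powr (- c_exp m + 0))"
proof (rule bigoI[of _ "\<bar>C\<bar>"], rule eventually_mono[OF eventually_gt_at_top[of 0]])
  fix n :: nat assume n: "0 < n"
  have "1 / real n = real n powr (- 1)" using n by (simp add: powr_minus_divide)
  also have "\<dots> \<le> real n powr (- c_exp m + 0)" using n c_exp_le_1[of m] by (intro powr_mono) auto
  finally have "\<bar>C\<bar> * (1 / real n) \<le> \<bar>C\<bar> * real n powr (- c_exp m + 0)" by (intro mult_left_mono) auto
  then show "norm (C / real n) \<le> \<bar>C\<bar> * norm (real n powr (- c_exp m + 0))" by simp
qed

theorem theorem1:
  fixes V1 V2 :: "nat \<Rightarrow> 'a set" and m :: nat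
  assumes "m \<ge> 1"
    and "\<And>n. finite (V1 n)" and "\<And>n. finite (V2 n)"
    and "\<And>n. card (V1 n) = n" and "\<And>n. card (V2 n) = n"
    and "\<And>n. V1 n \<inter> V2 n = {}"
  shows
    "(\<exists>\<epsilon> g :: nat \<Rightarrow> real. \<epsilon> \<longlonglongrightarrow> 0 \<and> g \<in> O(\<lambda>n. real n powr (- c_exp m + \<epsilon> n)) \<and>
        (\<forall>\<^sub>F n in sequentially.
           measure_pmf.prob (random_bipartite (V1 n) (V2 n) m) {E. has_perfect_matching n E}
             \<ge> 1 - g n)) \<and>
     (\<exists>\<epsilon> :: nat \<Rightarrow> real. \<epsilon> \<longlonglongrightarrow> 0 \<and>
        (\<lambda>n. 1 - measure_pmf.prob (random_bipartite (V1 n) (V2 n) m)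
                   {E. connected_graph (V1 n \<union> V2 n) E})
          \<in> O(\<lambda>n. real n powr (- c_exp m + \<epsilon> n))) \<and>
     \<bar>c_exp 1 - 0.514\<bar> < 0.0005 \<and>
     strict_mono_on {1..} c_exp \<and> c_exp \<longlonglongrightarrow> 1"
proof (intro conjI)
  have "1 - 2 * obstruction_const / real n
      \<le> measure_pmf.prob (random_bipartite (V1 n) (V2 n) m) {E. has_perfect_matching n E}" if "50 \<le> n" for n
    using prob_no_perfect_matching_le[OF assms(2-6,1) that] by linarith
  then have "\<forall>\<^sub>F n in sequentially. 1 - 2 * obstruction_const / real n
      \<le> measure_pmf.prob (random_bipartite (V1 n) (V2 n) m) {E. has_perfect_matching n E}"
    by (rule eventually_sequentiallyI)
  then have "(\<lambda>_. 0 :: real) \<longlonglongrightarrow> 0 \<and>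
      (\<lambda>n. 2 * obstruction_const / real n) \<in> O(\<lambda>n. real n powr (- c_exp m + 0)) \<and>
      (\<forall>\<^sub>F n in sequentially. measure_pmf.prob (random_bipartite (V1 n) (V2 n) m) {E. has_perfect_matching n E}
         \<ge> 1 - 2 * obstruction_const / real n)"
    using inverse_in_bigo_c_exp by simp
  then show "\<exists>\<epsilon> g :: nat \<Rightarrow> real. \<epsilon> \<longlonglongrightarrow> 0 \<and> g \<in> O(\<lambda>n. real n powr (- c_exp m + \<epsilon> n)) \<and>
        (\<forall>\<^sub>F n in sequentially.
           measure_pmf.prob (random_bipartite (V1 n) (V2 n) m) {E. has_perfect_matching n E}
             \<ge> 1 - g n)"
    by - (rule exI[of _ "\<lambda>_. 0"], rule exI[of _ "\<lambda>n. 2 * obstruction_const / real n"], assumption)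
  have "(\<lambda>n. 1 - measure_pmf.prob (random_bipartite (V1 n) (V2 n) m)
      {E. connected_graph (V1 n \<union> V2 n) E}) \<in> O(\<lambda>n. component_const / real n)"
  proof (rule bigoI[of _ 1], rule eventually_sequentiallyI[of 1])
    fix n :: nat assume n: "1 \<le> n"
    have "1 - measure_pmf.prob (random_bipartite (V1 n) (V2 n) m) {E. connected_graph (V1 n \<union> V2 n) E}
        \<le> component_const / real n"
      by (rule prob_disconnected_le[OF assms(2-6,1) n])
    \<comment> \<open>Nonnegativity of the failure probability turns the one-sided estimate into a
      bound on its norm.\<close>
    moreover have "measure_pmf.prob (random_bipartite (V1 n) (V2 n) m)
        {E. connected_graph (V1 n \<union> V2 n) E} \<le> 1" by (rule measure_pmf.prob_le_1)
    ultimately show "norm (1 - measure_pmf.prob (random_bipartite (V1 n) (V2 n) m)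
        {E. connected_graph (V1 n \<union> V2 n) E}) \<le> 1 * norm (component_const / real n)"
      unfolding real_norm_def by linarith
  qed
  then have "(\<lambda>n. 1 - measure_pmf.prob (random_bipartite (V1 n) (V2 n) m)
      {E. connected_graph (V1 n \<union> V2 n) E}) \<in> O(\<lambda>n. real n powr (- c_exp m + 0))"
    using inverse_in_bigo_c_exp by (rule landau_o.big_trans)
  then have "(\<lambda>_. 0 :: real) \<longlonglongrightarrow> 0 \<and> (\<lambda>n. 1 - measure_pmf.prob (random_bipartite (V1 n) (V2 n) m)
      {E. connected_graph (V1 n \<union> V2 n) E}) \<in> O(\<lambda>n. real n powr (- c_exp m + 0))"
    by simp
  then show "\<exists>\<epsilon> :: nat \<Rightarrow> real. \<epsilon> \<longlonglongrightarrow> 0 \<and>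
        (\<lambda>n. 1 - measure_pmf.prob (random_bipartite (V1 n) (V2 n) m)
                   {E. connected_graph (V1 n \<union> V2 n) E})
          \<in> O(\<lambda>n. real n powr (- c_exp m + \<epsilon> n))"
    by - (rule exI[of _ "\<lambda>_. 0"], assumption)
  show "\<bar>c_exp 1 - 0.514\<bar> < 0.0005" by (rule c_exp_1_approx)
  show "strict_mono_on {1..} c_exp" using strict_mono_c_exp by (auto simp: strict_mono_on_def strict_mono_def)
  show "c_exp \<longlonglongrightarrow> 1" by (rule c_exp_tendsto)
qed

end
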